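(* Let $M$ be a $\mu$-space and let $X$ be a dense subset of $M$. (A) The following assertions are equivalent: (i) for every locally convex topology $\mathcal{T}$ on $C(M)$ satisfying $\mathcal{T}_{p\restriction X}\subseteq\mathcal{T}\subseteq\mathcal{T}_{k\restriction X}$, the space $C_{\mathcal{T}}(M)$ is strongly Gelfand--Phillips; (ii) there is a locally convex topology $\mathcal{T}$ on $C(M)$ such that $\mathcal{T}_{p\restriction X}\subseteq\mathcal{T}\subseteq\mathcal{T}_{k\restriction X}$ and the space $C_{\mathcal{T}}(M)$ is strongly Gelfand--Phillips; (iii) $X$ contains a compact countable subspace $K$ of finite scattered height such that for every compact set $F\subseteq M$ the set $(F\cap X)\setminus K$ is finite. (B) If $X$ is $k$-dense and sequentially closed in $M$, then the conditions (i)--(iii) are equivalent to each of the following: (iv) for every locally convex topology $\mathcal{T}$ on $C(M)$ satisfying $\mathcal{T}_{p\restriction X}\subseteq\mathcal{T}\subseteq\mathcal{T}_k$, the space $C_{\mathcal{T}}(M)$ is strongly Gelfand--Phillips; (v) there is a locally convex topology $\mathcal{T}$ on $C(M)$ such that $\mathcal{T}_{p\restriction X}\subseteq\mathcal{T}\subseteq\mathcal{T}_k$ and the space $C_{\mathcal{T}}(M)$ is strongly Gelfand--Phillips; (vi) $X=M$ and $X$ contains a compact countable subspace $K$ of finite scattered height such that for every compact set $F\subseteq X$ the complement $F\setminus K$ is finite. (C) If $X$ is $k$-dense in $M$, then condition (v) implies the condition (vii) $M$ contains a compact countable subspace $K$ of finite scattered height such that $M=X\cup K$ and for every compact set $F\subseteq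 M$ the complement $F\setminus K$ is finite. (D) If (iii) holds (with the compact set $K$), then a sequence $(\mu_n)_{n\in\omega}\subseteq C_{\mathcal{T}}(M)'$ witnessing the strong Gelfand--Phillips property of $C_{\mathcal{T}}(M)$ in (i) and (iv) can be chosen such that all $\mu_n$ have finite support $\mathrm{supp}(\mu_n)$ contained in $K$.
   Context: Topological spaces are Tychonoff; locally convex spaces are Hausdorff and infinite-dimensional over the field $\mathbb{F}$ of real or complex numbers (so the function spaces considered are assumed infinite-dimensional). Function spaces. $C(M)$ is the vector space of all continuous functions $M\to\mathbb{F}$; $C_{\mathcal{T}}(M)$ is $C(M)$ with a locally convex topology $\mathcal{T}$. For $A\subseteq M$ and $\varepsilon\ge 0$, $[A;\varepsilon]=\{f\in C(M):\sup_{x\in A}|f(x)|\le\varepsilon\}$ (with the sup over the empty set equal to $0$). $\mathcal{T}_{p\restriction X}$ (resp. $\mathcal{T}_{k\restriction X}$) is the topology on $C(M)$ with neighborhood base at zero the sets $[S;\varepsilon]$, $\varepsilon>0$, $S$ a finite (resp. compact) subset of $X$. $\mathcal{T}_k$ is the compact-open topology on $C(M)$ (base $[S;\varepsilon]$, $S\subseteq M$ compact, $\varepsilon>0$). Topology. A subset $A\subseteq M$ is functionally bounded if every $f\in C(M)$ is bounded on $A$; $M$ is a $\mu$-space if every functionally bounded subset of $M$ has compact closure in $M$. $X\subseteq M$ is $k$-dense in $M$ if every compact set $K\subseteq M$ is contained in a compact set $S\subseteq M$ such that $S\cap X$ is dense in $S$; $X$ is sequentially closed in $M$ if the limit of every sequence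 of points of $X$ converging in $M$ lies in $X$. For a space $Y$ let $Y^{(0)}=Y$, $Y^{(1)}$ the set of non-isolated points of $Y$, and $Y^{(\alpha)}=\bigcap_{\beta<\alpha}(Y^{(\beta)})^{(1)}$ for ordinals $\alpha>0$; $Y$ is scattered iff $Y^{(\alpha)}=\emptyset$ for some $\alpha$, and the least such $\alpha$ is the scattered height of $Y$. Support. For a linear functional $\mu$ on $C(M)$, $\mathrm{supp}(\mu)$ is the set of all $x\in M$ such that for every neighborhood $O_x$ of $x$ there is $f\in C(M)$ with $\mu(f)\ne 0$ and $\overline{\{y:f(y)\neq 0\}}\subseteq O_x$. Strong Gelfand--Phillips. A barrel is a closed absolutely convex absorbing set. A subset $B$ of a locally convex space $E$ is barrel-bounded if for every barrel $U$ there is $n\in\omega$ with $B\subseteq nU$; it is barrel-precompact if for every barrel $U$ there is a finite $F\subseteq E$ with $B\subseteq F+U$. For $\chi\in E'$, $\|\chi\|_B:=\sup\{|\chi(x)|:x\in B\cup\{0\}\}$. $E$ is strongly Gelfand--Phillips if there is a weak$^\ast$ null sequence $(\chi_n)_{n\in\omega}$ in $E'$ such that $\|\chi_n\|_B\not\to 0$ for every barrel-bounded, not barrel-precompact set $B\subseteq E$; such a sequence witnesses the strong Gelfand--Phillips property. In (D), "in (i) and (iv)" means: for every $\mathcal{T}$ as in (i), and, when $X$ is $k$-dense and sequentially closed in $M$, for every $\mathcal{T}$ as in (iv). *)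

theory Defs
  imports "HOL-Analysis.Analysis"
begin

section \<open>Locally convex spaces\<close>

text \<open>
  A topological vector space over a field \<open>'k\<close> is given by an additive group \<open>'v\<close>, a scalar
  multiplication \<open>s\<close> and a topology \<open>T\<close> on \<open>'v\<close>; the topology is not a type class instance, because
  one and the same vector space is considered with many topologies.

  The scalars \<open>\<real>\<close> and \<open>\<complex>\<close> are treated uniformly by a type \<open>'k\<close> of sort
  \<open>{real_normed_field, euclidean_space}\<close>: by the Frobenius theorem and the uniqueness of a
  multiplicative norm extending the absolute value of \<open>\<real>\<close>, these are up to isometric
  isomorphism exactly \<open>real\<close> and \<open>complex\<close>. The definitions themselves do not need
  the restriction to finite dimension.
\<close>

definition convex_wrt :: "('k::real_normed_field \<Rightarrow> 'v::ab_group_add \<Rightarrow> 'v) \<Rightarrow> 'v set \<Rightarrow> bool" where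
  "convex_wrt s U \<longleftrightarrow>
    (\<forall>x\<in>U. \<forall>y\<in>U. \<forall>t\<in>{0..1::real}. s (of_real t) x + s (of_real (1 - t)) y \<in> U)"

definition absolutely_convex :: "('k::real_normed_field \<Rightarrow> 'v::ab_group_add \<Rightarrow> 'v) \<Rightarrow> 'v set \<Rightarrow> bool" where
  "absolutely_convex s U \<longleftrightarrow>
    (\<forall>x\<in>U. \<forall>y\<in>U. \<forall>a b. norm a + norm b \<le> 1 \<longrightarrow> s a x + s b y \<in> U)"

definition absorbing :: "('k::real_normed_field \<Rightarrow> 'v::ab_group_add \<Rightarrow> 'v) \<Rightarrow> 'v set \<Rightarrow> bool" where
  "absorbing s U \<longleftrightarrow> (\<forall>x. \<exists>r>0. \<forall>c. norm c \<le> r \<longrightarrow> s c x \<in> U)"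

definition infinite_dimensional :: "('k::real_normed_field \<Rightarrow> 'v::ab_group_add \<Rightarrow> 'v) \<Rightarrow> bool" where
  "infinite_dimensional s \<longleftrightarrow> \<not> (\<exists>B. finite B \<and> module.span s B = UNIV)"

definition locally_convex_space ::
    "('k::real_normed_field \<Rightarrow> 'v::ab_group_add \<Rightarrow> 'v) \<Rightarrow> 'v topology \<Rightarrow> bool" where
  "locally_convex_space s T \<longleftrightarrow>
    vector_space s \<and> topspace T = UNIV \<and> Hausdorff_space T \<and>
    continuous_map (prod_topology T T) T (\<lambda>(x, y). x + y) \<and>
    continuous_map (prod_topology euclidean T) T (\<lambda>(c, x). s c x) \<and>
    (\<forall>U. openin T U \<and> 0 \<in> U \<longrightarrow> (\<exists>V. openin T V \<and> 0 \<in> V \<and> V \<subseteq> U \<and> convex_wrt s V))"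

definition dual_space ::
    "('k::real_normed_field \<Rightarrow> 'v::ab_group_add \<Rightarrow> 'v) \<Rightarrow> 'v topology \<Rightarrow> ('v \<Rightarrow> 'k) set" where
  "dual_space s T = {\<phi>. Vector_Spaces.linear s (*) \<phi> \<and> continuous_map T euclidean \<phi>}"


section \<open>The strong Gelfand--Phillips property\<close>

definition barrel ::
    "('k::real_normed_field \<Rightarrow> 'v::ab_group_add \<Rightarrow> 'v) \<Rightarrow> 'v topology \<Rightarrow> 'v set \<Rightarrow> bool" where
  "barrel s T U \<longleftrightarrow> closedin T U \<and> absolutely_convex s U \<and> absorbing s U"

definition barrel_bounded ::
    "('k::real_normed_field \<Rightarrow> 'v::ab_group_add \<Rightarrow> 'v) \<Rightarrow> 'v topology \<Rightarrow> 'v set \<Rightarrow> bool" where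
  "barrel_bounded s T B \<longleftrightarrow> (\<forall>U. barrel s T U \<longrightarrow> (\<exists>n::nat. B \<subseteq> s (of_nat n) ` U))"

definition barrel_precompact ::
    "('k::real_normed_field \<Rightarrow> 'v::ab_group_add \<Rightarrow> 'v) \<Rightarrow> 'v topology \<Rightarrow> 'v set \<Rightarrow> bool" where
  "barrel_precompact s T B \<longleftrightarrow>
    (\<forall>U. barrel s T U \<longrightarrow> (\<exists>F. finite F \<and> B \<subseteq> {a + u |a u. a \<in> F \<and> u \<in> U}))"

text \<open>The supremum is extended-real valued, since for arbitrary \<open>B\<close> it can be infinite.\<close>

definition norm_on :: "('v::zero) set \<Rightarrow> ('v \<Rightarrow> 'k::real_normed_field) \<Rightarrow> ereal" where
  "norm_on B \<phi> = (SUP x\<in>B \<union> {0}. ereal (norm (\<phi> x)))"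

definition witnesses_strongly_GP ::
    "('k::real_normed_field \<Rightarrow> 'v::ab_group_add \<Rightarrow> 'v) \<Rightarrow> 'v topology \<Rightarrow> (nat \<Rightarrow> 'v \<Rightarrow> 'k) \<Rightarrow> bool" where
  "witnesses_strongly_GP s T \<phi> \<longleftrightarrow>
    (\<forall>n. \<phi> n \<in> dual_space s T) \<and>
    (\<forall>x. (\<lambda>n. \<phi> n x) \<longlonglongrightarrow> 0) \<and>
    (\<forall>B. barrel_bounded s T B \<and> \<not> barrel_precompact s T B \<longrightarrow>
         \<not> (\<lambda>n. norm_on B (\<phi> n)) \<longlonglongrightarrow> 0)"

definition strongly_GP ::
    "('k::real_normed_field \<Rightarrow> 'v::ab_group_add \<Rightarrow> 'v) \<Rightarrow> 'v topology \<Rightarrow> bool" where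
  "strongly_GP s T \<longleftrightarrow> (\<exists>\<phi>. witnesses_strongly_GP s T \<phi>)"


section \<open>The vector space of continuous functions\<close>

typedef (overloaded) ('a, 'k) cfun =
    "{f :: 'a::topological_space \<Rightarrow> 'k::real_normed_field. continuous_on UNIV f}"
  morphisms cfun_apply Cfun
  by (auto intro!: exI[of _ "\<lambda>_. 0"])

setup_lifting type_definition_cfun

instantiation cfun :: (topological_space, real_normed_field) ab_group_add
begin

lift_definition zero_cfun :: "('a, 'b) cfun" is "\<lambda>_. 0"
  by simp

lift_definition plus_cfun :: "('a, 'b) cfun \<Rightarrow> ('a, 'b) cfun \<Rightarrow> ('a, 'b) cfun"
  is "\<lambda>f g x. f x + g x"
  by (intro continuous_intros)

lift_definition minus_cfun :: "('a, 'b) cfun \<Rightarrow> ('a, 'b) cfun \<Rightarrow> ('a, 'b) cfun"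
  is "\<lambda>f g x. f x - g x"
  by (intro continuous_intros)

lift_definition uminus_cfun :: "('a, 'b) cfun \<Rightarrow> ('a, 'b) cfun"
  is "\<lambda>f x. - f x"
  by (intro continuous_intros)

instance
  by standard (transfer; simp add: algebra_simps fun_eq_iff)+

end

lift_definition cscale ::
    "'k \<Rightarrow> ('a::topological_space, 'k::real_normed_field) cfun \<Rightarrow> ('a, 'k) cfun"
  is "\<lambda>c f x. c * f x"
  by (intro continuous_intros)

lemma vector_space_cscale: "vector_space cscale"
  by standard (transfer; simp add: algebra_simps fun_eq_iff)+

text \<open>The set \<open>[A;\<epsilon>]\<close>, for \<open>\<epsilon> \<ge> 0\<close>.\<close>

definition cball0 :: "'a::topological_space set \<Rightarrow> real \<Rightarrow> ('a, 'k::real_normed_field) cfun set" where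
  "cball0 A \<epsilon> = {f. \<forall>x\<in>A. norm (cfun_apply f x) \<le> \<epsilon>}"

text \<open>
  The translation-invariant topology with the sets \<open>[S;\<epsilon>]\<close>, \<open>S \<in> \<S>\<close>, \<open>\<epsilon> > 0\<close>, as a neighbourhood base
  at zero. This is meaningful if \<open>\<S>\<close> is nonempty and closed under binary unions.
\<close>

definition topology_of_convergence_on ::
    "'a::topological_space set set \<Rightarrow> ('a, 'k::real_normed_field) cfun topology" where
  "topology_of_convergence_on \<S> =
    topology (\<lambda>U. \<forall>f\<in>U. \<exists>S\<in>\<S>. \<exists>\<epsilon>>0. \<forall>g. g - f \<in> cball0 S \<epsilon> \<longrightarrow> g \<in> U)"

lemma openin_topology_of_convergence_on:
  assumes "\<S> \<noteq> {}" "\<And>S S'. S \<in> \<S> \<Longrightarrow> S' \<in> \<S> \<Longrightarrow> S \<union> S' \<in> \<S>"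
  shows "openin (topology_of_convergence_on \<S>) U \<longleftrightarrow>
    (\<forall>f\<in>U. \<exists>S\<in>\<S>. \<exists>\<epsilon>>0. \<forall>g. g - f \<in> cball0 S \<epsilon> \<longrightarrow> g \<in> U)"
proof -
  let ?P = "\<lambda>U::('a, 'b) cfun set. \<forall>f\<in>U. \<exists>S\<in>\<S>. \<exists>\<epsilon>>0. \<forall>g. g - f \<in> cball0 S \<epsilon> \<longrightarrow> g \<in> U"
  have "?P (U \<inter> V)" if U: "?P U" and V: "?P V" for U V
  proof
    fix f assume f: "f \<in> U \<inter> V"
    obtain S \<epsilon> where S: "S \<in> \<S>" "\<epsilon> > 0" "\<And>g. g - f \<in> cball0 S \<epsilon> \<Longrightarrow> g \<in> U"
      using U f by blast
    obtain S' \<epsilon>' where S': "S' \<in> \<S>" "\<epsilon>' > 0" "\<And>g. g - f \<in> cball0 S' \<epsilon>' \<Longrightarrow> g \<in> V"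
      using V f by blast
    have "\<forall>g. g - f \<in> cball0 (S \<union> S') (min \<epsilon> \<epsilon>') \<longrightarrow> g \<in> U \<inter> V"
      using S(3) S'(3) by (auto simp: cball0_def)
    moreover have "S \<union> S' \<in> \<S>" "min \<epsilon> \<epsilon>' > 0"
      using assms S S' by auto
    ultimately show "\<exists>S\<in>\<S>. \<exists>\<epsilon>>0. \<forall>g. g - f \<in> cball0 S \<epsilon> \<longrightarrow> g \<in> U \<inter> V"
      by blast
  qed
  moreover have "?P (\<Union>K)" if K: "\<forall>U\<in>K. ?P U" for K
  proof
    fix f assume "f \<in> \<Union>K"
    then obtain U where U: "U \<in> K" "f \<in> U" by blast
    then obtain S \<epsilon> where "S \<in> \<S>" "\<epsilon> > 0" "\<forall>g. g - f \<in> cball0 S \<epsilon> \<longrightarrow> g \<in> U"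
      using K by blast
    then show "\<exists>S\<in>\<S>. \<exists>\<epsilon>>0. \<forall>g. g - f \<in> cball0 S \<epsilon> \<longrightarrow> g \<in> \<Union>K"
      using U by blast
  qed
  ultimately have "istopology ?P"
    unfolding istopology_def by blast
  then show ?thesis
    by (simp add: topology_of_convergence_on_def)
qed

definition Tp :: "'a::topological_space set \<Rightarrow> ('a, 'k::real_normed_field) cfun topology" where
  "Tp X = topology_of_convergence_on {S. finite S \<and> S \<subseteq> X}"

definition Tk :: "'a::topological_space set \<Rightarrow> ('a, 'k::real_normed_field) cfun topology" where
  "Tk X = topology_of_convergence_on {S. compact S \<and> S \<subseteq> X}"

lemma openin_Tp:
  "openin (Tp X) U \<longleftrightarrow>
    (\<forall>f\<in>U. \<exists>S. finite S \<and> S \<subseteq> X \<and> (\<exists>\<epsilon>>0. \<forall>g. g - f \<in> cball0 S \<epsilon> \<longrightarrow> g \<in> U))"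
  unfolding Tp_def by (subst openin_topology_of_convergence_on) auto

lemma openin_Tk:
  "openin (Tk X) U \<longleftrightarrow>
    (\<forall>f\<in>U. \<exists>S. compact S \<and> S \<subseteq> X \<and> (\<exists>\<epsilon>>0. \<forall>g. g - f \<in> cball0 S \<epsilon> \<longrightarrow> g \<in> U))"
  unfolding Tk_def by (subst openin_topology_of_convergence_on) auto

text \<open>The locally convex topologies on \<open>C(M)\<close> lying between \<open>T1\<close> and \<open>T2\<close>.\<close>

definition lc_topologies_between ::
    "('a::topological_space, 'k::real_normed_field) cfun topology \<Rightarrow> ('a, 'k) cfun topology
      \<Rightarrow> ('a, 'k) cfun topology set" where
  "lc_topologies_between T1 T2 =
    {T. locally_convex_space cscale T \<and>
        {U. openin T1 U} \<subseteq> {U. openin T U} \<and> {U. openin T U} \<subseteq> {U. openin T2 U}}"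

definition supp :: "(('a::topological_space, 'k::real_normed_field) cfun \<Rightarrow> 'k) \<Rightarrow> 'a set" where
  "supp \<mu> = {x. \<forall>O'. open O' \<and> x \<in> O' \<longrightarrow>
    (\<exists>f. \<mu> f \<noteq> 0 \<and> closure {y. cfun_apply f y \<noteq> 0} \<subseteq> O')}"


section \<open>Topological notions\<close>

text \<open>The type argument fixes the field in which the functions in \<open>C(M)\<close> take their values.\<close>

definition functionally_bounded ::
    "'k::real_normed_field itself \<Rightarrow> 'a::topological_space set \<Rightarrow> bool" where
  "functionally_bounded _ A \<longleftrightarrow> (\<forall>f :: ('a, 'k) cfun. bounded (cfun_apply f ` A))"

definition mu_space :: "'k::real_normed_field itself \<Rightarrow> 'a::topological_space itself \<Rightarrow> bool" where
  "mu_space k _ \<longleftrightarrow> (\<forall>A::'a set. functionally_bounded k A \<longrightarrow> compact (closure A))"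

definition k_dense :: "'a::topological_space set \<Rightarrow> bool" where
  "k_dense X \<longleftrightarrow> (\<forall>K. compact K \<longrightarrow> (\<exists>S. compact S \<and> K \<subseteq> S \<and> S \<subseteq> closure (S \<inter> X)))"

definition sequentially_closed :: "'a::topological_space set \<Rightarrow> bool" where
  "sequentially_closed X \<longleftrightarrow> (\<forall>x l. (\<forall>n. x n \<in> X) \<and> x \<longlonglongrightarrow> l \<longrightarrow> l \<in> X)"

text \<open>
  \<open>cb_derivative Y n\<close> is \<open>Y\<^sup>(\<^sup>n\<^sup>)\<close>. Only finite ordinals are needed: the least ordinal \<open>\<alpha>\<close> with
  \<open>Y\<^sup>(\<^sup>\<alpha>\<^sup>) = \<emptyset>\<close> exists and is finite iff \<open>Y\<^sup>(\<^sup>n\<^sup>) = \<emptyset>\<close> for some natural number \<open>n\<close>.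
\<close>

definition nonisolated :: "'a::topological_space set \<Rightarrow> 'a set" where
  "nonisolated Y = {y\<in>Y. y islimpt Y}"

fun cb_derivative :: "'a::topological_space set \<Rightarrow> nat \<Rightarrow> 'a set" where
  "cb_derivative Y n = (if n = 0 then Y else (\<Inter>m\<in>{..<n}. nonisolated (cb_derivative Y m)))"

declare cb_derivative.simps [simp del]

lemma cb_derivative_0: "cb_derivative Y 0 = Y"
  by (simp add: cb_derivative.simps)

lemma cb_derivative_Suc: "cb_derivative Y (Suc n) = nonisolated (cb_derivative Y n)"
proof (cases n)
  case 0
  then show ?thesis by (simp add: cb_derivative.simps[of Y "Suc 0"] cb_derivative_0 lessThan_Suc)
next
  case (Suc m)
  have "nonisolated (cb_derivative Y n) \<subseteq> cb_derivative Y n"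
    by (auto simp: nonisolated_def)
  moreover have "cb_derivative Y n = (\<Inter>m\<in>{..<n}. nonisolated (cb_derivative Y m))"
    using Suc by (subst cb_derivative.simps) simp
  moreover have "cb_derivative Y (Suc n) =
      nonisolated (cb_derivative Y n) \<inter> (\<Inter>m\<in>{..<n}. nonisolated (cb_derivative Y m))"
    by (subst cb_derivative.simps) (simp add: lessThan_Suc)
  ultimately show ?thesis by auto
qed

text \<open>A space with an empty derivative is automatically scattered.\<close>

definition finite_scattered_height :: "'a::topological_space set \<Rightarrow> bool" where
  "finite_scattered_height Y \<longleftrightarrow> (\<exists>n. cb_derivative Y n = {})"

definition countable_compact_finite_height :: "'a::topological_space set \<Rightarrow> bool" where
  "countable_compact_finite_height K \<longleftrightarrow> compact K \<and> countable K \<and> finite_scattered_height K"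

end

(*
  A barrel of C_T(M) is closed for the topology of uniform convergence on compact sets; a gliding
  hump and a partition of unity, as in the theorem of Nachbin and Shirota, show that it contains
  [A;eps] for some relatively compact A <= X. Barrel-bounded and barrel-precompact thus mean
  bounded and precompact for uniform convergence on such sets, whatever T is.

  Necessity. A witness mu_n is bounded by 1 on some [A;eps]. As all mu_n vanish on bumps off the
  closure F of A, only finitely many points of H Int X lie off F for compact H. Apart from finitely
  many conditions f(x) = 0, the number sup_n |mu_n f| is a norm equivalent to the uniform norm on F;
  but it behaves like the norm of c_0, in that sums of bumps placed successively off the (finitely
  many) large atoms of mu_0, ..., mu_N stay bounded. Nested bumps at a point that is no atom of any
  mu_n, or along a point of high Cantor-Bendixson rank, would therefore be contradictory: F is
  countable and of finite height, and lies in X if the mu_n are carried by subsets of X.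

  Sufficiency. For countable compact K of finite height join each point x of K to a nearest point
  r x of the next Cantor-Bendixson derivative. The functionals f(x) - f(r x), x in K, form a null
  sequence, and where they are uniformly small outside a finite set of x, chains x, r x, r (r x),
  ... of bounded length reduce precompactness on K to finitely many points.
*)

theory Submission
  imports Defs
begin

text \<open>The topology \<open>T\<close> drops out by a sandwich: a barrel of \<open>T\<close> is
  closed for the finer \<open>Tk Z\<close>, which forces it to contain some
  \<open>cball0 A \<epsilon>\<close>, while every \<open>cball0 A r\<close> with \<open>A\<close>
  inside \<open>X\<close> is cut out by conditions at points of \<open>X\<close> and so is closed
  even for \<open>Tp X\<close>. The obstacle is that \<open>A\<close> itself need not be compact:
  the argument yields only that functions are bounded on it, which makes its closure in the whole
  space compact, and this closure may leave \<open>X\<close>. Hence estimates are made over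
  \<open>A\<close>, continuity carries them to \<open>closure A\<close>, and whether
  \<open>closure A\<close> lies in \<open>X\<close> is settled last: by carriers of the functionals
  if \<open>Z = X\<close>, by sequential closedness if \<open>X\<close> is k-dense. Failure of
  precompactness is always produced by a triangular scheme of points \<open>x i\<close> and
  functions \<open>f i\<close>, with \<open>f j\<close> zero at all earlier \<open>x i\<close>;
  finiteness off \<open>closure A\<close> and the lower norm estimate both come from such
  schemes.\<close>

section \<open>Truncations, supports and bumps in the space of continuous functions\<close>

lemmas cfun_simps =
  zero_cfun.rep_eq plus_cfun.rep_eq minus_cfun.rep_eq uminus_cfun.rep_eq cscale.rep_eq

lemma continuous_cfun: "continuous_on S (cfun_apply f)"
  using cfun_apply[of f] by (auto intro: continuous_on_subset)

lemma cfun_ext: "(\<And>x. cfun_apply f x = cfun_apply g x) \<Longrightarrow> f = g"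
  by (simp add: cfun_apply_inject[symmetric] fun_eq_iff)

lemma cfun_apply_Cfun: "continuous_on UNIV f \<Longrightarrow> cfun_apply (Cfun f) = f"
  by (simp add: Cfun_inverse)

lemma cscale_simps [simp]:
  "cscale 0 f = 0" "cscale 1 f = f" "cscale a (cscale b f) = cscale (a * b) f"
  by (rule cfun_ext; simp add: cfun_simps)+

lift_definition cmult ::
    "('a::topological_space, 'k::real_normed_field) cfun \<Rightarrow> ('a, 'k) cfun \<Rightarrow> ('a, 'k) cfun"
  is "\<lambda>f g x. f x * g x"
  by (intro continuous_intros)

text \<open>For \<open>r > 0\<close> this is the radial retraction onto the ball of radius
  \<open>r\<close>, which serves real and complex scalars alike. The constant factor
  \<open>inverse r\<close> and the maximum with 1 keep the formula continuous for every
  \<open>r\<close>.\<close>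

lift_definition clip ::
    "real \<Rightarrow> ('a::topological_space, 'k::real_normed_field) cfun \<Rightarrow> ('a, 'k) cfun"
  is "\<lambda>r f x. f x / of_real (max 1 (inverse r * norm (f x)))"
proof (intro continuous_intros ballI)
  show "of_real (max 1 (inverse r * norm (f x))) \<noteq> (0::'k)" for r and f :: "'a \<Rightarrow> 'k" and x
    by (smt (verit, best) of_real_eq_0_iff)
qed

lemma norm_clip_le:
  assumes "r > 0"
  shows "norm (cfun_apply (clip r f) x) \<le> r"
proof -
  define m where "m = max 1 (inverse r * norm (cfun_apply f x))"
  have "m \<ge> 1" "inverse r * norm (cfun_apply f x) \<le> m"
    by (auto simp: m_def)
  then have "norm (cfun_apply f x) \<le> r * m"
    using assms by (simp add: field_simps)
  then have "norm (cfun_apply f x) / m \<le> r"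
    using \<open>m \<ge> 1\<close> by (simp add: field_simps)
  then show ?thesis
    using \<open>m \<ge> 1\<close> by (simp add: clip.rep_eq norm_divide flip: m_def)
qed

lemma clip_eq:
  assumes "r > 0" "norm (cfun_apply f x) \<le> r"
  shows "cfun_apply (clip r f) x = cfun_apply f x"
proof -
  have "inverse r * norm (cfun_apply f x) \<le> 1"
    using assms by (simp add: field_simps)
  then show ?thesis
    by (simp add: clip.rep_eq max_absorb1)
qed

definition csupport :: "('a::topological_space, 'k::real_normed_field) cfun \<Rightarrow> 'a set" where
  "csupport f = closure {y. cfun_apply f y \<noteq> 0}"

lemma closed_csupport [simp]: "closed (csupport f)"
  by (simp add: csupport_def)

lemma not_in_csupport: "x \<notin> csupport f \<Longrightarrow> cfun_apply f x = 0"
  using closure_subset by (force simp: csupport_def)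

lemma csupport_subset:
  assumes "\<And>x. cfun_apply f x \<noteq> 0 \<Longrightarrow> cfun_apply g x \<noteq> 0"
  shows "csupport f \<subseteq> csupport g"
  unfolding csupport_def by (rule closure_mono) (use assms in auto)

lemma csupport_subset_closed:
  assumes "closed S" "\<And>x. cfun_apply f x \<noteq> 0 \<Longrightarrow> x \<in> S"
  shows "csupport f \<subseteq> S"
  unfolding csupport_def by (rule closure_minimal) (use assms in auto)

lemma bump:
  fixes x :: "'a::topological_space"
  assumes "completely_regular_space (euclidean :: 'a topology)" "open W" "x \<in> W"
  obtains \<phi> :: "('a, 'k::real_normed_field) cfun" and V where
    "open V" "x \<in> V" "\<And>y. y \<in> V \<Longrightarrow> cfun_apply \<phi> y = 1" "csupport \<phi> \<subseteq> W"
    "\<And>y. norm (cfun_apply \<phi> y) \<le> 1"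
proof -
  have "closedin (euclidean :: 'a topology) (- W)" "x \<in> topspace euclidean - (- W)"
    using assms by auto
  then obtain f where f: "continuous_map (euclidean :: 'a topology) (top_of_set {0..1::real}) f"
      "f x = 0" "f ` (- W) \<subseteq> {1}"
    using assms(1) unfolding completely_regular_space_def by meson
  have cont: "continuous_on UNIV f"
    using f(1) by (auto simp: continuous_map_in_subtopology)
  \<comment> \<open>\<open>g\<close> is 1 where \<open>f \<le> 1/3\<close> and 0 where
    \<open>f \<ge> 2/3\<close>: the first gives a whole neighbourhood with value 1, the second keeps
    the closed support away from the set where \<open>f = 1\<close>.\<close>
  define g where "g = (\<lambda>y. max 0 (min 1 (2 - 3 * f y)))"
  define \<phi> :: "('a, 'k) cfun" where "\<phi> = Cfun (\<lambda>y. of_real (g y))"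
  have \<phi>: "cfun_apply \<phi> y = of_real (g y)" for y
    unfolding \<phi>_def g_def by (subst cfun_apply_Cfun) (intro continuous_intros cont, simp)
  show ?thesis
  proof
    show "open {y. f y < 1 / 3}"
      by (intro open_Collect_less continuous_intros cont)
    show "x \<in> {y. f y < 1 / 3}"
      using f by simp
    show "cfun_apply \<phi> y = 1" if "y \<in> {y. f y < 1 / 3}" for y
      using that by (simp add: \<phi> g_def)
    have "csupport \<phi> \<subseteq> {y. f y \<le> 2 / 3}"
    proof (rule csupport_subset_closed)
      show "closed {y. f y \<le> 2 / 3}"
        by (intro closed_Collect_le continuous_intros cont)
      show "y \<in> {y. f y \<le> 2 / 3}" if "cfun_apply \<phi> y \<noteq> 0" for y
        using that by (auto simp: \<phi> g_def max_def min_def split: if_splits)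
    qed
    also have "\<dots> \<subseteq> W"
      using f(3) by fastforce
    finally show "csupport \<phi> \<subseteq> W" .
    show "norm (cfun_apply \<phi> y) \<le> 1" for y
      by (simp add: \<phi> g_def)
  qed
qed


section \<open>Barrels\<close>

lemma absolutely_convexD:
  assumes "absolutely_convex s U" "x \<in> U" "y \<in> U" "norm a + norm b \<le> 1"
  shows "s a x + s b y \<in> U"
  using assms unfolding absolutely_convex_def by blast

lemma absolutely_convex_half_sum:
  fixes U :: "('a::topological_space, 'k::real_normed_field) cfun set"
  assumes "absolutely_convex cscale U" "cscale 2 f \<in> U" "cscale 2 g \<in> U"
  shows "f + g \<in> U"
proof -
  have "norm (1 / 2 :: 'k) + norm (1 / 2 :: 'k) \<le> 1"
    by (simp add: norm_divide)
  then have "cscale (1 / 2) (cscale 2 f) + cscale (1 / 2) (cscale 2 g) \<in> U"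
    using assms unfolding absolutely_convex_def by blast
  then show ?thesis by simp
qed

lemma topspace_Tk [simp]: "topspace (Tk X) = UNIV"
proof -
  have "openin (Tk X) UNIV"
    unfolding openin_Tk by (intro ballI exI[of _ "{}"]) (auto intro: exI[of _ 1])
  then show ?thesis
    using openin_subset by blast
qed

lemma topspace_Tp [simp]: "topspace (Tp X) = UNIV"
proof -
  have "openin (Tp X) UNIV"
    unfolding openin_Tp by (intro ballI exI[of _ "{}"]) (auto intro: exI[of _ 1])
  then show ?thesis
    using openin_subset by blast
qed

lemma openin_TpD:
  assumes "openin (Tp X) U" "f \<in> U"
  obtains S \<epsilon> where "finite S" "S \<subseteq> X" "\<epsilon> > 0" "\<And>g. g - f \<in> cball0 S \<epsilon> \<Longrightarrow> g \<in> U"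
proof -
  have "\<exists>S. finite S \<and> S \<subseteq> X \<and> (\<exists>\<epsilon>>0. \<forall>g. g - f \<in> cball0 S \<epsilon> \<longrightarrow> g \<in> U)"
    using assms(1)[unfolded openin_Tp] assms(2) by (rule bspec)
  then show ?thesis
    using that by auto
qed

lemma openin_TkD:
  assumes "openin (Tk X) U" "f \<in> U"
  obtains S \<epsilon> where "compact S" "S \<subseteq> X" "\<epsilon> > 0" "\<And>g. g - f \<in> cball0 S \<epsilon> \<Longrightarrow> g \<in> U"
proof -
  have "\<exists>S. compact S \<and> S \<subseteq> X \<and> (\<exists>\<epsilon>>0. \<forall>g. g - f \<in> cball0 S \<epsilon> \<longrightarrow> g \<in> U)"
    using assms(1)[unfolded openin_Tk] assms(2) by (rule bspec)
  then show ?thesis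
    using that by auto
qed

lemma closedin_TkD:
  assumes "closedin (Tk Z) U" "f \<notin> U"
  obtains S \<epsilon> where "compact S" "S \<subseteq> Z" "\<epsilon> > 0"
    "\<And>g. (\<And>x. x \<in> S \<Longrightarrow> norm (cfun_apply g x - cfun_apply f x) \<le> \<epsilon>) \<Longrightarrow> g \<notin> U"
proof -
  have "openin (Tk Z) (- U)" "f \<in> - U"
    using assms by (auto simp: closedin_def Compl_eq_Diff_UNIV)
  then show ?thesis
    by (rule openin_TkD) (rule that, auto simp: cball0_def cfun_simps)
qed

lemma closedin_Tk_mono: "closedin (Tk Z) U \<Longrightarrow> Z \<subseteq> Z' \<Longrightarrow> closedin (Tk Z') U"
  unfolding closedin_def openin_Tk by (simp; meson subset_trans)

text \<open>
  A gliding hump. If the conclusion failed, small perturbations would lead step by step to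
  functions lying outside of larger and larger multiples of \<open>U\<close>; since \<open>U\<close> is closed, each step
  is protected against the later ones, and no multiple of \<open>U\<close> contains the limit.
\<close>

lemma barrel_contains_small_functions:
  fixes U :: "('a::t2_space, 'k::{real_normed_field, banach}) cfun set" and h :: "'a \<Rightarrow> real"
  assumes closed: "closedin (Tk UNIV) U" and convex: "absolutely_convex cscale U"
    and absorb: "absorbing cscale U" and h: "continuous_on UNIV h"
  obtains R \<epsilon> where "\<epsilon> > 0"
    "\<And>f. (\<And>x. h x \<le> R \<Longrightarrow> norm (cfun_apply f x) \<le> \<epsilon>) \<Longrightarrow> f \<in> U"
proof (rule ccontr)
  assume contra: "\<not> thesis"
  note that' = that
  have small: "\<exists>f. (\<forall>x. h x \<le> R \<longrightarrow> norm (cfun_apply f x) \<le> \<epsilon>) \<and> f \<notin> U" if "\<epsilon> > 0" for R \<epsilon>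
    using contra that'[OF \<open>\<epsilon> > 0\<close>] by blast
  \<comment> \<open>Everything within \<open>r\<close> of \<open>g\<close> on the set
    \<open>h \<le> R\<close> stays outside of \<open>Suc i\<close> times \<open>U\<close>. The
    condition \<open>R \<ge> real i\<close> makes these sets exhaust the space.\<close>
  define P :: "nat \<Rightarrow> (('a, 'k) cfun \<times> real \<times> real) \<Rightarrow> bool" where
    "P i = (\<lambda>(g, R, r). r > 0 \<and> R \<ge> real i \<and>
      (\<forall>g'. (\<forall>x. h x \<le> R \<longrightarrow> norm (cfun_apply g' x - cfun_apply g x) \<le> r) \<longrightarrow>
         cscale (1 / of_nat (Suc i)) g' \<notin> U))" for i
  \<comment> \<open>Changes are at most half the current radius and radii are at least halved, so
    all later changes together stay within the protected radius \<open>r\<close>.\<close>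
  define Q :: "(('a, 'k) cfun \<times> real \<times> real) \<Rightarrow> (('a, 'k) cfun \<times> real \<times> real) \<Rightarrow> bool" where
    "Q = (\<lambda>(g, R, r) (g', R', r'). R \<le> R' \<and> r' \<le> r / 2 \<and>
      (\<forall>x. h x \<le> R \<longrightarrow> norm (cfun_apply g' x - cfun_apply g x) \<le> r / 2))"
  have step: "\<exists>s. P i s \<and> Q (g, R, r) s" if "r > 0" for i g R r
  proof -
    obtain \<rho> where \<rho>: "\<rho> > 0" "\<And>c. norm c \<le> \<rho> \<Longrightarrow> cscale c g \<in> U"
      using absorb unfolding absorbing_def by metis
    \<comment> \<open>With this \<open>t\<close> the coefficients in
      \<open>f0 = (Suc i / t) (g' / Suc i) - (1 / (\<rho> t)) (\<rho> g)\<close> have norms adding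
      up to exactly 1, so \<open>g' / Suc i\<close> in \<open>U\<close> would put \<open>f0\<close>
      into \<open>U\<close>.\<close>
    define t where "t = real (Suc i) + 1 / \<rho>"
    have t: "t > 0"
      using \<rho> by (simp add: t_def add_pos_pos)
    obtain f0 where f0: "\<And>x. h x \<le> R \<Longrightarrow> norm (cfun_apply f0 x) \<le> r / (2 * t)" "f0 \<notin> U"
      using small[of "r / (2 * t)" R] \<open>r > 0\<close> t by auto
    define g' where "g' = g + cscale (of_real t) f0"
    have "cscale (1 / of_nat (Suc i)) g' \<notin> U"
    proof
      assume g': "cscale (1 / of_nat (Suc i)) g' \<in> U"
      have g: "cscale (of_real \<rho>) g \<in> U"
        using \<rho> by simp
      have "norm (of_nat (Suc i) / of_real t :: 'k) + norm (- 1 / (of_real \<rho> * of_real t) :: 'k)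
          = real (Suc i) / t + 1 / (\<rho> * t)"
        using t \<rho> by (simp add: norm_divide norm_mult del: of_nat_Suc)
      also have "\<dots> = (real (Suc i) + 1 / \<rho>) / t"
        by (simp add: add_divide_distrib del: of_nat_Suc)
      also have "\<dots> = t / t"
        by (simp only: t_def)
      also have "\<dots> = 1"
        using t by simp
      finally have "cscale (of_nat (Suc i) / of_real t) (cscale (1 / of_nat (Suc i)) g')
          + cscale (- 1 / (of_real \<rho> * of_real t)) (cscale (of_real \<rho>) g) \<in> U" (is "?f \<in> U")
        by (intro absolutely_convexD[OF convex g' g]) simp
      moreover have "?f = f0"
      proof (rule cfun_ext)
        fix x
        have "of_nat (Suc i) \<noteq> (0::'k)"
          by (rule of_nat_neq_0)
        then show "cfun_apply ?f x = cfun_apply f0 x"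
          using t \<rho> by (simp add: cfun_simps g'_def field_simps del: of_nat_Suc)
      qed
      ultimately show False
        using f0 by simp
    qed
    then obtain S e where S: "compact S" "e > 0" and e:
        "\<And>g2. (\<And>x. x \<in> S \<Longrightarrow> norm (cfun_apply g2 x -
          cfun_apply (cscale (1 / of_nat (Suc i)) g') x) \<le> e) \<Longrightarrow> g2 \<notin> U"
      by (rule closedin_TkD[OF closed]) blast
    \<comment> \<open>\<open>h\<close> is bounded on the compact set \<open>S\<close> that certifies
      that the new function is outside; enlarging \<open>R'\<close> beyond this bound puts
      \<open>S\<close> into the set protected from now on.\<close>
    have "compact (h ` S)"
      using S h by (intro compact_continuous_image) (auto intro: continuous_on_subset)
    then obtain H where H: "\<And>x. x \<in> S \<Longrightarrow> h x \<le> H"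
      using compact_imp_bounded[of "h ` S"] by (auto simp: bounded_iff) (metis abs_le_D1)
    define R' where "R' = max R (max (real i) H)"
    define r' where "r' = min (r / 2) e"
    have "cscale (1 / of_nat (Suc i)) g2 \<notin> U"
      if g2: "\<forall>x. h x \<le> R' \<longrightarrow> norm (cfun_apply g2 x - cfun_apply g' x) \<le> r'" for g2
    proof (rule e)
      fix x assume "x \<in> S"
      then have "norm (cfun_apply g2 x - cfun_apply g' x) \<le> e"
        using g2 H[of x] by (simp add: R'_def r'_def)
      also have "e \<le> e * real (Suc i)"
        using S by (simp add: algebra_simps)
      finally have "norm (cfun_apply g2 x - cfun_apply g' x) / real (Suc i) \<le> e"
        by (simp add: field_simps)
      moreover have "cfun_apply (cscale (1 / of_nat (Suc i)) g2) x -
          cfun_apply (cscale (1 / of_nat (Suc i)) g') x =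
          (cfun_apply g2 x - cfun_apply g' x) / of_nat (Suc i)"
        by (simp add: cfun_simps diff_divide_distrib)
      ultimately show "norm (cfun_apply (cscale (1 / of_nat (Suc i)) g2) x -
          cfun_apply (cscale (1 / of_nat (Suc i)) g') x) \<le> e"
        by (simp add: norm_divide del: of_nat_Suc)
    qed
    then have "P i (g', R', r')"
      using S \<open>r > 0\<close> by (auto simp: P_def R'_def r'_def)
    moreover have "norm (cfun_apply g' x - cfun_apply g x) \<le> r / 2" if "h x \<le> R" for x
    proof -
      have "norm (cfun_apply g' x - cfun_apply g x) = t * norm (cfun_apply f0 x)"
        using t by (simp add: g'_def cfun_simps norm_mult)
      also have "\<dots> \<le> t * (r / (2 * t))"
        using t f0(1)[OF that] by (intro mult_left_mono) auto
      finally show ?thesis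
        using t by simp
    qed
    ultimately show ?thesis
      by (intro exI[of _ "(g', R', r')"]) (auto simp: Q_def R'_def r'_def)
  qed
  have "\<exists>s. P 0 s"
    using step[of 1] zero_less_one by blast
  moreover have "\<exists>s'. P (Suc i) s' \<and> Q s s'" if "P i s" for s i
  proof -
    obtain g R r where s: "s = (g, R, r)"
      by (cases s)
    have "r > 0"
      using that by (simp add: P_def s)
    then show ?thesis
      unfolding s by (rule step)
  qed
  ultimately obtain s where s: "\<And>i. P i (s i)" "\<And>i. Q (s i) (s (Suc i))"
    using dependent_nat_choice[of P "\<lambda>_. Q"] by blast
  define g where "g = (\<lambda>i. fst (s i))"
  define R where "R = (\<lambda>i. fst (snd (s i)))"
  define r where "r = (\<lambda>i. snd (snd (s i)))"
  have seq: "s i = (g i, R i, r i)" for i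
    by (simp add: g_def R_def r_def)
  have r: "r i > 0" and R: "R i \<ge> real i" and avoid:
    "\<And>g'. (\<And>x. h x \<le> R i \<Longrightarrow> norm (cfun_apply g' x - cfun_apply (g i) x) \<le> r i) \<Longrightarrow>
       cscale (1 / of_nat (Suc i)) g' \<notin> U" for i
    using s(1)[of i] by (auto simp: P_def seq)
  have R_Suc: "R i \<le> R (Suc i)" and r_Suc: "r (Suc i) \<le> r i / 2" and g_Suc:
    "\<And>x. h x \<le> R i \<Longrightarrow> norm (cfun_apply (g (Suc i)) x - cfun_apply (g i) x) \<le> r i / 2" for i
    using s(2)[of i] by (auto simp: Q_def seq)
  have R_mono: "R i \<le> R j" if "i \<le> j" for i j
    using that by (rule lift_Suc_mono_le[of R, OF R_Suc])
  have g_diff: "norm (cfun_apply (g j) x - cfun_apply (g i) x) \<le> r i - r j"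
    if "i \<le> j" "h x \<le> R i" for i j x
    using that(1)
  proof (induction j rule: dec_induct)
    case base
    show ?case by simp
  next
    case (step j)
    \<comment> \<open>Telescoping works because
      \<open>r j / 2 \<le> r j - r (Suc j)\<close>.\<close>
    have "norm (cfun_apply (g (Suc j)) x - cfun_apply (g j) x) \<le> r j / 2"
      using g_Suc[of x j] that(2) R_mono[OF step(1)] by linarith
    moreover have "norm (cfun_apply (g (Suc j)) x - cfun_apply (g i) x) \<le>
      norm (cfun_apply (g (Suc j)) x - cfun_apply (g j) x) + norm (cfun_apply (g j) x - cfun_apply (g i) x)"
      by norm
    ultimately show ?case
      using step.IH r_Suc[of j] by linarith
  qed
  have r_le: "r i \<le> r 0 * (1 / 2) ^ i" for i
  proof (induction i)
    case (Suc i)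
    then show ?case using r_Suc[of i] by simp
  qed simp
  have "(\<lambda>i. r 0 * (1 / 2) ^ i) \<longlonglongrightarrow> 0"
    by (intro tendsto_mult_right_zero LIMSEQ_power_zero) simp
  then have r_lim: "r \<longlonglongrightarrow> 0"
    by (rule tendsto_sandwich[OF _ _ tendsto_const, rotated 2])
      (auto intro!: always_eventually simp: r_le less_imp_le[OF r])
  have eventually_R: "\<exists>i. h x < R i \<and> r i < e" if "e > 0" for x e
  proof -
    obtain k where "h x < real k"
      using reals_Archimedean2 by blast
    moreover obtain m where "\<And>i. i \<ge> m \<Longrightarrow> r i < e"
      using order_tendstoD(2)[OF r_lim \<open>e > 0\<close>] by (auto simp: eventually_sequentially)
    moreover have "real k \<le> R (max k m)"
      using R[of "max k m"] by linarith
    ultimately show ?thesis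
      by (intro exI[of _ "max k m"]) auto
  qed
  have conv: "(\<lambda>i. cfun_apply (g i) x) \<longlonglongrightarrow> lim (\<lambda>i. cfun_apply (g i) x)" for x
  proof -
    have "Cauchy (\<lambda>i. cfun_apply (g i) x)"
    proof (rule CauchyI)
      fix e :: real assume "e > 0"
      then obtain i where i: "h x < R i" "r i < e / 2"
        using eventually_R[of "e / 2"] by auto
      have "norm (cfun_apply (g m) x - cfun_apply (g n) x) < e" if "m \<ge> i" "n \<ge> i" for m n
      proof -
        have "norm (cfun_apply (g m) x - cfun_apply (g n) x) \<le>
            norm (cfun_apply (g m) x - cfun_apply (g i) x) + norm (cfun_apply (g n) x - cfun_apply (g i) x)"
          by norm
        then show ?thesis
          using i g_diff[OF that(1), of x] g_diff[OF that(2), of x] r[of m] r[of n] by linarith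
      qed
      then show "\<exists>M. \<forall>m\<ge>M. \<forall>n\<ge>M. norm (cfun_apply (g m) x - cfun_apply (g n) x) < e"
        by blast
    qed
    then show ?thesis
      unfolding Cauchy_convergent_iff convergent_LIMSEQ_iff .
  qed
  define G where "G = (\<lambda>x. lim (\<lambda>i. cfun_apply (g i) x))"
  have G: "norm (G x - cfun_apply (g i) x) \<le> r i" if "h x \<le> R i" for x i
  proof (rule tendsto_upperbound)
    show "(\<lambda>j. norm (cfun_apply (g j) x - cfun_apply (g i) x)) \<longlonglongrightarrow> norm (G x - cfun_apply (g i) x)"
      unfolding G_def by (intro tendsto_intros conv)
    show "\<forall>\<^sub>F j in sequentially. norm (cfun_apply (g j) x - cfun_apply (g i) x) \<le> r i"
      unfolding eventually_sequentially using g_diff[of i _ x] that r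
      by (intro exI[of _ i]) (smt (verit))
  qed simp
  \<comment> \<open>The limit is uniform only on each open set \<open>h < R i\<close>, but these
    sets cover the space, and continuity is local.\<close>
  have "continuous_on UNIV G"
    unfolding continuous_on_eq_continuous_at[OF open_UNIV]
  proof
    fix x
    obtain i where i: "h x < R i"
      using eventually_R zero_less_one by blast
    have "open {y. h y < R i}"
      by (intro open_Collect_less h continuous_intros)
    moreover have "continuous_on {y. h y < R i} G"
    proof (rule uniform_limit_theorem)
      show "uniform_limit {y. h y < R i} (\<lambda>j. cfun_apply (g j)) G sequentially"
      proof (rule uniform_limitI)
        fix e :: real assume "e > 0"
        have "dist (cfun_apply (g j) y) (G y) < e" if "r j < e" "i \<le> j" "h y < R i" for j y
          using G[of y j] R_mono[OF that(2)] that by (simp add: dist_norm norm_minus_commute)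
        with eventually_conj[OF order_tendstoD(2)[OF r_lim \<open>e > 0\<close>] eventually_ge_at_top[of i]]
        show "\<forall>\<^sub>F j in sequentially. \<forall>y\<in>{y. h y < R i}. dist (cfun_apply (g j) y) (G y) < e"
          by (auto elim: eventually_mono)
      qed
    qed (auto intro: always_eventually continuous_cfun)
    ultimately show "continuous (at x) G"
      using i by (simp add: continuous_on_eq_continuous_at)
  qed
  then have out: "cscale (1 / of_nat (Suc i)) (Cfun G) \<notin> U" for i
    using avoid[of i "Cfun G"] G[of _ i] by (simp add: cfun_apply_Cfun)
  obtain \<rho> where \<rho>: "\<rho> > 0" "\<And>c. norm c \<le> \<rho> \<Longrightarrow> cscale c (Cfun G) \<in> U"
    using absorb unfolding absorbing_def by metis
  obtain i where "1 / real (Suc i) < \<rho>"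
    using \<rho> nat_approx_posE by blast
  then have "norm (1 / of_nat (Suc i) :: 'k) \<le> \<rho>"
    by (simp add: norm_divide del: of_nat_Suc)
  with \<rho> out show False
    by blast
qed

section \<open>Cutoffs and the support of a barrel\<close>

text \<open>In place of a partition of unity, \<open>f\<close> is multiplied by factors
  \<open>1 - \<phi> z\<close> one after the other. Each factor changes it by a function supported
  inside the support of \<open>\<phi> z\<close>, hence in \<open>N\<close>, makes it vanish on
  \<open>V z\<close>, and preserves the zeros already there.\<close>

lemma cutoff_on_compact:
  fixes f :: "('a::topological_space, 'k::real_normed_field) cfun"
  assumes crs: "completely_regular_space (euclidean :: 'a topology)" and C: "compact C"
    and zero: "0 \<in> N" and add: "\<And>g g'. g \<in> N \<Longrightarrow> g' \<in> N \<Longrightarrow> g + g' \<in> N"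
    and loc: "\<And>x. x \<in> C \<Longrightarrow> \<exists>W. open W \<and> x \<in> W \<and> (\<forall>g. csupport g \<subseteq> W \<longrightarrow> g \<in> N)"
  obtains f' where "f - f' \<in> N" "\<And>x. x \<in> C \<Longrightarrow> cfun_apply f' x = 0"
    "\<And>x. cfun_apply f x = 0 \<Longrightarrow> cfun_apply f' x = 0"
proof -
  have "\<exists>V (\<phi> :: ('a, 'k) cfun). open V \<and> x \<in> V \<and> (\<forall>y\<in>V. cfun_apply \<phi> y = 1) \<and> (\<forall>g. csupport g \<subseteq> csupport \<phi> \<longrightarrow> g \<in> N)"
    if x: "x \<in> C" for x
  proof -
    obtain W where "open W" "x \<in> W" and W: "\<And>g. csupport g \<subseteq> W \<Longrightarrow> g \<in> N"
      using loc[OF x] by blast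
    obtain \<phi> :: "('a, 'k) cfun" and V where \<phi>: "open V" "x \<in> V"
      "\<And>y. y \<in> V \<Longrightarrow> cfun_apply \<phi> y = 1" "csupport \<phi> \<subseteq> W"
      by (rule bump[OF crs \<open>open W\<close> \<open>x \<in> W\<close>]) blast
    have "\<forall>g. csupport g \<subseteq> csupport \<phi> \<longrightarrow> g \<in> N"
      using W subset_trans[OF _ \<phi>(4)] by blast
    then show ?thesis
      by (intro exI[of _ V] exI[of _ \<phi>] conjI ballI \<phi>(1-3))
  qed
  then obtain V and \<phi> :: "'a \<Rightarrow> ('a, 'k) cfun" where V: "\<And>x. x \<in> C \<Longrightarrow> open (V x)" "\<And>x. x \<in> C \<Longrightarrow> x \<in> V x"
    and \<phi>: "\<And>x y. x \<in> C \<Longrightarrow> y \<in> V x \<Longrightarrow> cfun_apply (\<phi> x) y = 1"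
      "\<And>x g. x \<in> C \<Longrightarrow> csupport g \<subseteq> csupport (\<phi> x) \<Longrightarrow> g \<in> N"
    by metis
  obtain I where I: "I \<subseteq> C" "finite I" "C \<subseteq> (\<Union>x\<in>I. V x)"
    using compactE_image[OF C, of C V] V by blast
  have "\<exists>f'. f - f' \<in> N \<and> (\<forall>x. x \<in> (\<Union>x\<in>I. V x) \<or> cfun_apply f x = 0 \<longrightarrow> cfun_apply f' x = 0)"
    using I(2,1)
  proof (induction I rule: finite_induct)
    case empty
    show ?case
      by (intro exI[of _ f]) (use zero in auto)
  next
    case (insert z I)
    then obtain f' where f': "f - f' \<in> N"
      "\<And>x. x \<in> (\<Union>x\<in>I. V x) \<or> cfun_apply f x = 0 \<Longrightarrow> cfun_apply f' x = 0"
      by auto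
    have z: "z \<in> C"
      using insert.prems by simp
    have "cmult f' (\<phi> z) \<in> N"
      by (rule \<phi>(2)[OF z], rule csupport_subset) (simp add: cmult.rep_eq)
    moreover have "f - (f' - cmult f' (\<phi> z)) = (f - f') + cmult f' (\<phi> z)"
      by simp
    ultimately have "f - (f' - cmult f' (\<phi> z)) \<in> N"
      using add[OF f'(1)] by (simp only:)
    moreover have "cfun_apply (f' - cmult f' (\<phi> z)) x = 0"
      if "x \<in> (\<Union>x\<in>insert z I. V x) \<or> cfun_apply f x = 0" for x
      using that f'(2)[of x] \<phi>(1)[OF z, of x] by (auto simp: cfun_simps cmult.rep_eq)
    ultimately show ?case
      by blast
  qed
  then obtain f' where "f - f' \<in> N"
    and f': "\<And>x. x \<in> (\<Union>x\<in>I. V x) \<or> cfun_apply f x = 0 \<Longrightarrow> cfun_apply f' x = 0"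
    by auto
  show ?thesis
  proof (rule that[OF \<open>f - f' \<in> N\<close>])
    fix x assume "x \<in> C"
    show "cfun_apply f' x = 0"
      by (rule f') (use I(3) \<open>x \<in> C\<close> in blast)
  next
    fix x assume "cfun_apply f x = 0"
    then show "cfun_apply f' x = 0"
      by (simp add: f')
  qed
qed

text \<open>The support of a barrel in the sense of Nachbin and Shirota.\<close>

definition hold :: "('a::topological_space, 'k::real_normed_field) cfun set \<Rightarrow> 'a set" where
  "hold U = {x. \<forall>W. open W \<and> x \<in> W \<longrightarrow> (\<exists>f. csupport f \<subseteq> W \<and> f \<notin> U)}"

text \<open>Cutting \<open>f\<close> off near its support within a compact test set \<open>S\<close>
  leaves a function \<open>f'\<close> vanishing on \<open>S\<close>. Then \<open>f - f'\<close>
  agrees with \<open>f\<close> on \<open>S\<close>, so it should be outside of \<open>U\<close>, yet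
  it is built from pieces in \<open>U\<close>. Only the part of \<open>hold U\<close> in
  \<open>Z\<close> matters since test sets for \<open>Tk Z\<close> lie in \<open>Z\<close>.\<close>

lemma in_barrel_if_csupport_disjoint_hold:
  fixes U :: "('a::topological_space, 'k::real_normed_field) cfun set"
  assumes crs: "completely_regular_space (euclidean :: 'a topology)"
    and closed: "closedin (Tk Z) U" and convex: "absolutely_convex cscale U"
    and absorb: "absorbing cscale U" and disj: "csupport f \<inter> (hold U \<inter> Z) = {}"
  shows "f \<in> U"
proof (rule ccontr)
  assume "f \<notin> U"
  then obtain S \<epsilon> where S: "compact S" "S \<subseteq> Z" "\<epsilon> > 0" and out:
    "\<And>g. (\<And>x. x \<in> S \<Longrightarrow> norm (cfun_apply g x - cfun_apply f x) \<le> \<epsilon>) \<Longrightarrow> g \<notin> U"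
    by (rule closedin_TkD[OF closed]) blast
  \<comment> \<open>Demanding all scalar multiples makes \<open>N\<close> closed under addition,
    which \<open>U\<close> is not. It costs nothing locally, as scaling does not enlarge
    supports.\<close>
  define N where "N = {g. \<forall>c. cscale c g \<in> U}"
  have "cscale 0 0 \<in> U"
    using absorb unfolding absorbing_def by (metis less_imp_le norm_zero)
  then have zero: "0 \<in> N"
    by (simp add: N_def) (metis cscale_simps(1,3) mult_zero_right)
  have add: "g + g' \<in> N" if "g \<in> N" "g' \<in> N" for g g'
  proof -
    have "cscale c (g + g') = cscale c g + cscale c g'" for c
      by (rule cfun_ext) (simp add: cfun_simps algebra_simps)
    then show ?thesis
      using that by (auto simp: N_def intro!: absolutely_convex_half_sum[OF convex])
  qed
  have loc: "\<exists>W. open W \<and> x \<in> W \<and> (\<forall>g. csupport g \<subseteq> W \<longrightarrow> g \<in> N)" if x: "x \<in> S \<inter> csupport f" for x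
  proof -
    have "x \<notin> hold U"
      using x disj S by blast
    then obtain W where W: "open W" "x \<in> W" "\<And>g. csupport g \<subseteq> W \<Longrightarrow> g \<in> U"
      unfolding hold_def by blast
    have "csupport (cscale c g) \<subseteq> csupport g" for c g
      by (rule csupport_subset) (simp add: cfun_simps)
    then show ?thesis
      using W unfolding N_def by (intro exI[of _ W]) (blast intro: subset_trans)
  qed
  obtain f' where f': "f - f' \<in> N" "\<And>x. x \<in> S \<inter> csupport f \<Longrightarrow> cfun_apply f' x = 0"
    "\<And>x. cfun_apply f x = 0 \<Longrightarrow> cfun_apply f' x = 0"
    by (rule cutoff_on_compact[OF crs compact_Int_closed[OF S(1) closed_csupport] zero add loc, where f = f])
      blast+
  have "cscale 1 (f - f') \<in> U"
    using f'(1) unfolding N_def by blast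
  then have "f - f' \<in> U"
    by simp
  moreover have "f - f' \<notin> U"
  proof (rule out)
    fix x assume "x \<in> S"
    then have "cfun_apply f' x = 0"
      using f'(2,3) not_in_csupport[of x f] by blast
    then show "norm (cfun_apply (f - f') x - cfun_apply f x) \<le> \<epsilon>"
      using S by (simp add: cfun_simps)
  qed
  ultimately show False
    by simp
qed

text \<open>The gliding hump with \<open>norm \<circ> h\<close> as exhausting function gives
  \<open>R\<close> such that functions vanishing where that norm is at most \<open>R\<close> lie in
  \<open>U\<close>; hence no point with a larger value belongs to the support of the barrel.\<close>

lemma functionally_bounded_hold:
  fixes U :: "('a::t2_space, 'k::{real_normed_field, banach}) cfun set"
  assumes closed: "closedin (Tk UNIV) U" and convex: "absolutely_convex cscale U"
    and absorb: "absorbing cscale U"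
  shows "functionally_bounded TYPE('k) (hold U)"
  unfolding functionally_bounded_def
proof
  fix h :: "('a, 'k) cfun"
  have cont: "continuous_on UNIV (\<lambda>x. norm (cfun_apply h x))"
    by (intro continuous_intros continuous_cfun)
  obtain R \<epsilon> where R: "\<epsilon> > 0"
    "\<And>f. (\<And>x. norm (cfun_apply h x) \<le> R \<Longrightarrow> norm (cfun_apply f x) \<le> \<epsilon>) \<Longrightarrow> f \<in> U"
    by (rule barrel_contains_small_functions[OF closed convex absorb cont]) blast
  have "norm (cfun_apply h x) \<le> R" if x: "x \<in> hold U" for x
  proof (rule ccontr)
    assume neg: "\<not> norm (cfun_apply h x) \<le> R"
    have "open {y. R < norm (cfun_apply h y)}"
      by (intro open_Collect_less cont continuous_intros)
    moreover have "x \<in> {y. R < norm (cfun_apply h y)}"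
      using neg by simp
    ultimately obtain f where f: "csupport f \<subseteq> {y. R < norm (cfun_apply h y)}" "f \<notin> U"
      using x unfolding hold_def by blast
    have "norm (cfun_apply f y) \<le> \<epsilon>" if "norm (cfun_apply h y) \<le> R" for y
    proof -
      have "y \<notin> csupport f"
        using that f(1) by auto
      then show ?thesis
        using R(1) by (simp add: not_in_csupport)
    qed
    then have "f \<in> U"
      by (rule R(2))
    then show False
      using f(2) by simp
  qed
  then show "bounded (cfun_apply h ` hold U)"
    by (auto simp: bounded_iff)
qed

text \<open>This is the gliding hump with the constant 0 as exhausting function: for
  \<open>R \<ge> 0\<close> its smallness condition is imposed everywhere, for \<open>R < 0\<close>
  nowhere, and a uniformly small function satisfies it in both cases.\<close>

lemma barrel_contains_sup_ball:
  fixes U :: "('a::t2_space, 'k::{real_normed_field, banach}) cfun set"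
  assumes "closedin (Tk UNIV) U" "absolutely_convex cscale U" "absorbing cscale U"
  obtains \<epsilon> where "\<epsilon> > 0" "\<And>f. (\<And>x. norm (cfun_apply f x) \<le> \<epsilon>) \<Longrightarrow> f \<in> U"
proof (rule barrel_contains_small_functions[OF assms continuous_on_const])
  fix R \<epsilon> :: real
  assume \<epsilon>: "\<epsilon> > 0" "\<And>f. (\<And>x. 0 \<le> R \<Longrightarrow> norm (cfun_apply f x) \<le> \<epsilon>) \<Longrightarrow> f \<in> U"
  show thesis
  proof (rule that[OF \<epsilon>(1)])
    fix f :: "('a, 'k) cfun"
    assume "norm (cfun_apply f x) \<le> \<epsilon>" for x
    then show "f \<in> U"
      by (intro \<epsilon>(2))
  qed
qed

lemma functionally_bounded_subset:
  fixes k :: "'b::real_normed_field itself" and A :: "'a::t2_space set"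
  assumes "functionally_bounded k A" "B \<subseteq> A"
  shows "functionally_bounded k B"
  unfolding functionally_bounded_def
proof
  fix f :: "('a, 'b) cfun"
  have "bounded (cfun_apply f ` A)"
    using assms(1) unfolding functionally_bounded_def ..
  then show "bounded (cfun_apply f ` B)"
    by (rule bounded_subset) (intro image_mono assms)
qed

lemma norm_le_on_closure:
  assumes "\<And>x. x \<in> A \<Longrightarrow> norm (cfun_apply f x) \<le> \<epsilon>" "x \<in> closure A"
  shows "norm (cfun_apply f x) \<le> \<epsilon>"
proof -
  have "closed {x. norm (cfun_apply f x) \<le> \<epsilon>}"
    by (intro closed_Collect_le continuous_intros continuous_cfun)
  then have "closure A \<subseteq> {x. norm (cfun_apply f x) \<le> \<epsilon>}"
    using assms(1) by (intro closure_minimal) auto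
  then show ?thesis
    using assms(2) by auto
qed

lemma compact_closure_Int:
  fixes H :: "'a::t2_space set"
  assumes "compact H"
  shows "compact (closure (H \<inter> X))"
proof -
  have "closure (H \<inter> X) \<subseteq> H"
    using assms by (intro closure_minimal compact_imp_closed) auto
  then show ?thesis
    using compact_Int_closed[OF assms closed_closure, of "H \<inter> X"] by (simp add: Int_absorb1)
qed

text \<open>Split \<open>f\<close> into its truncation at \<open>e / 2\<close> and the rest. Twice
  the truncation is uniformly bounded by \<open>e\<close>; the rest is supported where
  \<open>f\<close> has norm at least \<open>e / 2\<close>, and this set misses \<open>A\<close>,
  where the norm is at most \<open>e / 4\<close>. Doubling pays for forming the sum inside an
  absolutely convex set.\<close>

lemma barrel_contains_cball0:
  fixes U :: "('a::t2_space, 'k::{real_normed_field, banach}) cfun set"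
  assumes crs: "completely_regular_space (euclidean :: 'a topology)"
    and mu: "mu_space TYPE('k) TYPE('a)" and Z: "Z = X \<or> k_dense X"
    and closed: "closedin (Tk Z) U" and convex: "absolutely_convex cscale U"
    and absorb: "absorbing cscale U"
  obtains A \<epsilon> where "A \<subseteq> X" "compact (closure A)" "\<epsilon> > 0" "cball0 A \<epsilon> \<subseteq> U"
proof -
  have closed': "closedin (Tk UNIV) U"
    using closedin_Tk_mono[OF closed] by simp
  obtain e where e: "e > 0" "\<And>f. (\<And>x. norm (cfun_apply f x) \<le> e) \<Longrightarrow> f \<in> U"
    by (rule barrel_contains_sup_ball[OF closed' convex absorb]) blast
  define A where "A = hold U \<inter> Z"
  have "functionally_bounded TYPE('k) A"
    using functionally_bounded_hold[OF closed' convex absorb]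
    by (rule functionally_bounded_subset) (simp add: A_def)
  then have cA: "compact (closure A)"
    using mu unfolding mu_space_def by blast
  have ball: "cball0 A (e / 4) \<subseteq> U"
  proof
    fix f :: "('a, 'k) cfun" assume f: "f \<in> cball0 A (e / 4)"
    define g where "g = clip (e / 2) f"
    have "cscale 2 g \<in> U"
      using norm_clip_le[of "e / 2" f] e by (auto intro!: e(2) simp: cfun_simps norm_mult g_def mult.commute)
    moreover have "cscale 2 (f - g) \<in> U"
    proof (rule in_barrel_if_csupport_disjoint_hold[OF crs closed convex absorb])
      have "csupport (cscale 2 (f - g)) \<subseteq> {x. e / 2 \<le> norm (cfun_apply f x)}"
      proof (rule csupport_subset_closed)
        show "closed {x. e / 2 \<le> norm (cfun_apply f x)}"
          by (intro closed_Collect_le continuous_intros continuous_cfun)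
        show "x \<in> {x. e / 2 \<le> norm (cfun_apply f x)}" if "cfun_apply (cscale 2 (f - g)) x \<noteq> 0" for x
          using that clip_eq[of "e / 2" f x] e by (force simp: cfun_simps g_def)
      qed
      then show "csupport (cscale 2 (f - g)) \<inter> (hold U \<inter> Z) = {}"
        using f e by (force simp: cball0_def A_def)
    qed
    ultimately have "g + (f - g) \<in> U"
      by (rule absolutely_convex_half_sum[OF convex])
    then show "f \<in> U"
      by simp
  qed
  show ?thesis
  proof (cases "Z = X")
    case True
    then show ?thesis
      using that[of A "e / 4"] cA ball e by (simp add: A_def)
  next
    case False
    \<comment> \<open>Here \<open>A\<close> may lie off \<open>X\<close>. By k-density it sits in a
      compact set in which the points of \<open>X\<close> are dense, and bounds on those points pass
      to the closure.\<close>
    then obtain S where S: "compact S" "closure A \<subseteq> S" "S \<subseteq> closure (S \<inter> X)"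
      using Z cA unfolding k_dense_def by blast
    have "cball0 (S \<inter> X) (e / 4) \<subseteq> (cball0 A (e / 4) :: ('a, 'k) cfun set)"
    proof
      fix f :: "('a, 'k) cfun" assume f: "f \<in> cball0 (S \<inter> X) (e / 4)"
      have "norm (cfun_apply f x) \<le> e / 4" if "x \<in> A" for x
      proof (rule norm_le_on_closure)
        show "x \<in> closure (S \<inter> X)"
          using that S(2,3) closure_subset by blast
      qed (use f in \<open>simp add: cball0_def\<close>)
      then show "f \<in> cball0 A (e / 4)"
        by (simp add: cball0_def)
    qed
    moreover have "compact (closure (S \<inter> X))"
      by (rule compact_closure_Int[OF S(1)])
    ultimately show ?thesis
      using that[of "S \<inter> X" "e / 4"] ball e by auto
  qed
qed

lemma cfun_apply_sum: "cfun_apply (sum f I) x = (\<Sum>i\<in>I. cfun_apply (f i) x)"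
  by (induction I rule: infinite_finite_induct) (auto simp: cfun_simps)

lemma separate_finite_set:
  fixes Y :: "'a::t2_space set"
  assumes "finite Y"
  obtains W where "\<And>y. y \<in> Y \<Longrightarrow> open (W y)" "\<And>y. y \<in> Y \<Longrightarrow> y \<in> W y"
    "\<And>y z. y \<in> Y \<Longrightarrow> z \<in> Y \<Longrightarrow> y \<noteq> z \<Longrightarrow> W y \<inter> W z = {}"
proof -
  have "\<forall>y z :: 'a. \<exists>U V. y \<noteq> z \<longrightarrow> open U \<and> open V \<and> y \<in> U \<and> z \<in> V \<and> U \<inter> V = {}"
  proof (intro allI)
    show "\<exists>U V. y \<noteq> z \<longrightarrow> open U \<and> open V \<and> y \<in> U \<and> z \<in> V \<and> U \<inter> V = {}" for y z :: 'a
      by (cases "y = z") (use hausdorff[of y z] in simp_all)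
  qed
  then obtain U V :: "'a \<Rightarrow> 'a \<Rightarrow> 'a set" where UV: "\<And>y z. y \<noteq> z \<Longrightarrow>
      open (U y z) \<and> open (V y z) \<and> y \<in> U y z \<and> z \<in> V y z \<and> U y z \<inter> V y z = {}"
    by metis
  show ?thesis
  proof
    let ?W = "\<lambda>y. \<Inter>z\<in>Y - {y}. U y z \<inter> V z y"
    show "open (?W y)" if "y \<in> Y" for y
      using UV assms by (intro open_INT) auto
    show "y \<in> ?W y" for y
    proof (intro INT_I IntI)
      show "y \<in> U y z" "y \<in> V z y" if "z \<in> Y - {y}" for z
        using UV[of y z] UV[of z y] that by auto
    qed
    show "?W y \<inter> ?W z = {}" if "y \<in> Y" "z \<in> Y" "y \<noteq> z" for y z
    proof -
      have "?W y \<subseteq> U y z" "?W z \<subseteq> V y z"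
        using that by auto
      then show ?thesis
        using UV[OF that(3)] by blast
    qed
  qed
qed

lemma cb_derivative_subset: "cb_derivative Y n \<subseteq> Y"
  by (induction n) (auto simp: cb_derivative_0 cb_derivative_Suc nonisolated_def)


section \<open>Null sequences of functionals detecting non-precompact sets\<close>

text \<open>This is what remains of a witnessing sequence once the topology is forgotten:
  \<open>A\<close> and \<open>C\<close> come from its polar barrel, and \<open>detect\<close> is the
  strong Gelfand--Phillips property for triangular sequences. The bound \<open>e i\<close> is
  uniform in \<open>n\<close>; together with pointwise convergence for the finitely many remaining
  \<open>i\<close> it gives uniform convergence on the sequence.\<close>

locale detecting_null_sequence =
  fixes X A :: "'a::t2_space set" and C :: real
    and \<mu> :: "nat \<Rightarrow> ('a, 'k::{real_normed_field, euclidean_space}) cfun \<Rightarrow> 'k"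
  assumes crs: "completely_regular_space (euclidean :: 'a topology)"
    and add: "\<And>n f g. \<mu> n (f + g) = \<mu> n f + \<mu> n g"
    and scale: "\<And>n c f. \<mu> n (cscale c f) = c * \<mu> n f"
    and null: "\<And>f. (\<lambda>n. \<mu> n f) \<longlonglongrightarrow> 0"
    and A_sub: "A \<subseteq> X" and A_compact: "compact (closure A)"
    and C_nonneg: "C \<ge> 0"
    and bound: "\<And>n f r. r \<ge> 0 \<Longrightarrow> (\<And>x. x \<in> A \<Longrightarrow> norm (cfun_apply f x) \<le> r) \<Longrightarrow>
      norm (\<mu> n f) \<le> C * r"
    and detect: "\<And>B f x e. B \<subseteq> X \<Longrightarrow> compact (closure B) \<Longrightarrow> (\<And>i. x i \<in> B) \<Longrightarrow>
      (\<And>i y. norm (cfun_apply (f i) y) \<le> 1) \<Longrightarrow>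
      (\<And>i::nat. 1 / 2 \<le> norm (cfun_apply (f i) (x i))) \<Longrightarrow>
      (\<And>i j. i < j \<Longrightarrow> cfun_apply (f j) (x i) = 0) \<Longrightarrow>
      (\<And>n i. norm (\<mu> n (f i)) \<le> e i) \<Longrightarrow> e \<longlonglongrightarrow> 0 \<Longrightarrow> False"
begin

lemma zero: "\<mu> n 0 = 0"
  using scale[of n 0 0] by simp

lemma sum: "\<mu> n (sum f I) = (\<Sum>i\<in>I. \<mu> n (f i))"
  by (induction I rule: infinite_finite_induct) (auto simp: zero add)

lemma bound_1:
  assumes "\<And>x. norm (cfun_apply f x) \<le> 1"
  shows "norm (\<mu> n f) \<le> C"
  using bound[of 1 f n] assms by simp

lemma cong_on_A:
  assumes "\<And>x. x \<in> A \<Longrightarrow> cfun_apply f x = cfun_apply g x"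
  shows "\<mu> n f = \<mu> n g"
proof -
  have "norm (\<mu> n (f + cscale (- 1) g)) \<le> C * 0"
    by (rule bound) (auto simp: cfun_simps assms)
  then show ?thesis
    by (simp add: add scale)
qed

text \<open>Bumps at infinitely many such points, each avoiding \<open>closure A\<close> and the
  earlier points, are annihilated by every \<open>\<mu> n\<close>, and \<open>detect\<close> applies
  with the zero sequence as bound.\<close>

lemma finite_outside_closure:
  assumes "compact H"
  shows "finite (H \<inter> X - closure A)"
proof (rule ccontr)
  assume inf: "infinite (H \<inter> X - closure A)"
  then obtain x :: "nat \<Rightarrow> 'a" where x: "inj x" "range x \<subseteq> H \<inter> X - closure A"
    unfolding infinite_iff_countable_subset by blast
  have "\<exists>f :: ('a, 'k) cfun. (\<forall>y. norm (cfun_apply f y) \<le> 1) \<and> cfun_apply f (x i) = 1 \<and>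
      (\<forall>y\<in>closure A \<union> x ` {..<i}. cfun_apply f y = 0)" for i
  proof -
    have "open (- (closure A \<union> x ` {..<i}))"
      by (intro open_Compl closed_Un closed_closure finite_imp_closed[of "x ` {..<i}"]) simp
    moreover have "x i \<in> - (closure A \<union> x ` {..<i})"
      using x by (auto dest: injD)
    ultimately obtain f :: "('a, 'k) cfun" and V where f: "x i \<in> V" "\<And>y. y \<in> V \<Longrightarrow> cfun_apply f y = 1"
      "csupport f \<subseteq> - (closure A \<union> x ` {..<i})" "\<And>y. norm (cfun_apply f y) \<le> 1"
      by (rule bump[OF crs]) blast
    then show ?thesis
      using not_in_csupport[of _ f] by (intro exI[of _ f]) blast
  qed
  then obtain f :: "nat \<Rightarrow> ('a, 'k) cfun" where f: "\<And>i y. norm (cfun_apply (f i) y) \<le> 1"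
    "\<And>i. cfun_apply (f i) (x i) = 1"
    "\<And>i y. y \<in> closure A \<union> x ` {..<i} \<Longrightarrow> cfun_apply (f i) y = 0"
    by metis
  have vanish: "\<mu> n (f i) = 0" for n i
    using bound[of 0 "f i" n] f(3)[of _ i] closure_subset[of A] by auto
  have "compact (closure (H \<inter> X))"
    by (rule compact_closure_Int[OF assms])
  then show False
  proof (rule detect[of "H \<inter> X" x f "\<lambda>_. 0", rotated])
    show "cfun_apply (f j) (x i) = 0" if "i < j" for i j
      using that by (intro f(3)) auto
    show "x i \<in> H \<inter> X" for i
      using x(2) by auto
  qed (auto simp: f vanish)
qed

text \<open>If no finite \<open>D\<close> works, a counterexample can always be chosen to vanish at
  all points used before, with functionals at most \<open>1 / Suc i\<close>. After normalization
  these form a triangular sequence contradicting \<open>detect\<close>.\<close>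

lemma lower_bound:
  obtains D \<delta> where "finite D" "D \<subseteq> A" "\<delta> > 0"
    "\<And>f b x. (\<And>y. y \<in> D \<Longrightarrow> cfun_apply f y = 0) \<Longrightarrow> (\<And>n. norm (\<mu> n f) \<le> b) \<Longrightarrow>
      x \<in> closure A \<Longrightarrow> \<delta> * norm (cfun_apply f x) \<le> b"
proof (rule ccontr)
  note that' = that
  assume contra: "\<not> thesis"
  have normalized: "\<exists>f x. (\<forall>y\<in>D. cfun_apply f y = 0) \<and> (\<forall>y. norm (cfun_apply f y) \<le> 1) \<and> x \<in> A \<and>
      1 / 2 \<le> norm (cfun_apply f x) \<and> (\<forall>n. norm (\<mu> n f) \<le> \<delta>)"
    if D: "finite D" "D \<subseteq> A" and \<delta>: "\<delta> > 0" for D \<delta>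
  proof -
    have "\<exists>f b x. (\<forall>y\<in>D. cfun_apply f y = 0) \<and> (\<forall>n. norm (\<mu> n f) \<le> b) \<and> x \<in> closure A \<and>
        \<not> \<delta> * norm (cfun_apply f x) \<le> b"
    proof (rule ccontr)
      assume neg: "\<not> ?thesis"
      have thesis
        by (rule that'[OF D \<delta>]) (use neg in blast)
      with contra show False ..
    qed
    then obtain f b x where f: "\<And>y. y \<in> D \<Longrightarrow> cfun_apply f y = 0" "\<And>n. norm (\<mu> n f) \<le> b"
      "x \<in> closure A" "\<not> \<delta> * norm (cfun_apply f x) \<le> b"
      by blast
    have "b \<ge> 0"
      by (rule order_trans[OF norm_ge_zero f(2)[of 0]])
    have "\<exists>x0\<in>closure A. \<forall>y\<in>closure A. norm (cfun_apply f y) \<le> norm (cfun_apply f x0)"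
      by (rule continuous_attains_sup[OF A_compact _ continuous_on_norm[OF continuous_cfun]])
        (use f(3) in auto)
    then obtain x0 where x0: "x0 \<in> closure A"
      "\<And>y. y \<in> closure A \<Longrightarrow> norm (cfun_apply f y) \<le> norm (cfun_apply f x0)"
      by blast
    define s where "s = norm (cfun_apply f x0)"
    have "norm (cfun_apply f x) \<le> s"
      using x0(2)[OF f(3)] by (simp add: s_def)
    then have "\<delta> * norm (cfun_apply f x) \<le> \<delta> * s"
      using \<delta> by (intro mult_left_mono) auto
    then have s: "b < \<delta> * s"
      using f(4) by linarith
    then have "s > 0"
      using \<open>b \<ge> 0\<close> \<delta> by (smt (verit) mult_nonneg_nonpos)
    \<comment> \<open>The maximum is attained only on \<open>closure A\<close>. Giving up a factor 2
      yields a point of \<open>A\<close> itself, which is the origin of the \<open>1 / 2\<close> in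
      \<open>detect\<close>.\<close>
    have "open {y. s / 2 < norm (cfun_apply f y)}"
      by (intro open_Collect_less continuous_intros continuous_cfun)
    moreover have "x0 \<in> closure A \<inter> {y. s / 2 < norm (cfun_apply f y)}"
      using x0 \<open>s > 0\<close> by (auto simp: s_def)
    ultimately obtain x' where x': "x' \<in> A" "s / 2 < norm (cfun_apply f x')"
      using open_Int_closure_eq_empty[of "{y. s / 2 < norm (cfun_apply f y)}" A] by blast
    \<comment> \<open>Dividing by \<open>s\<close> bounds the function by 1 on \<open>A\<close>
      only; truncation bounds it everywhere, without changing the functionals since they depend only
      on the values on \<open>A\<close>.\<close>
    define f' where "f' = clip 1 (cscale (1 / of_real s) f)"
    have f'_eq: "cfun_apply f' y = cfun_apply f y / of_real s" if "y \<in> A" for y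
    proof -
      have "norm (cfun_apply f y) \<le> s"
        using x0(2) that closure_subset unfolding s_def by blast
      then have "norm (cfun_apply (cscale (1 / of_real s) f) y) \<le> 1"
        using \<open>s > 0\<close> by (simp add: cfun_simps norm_divide)
      then show ?thesis
        by (simp add: f'_def clip_eq cfun_simps)
    qed
    have f'_functional: "\<mu> n f' = \<mu> n (cscale (1 / of_real s) f)" for n
      by (rule cong_on_A) (simp add: f'_eq cfun_simps)
    have "norm (\<mu> n f') \<le> \<delta>" for n
    proof -
      have "norm (\<mu> n f) \<le> \<delta> * s"
        using f(2)[of n] s by linarith
      moreover have "norm (\<mu> n f') = norm (\<mu> n f) / s"
        using \<open>s > 0\<close> by (simp add: f'_functional scale norm_divide norm_mult)
      ultimately show ?thesis
        using \<open>s > 0\<close> by (simp add: divide_le_eq)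
    qed
    moreover have "1 / 2 \<le> norm (cfun_apply f' x')"
      using x' \<open>s > 0\<close> by (simp add: f'_eq norm_divide field_simps)
    moreover have "cfun_apply f' y = 0" if "y \<in> D" for y
      using that D f(1) f'_eq[of y] by auto
    moreover have "norm (cfun_apply f' y) \<le> 1" for y
      by (simp add: f'_def norm_clip_le)
    ultimately show ?thesis
      using x' by blast
  qed
  \<comment> \<open>\<open>D\<close> is carried along to collect the points found before, at which
    the next function has to vanish.\<close>
  define P :: "nat \<Rightarrow> ('a set \<times> ('a, 'k) cfun \<times> 'a) \<Rightarrow> bool" where
    "P i = (\<lambda>(D, f, x). finite D \<and> D \<subseteq> A \<and> (\<forall>y\<in>D. cfun_apply f y = 0) \<and>
      (\<forall>y. norm (cfun_apply f y) \<le> 1) \<and> x \<in> A \<and> 1 / 2 \<le> norm (cfun_apply f x) \<and>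
      (\<forall>n. norm (\<mu> n f) \<le> 1 / real (Suc i)))" for i
  define Q :: "('a set \<times> ('a, 'k) cfun \<times> 'a) \<Rightarrow> ('a set \<times> ('a, 'k) cfun \<times> 'a) \<Rightarrow> bool" where
    "Q = (\<lambda>(D, f, x) (D', f', x'). D' = insert x D)"
  have "\<exists>s. P 0 s"
    using normalized[of "{}" 1] by (auto simp: P_def)
  moreover have "\<exists>s'. P (Suc i) s' \<and> Q s s'" if P: "P i s" for s i
  proof -
    obtain D f x where s: "s = (D, f, x)"
      by (cases s)
    have *: "finite (insert x D)" "insert x D \<subseteq> A" "1 / real (Suc (Suc i)) > 0"
      using P by (auto simp: P_def s)
    obtain f' x' where "(\<forall>y\<in>insert x D. cfun_apply f' y = 0) \<and> (\<forall>y. norm (cfun_apply f' y) \<le> 1) \<and> x' \<in> A \<and>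
      1 / 2 \<le> norm (cfun_apply f' x') \<and> (\<forall>n. norm (\<mu> n f') \<le> 1 / real (Suc (Suc i)))"
      using normalized[OF *] by blast
    then have "P (Suc i) (insert x D, f', x') \<and> Q s (insert x D, f', x')"
      using * by (simp add: P_def Q_def s)
    then show ?thesis
      by blast
  qed
  ultimately obtain s where s: "\<And>i. P i (s i)" "\<And>i. Q (s i) (s (Suc i))"
    using dependent_nat_choice[of P "\<lambda>_. Q"] by blast
  define D where "D = (\<lambda>i. fst (s i))"
  define f where "f = (\<lambda>i. fst (snd (s i)))"
  define x where "x = (\<lambda>i. snd (snd (s i)))"
  have seq: "s i = (D i, f i, x i)" for i
    by (simp add: D_def f_def x_def)
  have D_Suc: "D (Suc i) = insert (x i) (D i)" for i
    using s(2)[of i] by (simp add: Q_def seq)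
  have mem: "x i \<in> D j" if "i < j" for i j
    using that by (induction j) (auto simp: D_Suc less_Suc_eq)
  show False
  proof (rule detect[of A x f "\<lambda>i. 1 / real (Suc i)"])
    show "cfun_apply (f j) (x i) = 0" if "i < j" for i j
      using s(1)[of j] mem[OF that] by (auto simp: P_def seq)
    show "(\<lambda>i. 1 / real (Suc i)) \<longlonglongrightarrow> 0"
      using LIMSEQ_inverse_real_of_nat by (simp add: inverse_eq_divide)
    fix i n y
    show "x i \<in> A" "norm (cfun_apply (f i) y) \<le> 1" "1 / 2 \<le> norm (cfun_apply (f i) (x i))"
      "norm (\<mu> n (f i)) \<le> 1 / real (Suc i)"
      using s(1)[of i] by (auto simp: P_def seq)
  qed (use A_sub A_compact in auto)
qed

text \<open>The points to which the measure \<open>\<mu> n\<close> gives mass at least \<open>\<eta>\<close>.\<close>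

definition atoms :: "nat \<Rightarrow> real \<Rightarrow> 'a set" where
  "atoms n \<eta> = {y. \<forall>W. open W \<and> y \<in> W \<longrightarrow>
    (\<exists>g. csupport g \<subseteq> W \<and> (\<forall>x. norm (cfun_apply g x) \<le> 1) \<and> \<eta> \<le> norm (\<mu> n g))}"

text \<open>Test functions at \<open>m\<close> atoms can be given disjoint supports, so their
  unimodular combinations are bounded by 1. With aligned phases \<open>\<mu> n\<close> is at least
  \<open>m * \<eta>\<close> on one of them, whereas \<open>C\<close> bounds it.\<close>

lemma finite_atoms:
  assumes "\<eta> > 0"
  shows "finite (atoms n \<eta>)"
proof (rule ccontr)
  assume inf: "infinite (atoms n \<eta>)"
  obtain m where m: "C / \<eta> < real m"
    using reals_Archimedean2 by blast
  obtain Y where Y: "Y \<subseteq> atoms n \<eta>" "finite Y" "card Y = m"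
    using infinite_arbitrarily_large[OF inf] by blast
  obtain W where W: "\<And>y. y \<in> Y \<Longrightarrow> open (W y)" "\<And>y. y \<in> Y \<Longrightarrow> y \<in> W y"
    "\<And>y z. y \<in> Y \<Longrightarrow> z \<in> Y \<Longrightarrow> y \<noteq> z \<Longrightarrow> W y \<inter> W z = {}"
    using separate_finite_set[OF Y(2)] by blast
  have "\<exists>g. csupport g \<subseteq> W y \<and> (\<forall>x. norm (cfun_apply g x) \<le> 1) \<and> \<eta> \<le> norm (\<mu> n g)" if "y \<in> Y" for y
    using Y(1) W that unfolding atoms_def by blast
  then obtain g where g: "\<And>y. y \<in> Y \<Longrightarrow> csupport (g y) \<subseteq> W y"
    "\<And>y x. y \<in> Y \<Longrightarrow> norm (cfun_apply (g y) x) \<le> 1" "\<And>y. y \<in> Y \<Longrightarrow> \<eta> \<le> norm (\<mu> n (g y))"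
    by metis
  \<comment> \<open>The phase that makes each contribution a nonnegative real, so that nothing
    cancels in the sum.\<close>
  define c where "c = (\<lambda>y. of_real (norm (\<mu> n (g y))) / \<mu> n (g y))"
  define f where "f = (\<Sum>y\<in>Y. cscale (c y) (g y))"
  have "\<mu> n (g y) \<noteq> 0" if "y \<in> Y" for y
    using g(3)[OF that] assms by auto
  then have c: "c y * \<mu> n (g y) = of_real (norm (\<mu> n (g y)))" "norm (c y) = 1" if "y \<in> Y" for y
    using that by (auto simp: c_def norm_divide)
  have disj: "cfun_apply (g z) x = 0" if "y \<in> Y" "z \<in> Y" "y \<noteq> z" "cfun_apply (g y) x \<noteq> 0" for x y z
    using that g(1)[of y] g(1)[of z] W(3)[of y z] not_in_csupport[of x "g y"] not_in_csupport[of x "g z"]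
    by blast
  have "norm (cfun_apply f x) \<le> 1" for x
  proof (cases "\<exists>y\<in>Y. cfun_apply (g y) x \<noteq> 0")
    case True
    then obtain y where y: "y \<in> Y" "cfun_apply (g y) x \<noteq> 0"
      by blast
    have "cfun_apply f x = (\<Sum>z\<in>Y. c z * cfun_apply (g z) x)"
      by (simp add: f_def cfun_apply_sum cfun_simps)
    also have "\<dots> = (\<Sum>z\<in>{y}. c z * cfun_apply (g z) x)"
      using Y(2) y(1) disj[OF y(1) _ _ y(2)]
      by (intro Groups_Big.sum.mono_neutral_right) (auto dest: not_sym)
    also have "\<dots> = c y * cfun_apply (g y) x"
      by simp
    finally show ?thesis
      using c(2)[OF y(1)] g(2)[OF y(1)] by (simp add: norm_mult)
  next
    case False
    then show ?thesis
      by (simp add: f_def cfun_apply_sum cfun_simps)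
  qed
  then have "norm (\<mu> n f) \<le> C"
    by (rule bound_1)
  moreover have "\<mu> n f = of_real (\<Sum>y\<in>Y. norm (\<mu> n (g y)))"
    by (simp add: f_def sum scale c)
  then have "norm (\<mu> n f) = (\<Sum>y\<in>Y. norm (\<mu> n (g y)))"
    by (simp only: norm_of_real) (simp add: sum_nonneg)
  moreover have "(\<Sum>y\<in>Y. norm (\<mu> n (g y))) \<ge> (\<Sum>y\<in>Y. \<eta>)"
    by (intro sum_mono g)
  ultimately have "real m * \<eta> \<le> C"
    using Y by simp
  then show False
    using m assms by (simp add: field_simps)
qed

text \<open>
  The uniform norm of a sum of bumps can grow although, as in \<open>c\<^sub>0\<close>, the functionals \<open>\<mu> n\<close>
  remain bounded on it: \<open>\<mu> n\<close> is small on \<open>f\<close> for large \<open>n\<close>, and for the finitely many other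
  indices \<open>n\<close> it is small on the new bump, unless that is placed at an atom.
\<close>

lemma add_bump:
  assumes f: "\<And>n. norm (\<mu> n f) < C + 1"
  obtains N \<eta> where "\<eta> > 0"
    "\<And>y W. y \<notin> (\<Union>n<N. atoms n \<eta>) \<Longrightarrow> open W \<Longrightarrow> y \<in> W \<Longrightarrow>
      \<exists>g V. open V \<and> y \<in> V \<and> (\<forall>z\<in>V. cfun_apply g z = 1) \<and> csupport g \<subseteq> W \<and>
        (\<forall>n. norm (\<mu> n (f + g)) < C + 1)"
proof -
  have "\<forall>\<^sub>F n in sequentially. norm (\<mu> n f) < 1"
    using null[of f] by (intro order_tendstoD(2)[OF tendsto_norm_zero]) auto
  then obtain N where N: "\<And>n. n \<ge> N \<Longrightarrow> norm (\<mu> n f) < 1"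
    by (auto simp: eventually_sequentially)
  \<comment> \<open>\<open>\<eta>\<close> is the least slack below \<open>C + 1\<close> among the
    first \<open>N\<close> functionals, with 1 inserted for \<open>N = 0\<close>. Beyond
    \<open>N\<close> the old value is below 1 and a bump adds at most \<open>C\<close>, whence the
    threshold \<open>C + 1\<close>.\<close>
  define \<eta> where "\<eta> = Min (insert 1 ((\<lambda>n. C + 1 - norm (\<mu> n f)) ` {..<N}))"
  have \<eta>: "\<eta> > 0" "\<eta> \<le> C + 1 - norm (\<mu> n f)" if "n < N" for n
    using f that by (auto simp: \<eta>_def)
  have \<eta>0: "\<eta> > 0"
    using f by (auto simp: \<eta>_def)
  show ?thesis
  proof (rule that[OF \<eta>0, of N])
    fix y W assume y: "y \<notin> (\<Union>n<N. atoms n \<eta>)" and W: "open W" "y \<in> W"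
    have "\<exists>V. n < N \<longrightarrow> open V \<and> y \<in> V \<and>
        (\<forall>g. csupport g \<subseteq> V \<and> (\<forall>x. norm (cfun_apply g x) \<le> 1) \<longrightarrow> norm (\<mu> n g) < \<eta>)" for n
    proof (cases "n < N")
      case True
      then have "y \<notin> atoms n \<eta>"
        using y by blast
      then show ?thesis
        unfolding atoms_def not_le[symmetric] by blast
    qed simp
    then obtain V where V: "\<And>n. n < N \<Longrightarrow> open (V n)" "\<And>n. n < N \<Longrightarrow> y \<in> V n"
      "\<And>n g. n < N \<Longrightarrow> csupport g \<subseteq> V n \<Longrightarrow> (\<And>x. norm (cfun_apply g x) \<le> 1) \<Longrightarrow> norm (\<mu> n g) < \<eta>"
      by metis
    have "open (W \<inter> (\<Inter>n<N. V n))" "y \<in> W \<inter> (\<Inter>n<N. V n)"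
      using W V by (auto intro: open_INT)
    then obtain g :: "('a, 'k) cfun" and V' where g: "open V'" "y \<in> V'"
      "\<And>z. z \<in> V' \<Longrightarrow> cfun_apply g z = 1" "csupport g \<subseteq> W \<inter> (\<Inter>n<N. V n)"
      "\<And>x. norm (cfun_apply g x) \<le> 1"
      by (rule bump[OF crs]) blast
    have "norm (\<mu> n (f + g)) < C + 1" for n
    proof (cases "n < N")
      case True
      then have "norm (\<mu> n g) < \<eta>"
        using g(4,5) by (intro V(3)) auto
      then show ?thesis
        using \<eta>(2)[OF True] norm_triangle_ineq[of "\<mu> n f" "\<mu> n g"] by (simp add: add)
    next
      case False
      then show ?thesis
        using N[of n] bound_1[OF g(5), of n] norm_triangle_ineq[of "\<mu> n f" "\<mu> n g"] by (simp add: add)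
    qed
    then show "\<exists>g V. open V \<and> y \<in> V \<and> (\<forall>z\<in>V. cfun_apply g z = 1) \<and> csupport g \<subseteq> W \<and>
        (\<forall>n. norm (\<mu> n (f + g)) < C + 1)"
      using g by (intro exI[of _ g] exI[of _ V']) auto
  qed
qed

section \<open>Countability, location and scattered height of the closure\<close>

text \<open>At a point outside \<open>D\<close> that is never an atom, bumps can be piled up any
  number of times: the value there reaches every \<open>i\<close> while all functionals stay below
  \<open>C + 1\<close>, against the lower bound. Supports avoid \<open>D\<close> because that bound
  requires zeros there.\<close>

lemma closure_subset_atoms:
  obtains D where "finite D" "D \<subseteq> A" "closure A \<subseteq> D \<union> (\<Union>n k. atoms n (1 / real (Suc k)))"
proof -
  obtain D \<delta> where D: "finite D" "D \<subseteq> A" "\<delta> > 0"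
    "\<And>f b x. (\<And>y. y \<in> D \<Longrightarrow> cfun_apply f y = 0) \<Longrightarrow> (\<And>n. norm (\<mu> n f) \<le> b) \<Longrightarrow>
      x \<in> closure A \<Longrightarrow> \<delta> * norm (cfun_apply f x) \<le> b"
    by (rule lower_bound) blast
  have "y \<in> (\<Union>n k. atoms n (1 / real (Suc k)))" if y: "y \<in> closure A" "y \<notin> D" for y
  proof (rule ccontr)
    assume *: "y \<notin> (\<Union>n k. atoms n (1 / real (Suc k)))"
    \<comment> \<open>The levels \<open>1 / Suc k\<close> suffice, as a smaller level admits more
      atoms.\<close>
    have no_atom: "y \<notin> atoms n \<eta>" if "\<eta> > 0" for n \<eta>
    proof -
      obtain k where "1 / real (Suc k) < \<eta>"
        using \<open>\<eta> > 0\<close> nat_approx_posE by blast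
      then have "\<eta> \<le> r \<Longrightarrow> 1 / real (Suc k) \<le> r" for r
        by simp
      then have "atoms n \<eta> \<subseteq> atoms n (1 / real (Suc k))"
        unfolding atoms_def by blast
      then show ?thesis
        using * by blast
    qed
    have grow: "\<exists>f. cfun_apply f y = of_nat i \<and> (\<forall>z\<in>D. cfun_apply f z = 0) \<and> (\<forall>n. norm (\<mu> n f) < C + 1)" for i
    proof (induction i)
      case 0
      show ?case
        using C_nonneg by (intro exI[of _ 0]) (simp add: cfun_simps zero)
    next
      case (Suc i)
      then obtain f where f: "cfun_apply f y = of_nat i" "\<forall>z\<in>D. cfun_apply f z = 0"
        "\<And>n. norm (\<mu> n f) < C + 1"
        by blast
      obtain N \<eta> where "\<eta> > 0" and bump:
        "\<And>y W. y \<notin> (\<Union>n<N. atoms n \<eta>) \<Longrightarrow> open W \<Longrightarrow> y \<in> W \<Longrightarrow>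
          \<exists>g V. open V \<and> y \<in> V \<and> (\<forall>z\<in>V. cfun_apply g z = 1) \<and> csupport g \<subseteq> W \<and>
            (\<forall>n. norm (\<mu> n (f + g)) < C + 1)"
        by (rule add_bump[OF f(3)]) blast
      have *: "y \<notin> (\<Union>n<N. atoms n \<eta>)" "open (- D)" "y \<in> - D"
        using y D(1) no_atom[OF \<open>\<eta> > 0\<close>] by (auto intro: finite_imp_closed)
      obtain g V where g: "y \<in> V" "\<forall>z\<in>V. cfun_apply g z = 1" "csupport g \<subseteq> - D"
        "\<forall>n. norm (\<mu> n (f + g)) < C + 1"
        using bump[OF *] by blast
      have "cfun_apply g z = 0" if "z \<in> D" for z
        using that g(3) by (intro not_in_csupport) auto
      then show ?case
        using f g by (intro exI[of _ "f + g"]) (auto simp: cfun_simps)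
    qed
    have bounded: "\<delta> * real i \<le> C + 1" for i
    proof -
      obtain f where f: "cfun_apply f y = of_nat i" "\<forall>z\<in>D. cfun_apply f z = 0"
        "\<forall>n. norm (\<mu> n f) < C + 1"
        using grow by blast
      then show ?thesis
        using D(4)[of f "C + 1" y] y(1) by (simp add: less_imp_le)
    qed
    obtain i where "(C + 1) / \<delta> < real i"
      using reals_Archimedean2 by blast
    then show False
      using bounded[of i] D(3) by (simp add: field_simps)
  qed
  then have "closure A \<subseteq> D \<union> (\<Union>n k. atoms n (1 / real (Suc k)))"
    by blast
  then show ?thesis
    by (rule that[OF D(1,2)])
qed

lemma countable_closure: "countable (closure A)"
proof -
  obtain D where D: "finite D" "closure A \<subseteq> D \<union> (\<Union>n k. atoms n (1 / real (Suc k)))"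
    using closure_subset_atoms by metis
  have "countable (D \<union> (\<Union>n k. atoms n (1 / real (Suc k))))"
    using D(1) by (simp add: countable_finite finite_atoms)
  then show ?thesis
    using D(2) countable_subset by blast
qed

text \<open>A functional carried by a closed set has no atom off that set, since a test function
  supported off it is annihilated. The exceptional finite set \<open>D\<close> lies in
  \<open>A\<close> anyway.\<close>

lemma closure_subset_carriers:
  assumes "\<And>n. \<exists>S\<subseteq>X. closed S \<and> (\<forall>f. (\<forall>x\<in>S. cfun_apply f x = 0) \<longrightarrow> \<mu> n f = 0)"
  shows "closure A \<subseteq> X"
proof -
  obtain D where D: "D \<subseteq> A" "closure A \<subseteq> D \<union> (\<Union>n k. atoms n (1 / real (Suc k)))"
    using closure_subset_atoms by metis
  have "atoms n \<eta> \<subseteq> X" if \<eta>: "\<eta> > 0" for n \<eta>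
  proof
    fix y assume y: "y \<in> atoms n \<eta>"
    obtain S where S: "S \<subseteq> X" "closed S" "\<And>f. (\<forall>x\<in>S. cfun_apply f x = 0) \<Longrightarrow> \<mu> n f = 0"
      using assms[of n] by blast
    show "y \<in> X"
    proof (rule ccontr)
      assume "y \<notin> X"
      then have "open (- S)" "y \<in> - S"
        using S by auto
      then obtain g where g: "csupport g \<subseteq> - S" "\<eta> \<le> norm (\<mu> n g)"
        using y unfolding atoms_def by blast
      have "cfun_apply g x = 0" if "x \<in> S" for x
        using that g(1) by (intro not_in_csupport) auto
      then have "\<mu> n g = 0"
        by (intro S(3)) blast
      then show False
        using g \<eta> by simp
    qed
  qed
  then have "(\<Union>n k. atoms n (1 / real (Suc k))) \<subseteq> X"
    by (intro UN_least) simp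
  then have "D \<union> (\<Union>n k. atoms n (1 / real (Suc k))) \<subseteq> X"
    using D(1) A_sub by (intro Un_least) auto
  then show ?thesis
    using D(2) by (rule subset_trans[rotated])
qed

text \<open>The point reached may be an atom, so the next bump goes elsewhere: a point of the
  derivative of order \<open>m - i\<close> is a limit of points of order one less, all but finitely
  many of them allowed. Bumps are nested, each placed where the sum is already constantly
  \<open>i\<close>, and \<open>m\<close> steps reach the value \<open>m\<close>.\<close>

lemma finite_scattered_height_closure: "finite_scattered_height (closure A)"
proof (rule ccontr)
  assume neg: "\<not> finite_scattered_height (closure A)"
  obtain D \<delta> where D: "finite D" "D \<subseteq> A" "\<delta> > 0"
    "\<And>f b x. (\<And>y. y \<in> D \<Longrightarrow> cfun_apply f y = 0) \<Longrightarrow> (\<And>n. norm (\<mu> n f) \<le> b) \<Longrightarrow>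
      x \<in> closure A \<Longrightarrow> \<delta> * norm (cfun_apply f x) \<le> b"
    by (rule lower_bound) blast
  obtain m where m: "(C + 1) / \<delta> < real m"
    using reals_Archimedean2 by blast
  obtain y0 where y0: "y0 \<in> cb_derivative (closure A) m"
    using neg unfolding finite_scattered_height_def by blast
  have "\<exists>f V y. open V \<and> y \<in> V \<and> y \<in> cb_derivative (closure A) (m - i) \<and>
      (\<forall>z\<in>V. cfun_apply f z = of_nat i) \<and> (\<forall>z\<in>D. cfun_apply f z = 0) \<and>
      (\<forall>n. norm (\<mu> n f) < C + 1)" if "i \<le> m" for i
    using that
  proof (induction i)
    case 0
    show ?case
      using C_nonneg y0 by (intro exI[of _ 0] exI[of _ UNIV] exI[of _ y0]) (simp add: cfun_simps zero)
  next
    case (Suc i)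
    then obtain f V y where V: "open V" "y \<in> V" "y \<in> cb_derivative (closure A) (m - i)"
      and f: "\<forall>z\<in>V. cfun_apply f z = of_nat i" "\<forall>z\<in>D. cfun_apply f z = 0"
      "\<And>n. norm (\<mu> n f) < C + 1"
      by (auto simp: Suc_le_eq)
    obtain N \<eta> where "\<eta> > 0" and bump:
      "\<And>y W. y \<notin> (\<Union>n<N. atoms n \<eta>) \<Longrightarrow> open W \<Longrightarrow> y \<in> W \<Longrightarrow>
        \<exists>g V. open V \<and> y \<in> V \<and> (\<forall>z\<in>V. cfun_apply g z = 1) \<and> csupport g \<subseteq> W \<and>
          (\<forall>n. norm (\<mu> n (f + g)) < C + 1)"
      by (rule add_bump[OF f(3)]) blast
    define F where "F = D \<union> (\<Union>n<N. atoms n \<eta>)"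
    have "finite F"
      using D(1) finite_atoms[OF \<open>\<eta> > 0\<close>] by (auto simp: F_def)
    have "m - i = Suc (m - Suc i)"
      using Suc.prems by simp
    then have limpt: "y islimpt cb_derivative (closure A) (m - Suc i)"
      using V(3) by (simp add: cb_derivative_Suc nonisolated_def)
    \<comment> \<open>Only \<open>F - {y}\<close> is removed, so that a neighbourhood of
      \<open>y\<close> remains; the limit point property then supplies \<open>y' \<noteq> y\<close>,
      which therefore avoids all of \<open>F\<close>.\<close>
    have "open (V - (F - {y}))"
      by (intro open_Diff V finite_imp_closed finite_Diff \<open>finite F\<close>)
    moreover have "y \<in> V - (F - {y})"
      using V by simp
    ultimately obtain y' where "y' \<in> cb_derivative (closure A) (m - Suc i)"
      "y' \<in> V - (F - {y})" "y' \<noteq> y"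
      by (metis islimptE[OF limpt])
    then have y': "y' \<in> cb_derivative (closure A) (m - Suc i)" "y' \<in> V" "y' \<notin> F"
      by auto
    have *: "y' \<notin> (\<Union>n<N. atoms n \<eta>)" "open (V - D)" "y' \<in> V - D"
      using y' open_Diff[OF V(1) finite_imp_closed[OF D(1)]] by (auto simp: F_def)
    obtain g V' where g: "open V'" "y' \<in> V'" "\<forall>z\<in>V'. cfun_apply g z = 1" "csupport g \<subseteq> V - D"
      "\<forall>n. norm (\<mu> n (f + g)) < C + 1"
      using bump[OF *] by blast
    have "cfun_apply g z = 0" if "z \<in> D" for z
      using that g(4) by (intro not_in_csupport) auto
    then show ?case
      using f g y' V(1)
      by (intro exI[of _ "f + g"] exI[of _ "V \<inter> V'"] exI[of _ y']) (auto simp: cfun_simps)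
  qed
  from this[of m] obtain f V y where "y \<in> V" "y \<in> cb_derivative (closure A) 0"
      "\<forall>z\<in>V. cfun_apply f z = of_nat m" "\<forall>z\<in>D. cfun_apply f z = 0" "\<forall>n. norm (\<mu> n f) < C + 1"
    by auto
  then have "\<delta> * real m \<le> C + 1"
    using D(4)[of f "C + 1" y] by (simp add: cb_derivative_0 less_imp_le)
  then show False
    using m D(3) by (simp add: field_simps)
qed

lemma countable_compact_finite_height_closure: "countable_compact_finite_height (closure A)"
  unfolding countable_compact_finite_height_def
  using A_compact countable_closure finite_scattered_height_closure by blast

end

section \<open>The topologies on the space of continuous functions\<close>

text \<open>\<open>Tp X\<close> is the initial topology of the evaluations at points of
  \<open>X\<close>; this reduces continuity of the vector space operations to that of the operations
  on scalars.\<close>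

lemma continuous_map_into_Tp:
  fixes h :: "'b \<Rightarrow> ('a::topological_space, 'k::real_normed_field) cfun"
  assumes "\<And>x. x \<in> X \<Longrightarrow> continuous_map Y euclidean (\<lambda>y. cfun_apply (h y) x)"
  shows "continuous_map Y (Tp X) h"
  unfolding continuous_map_def
proof (intro conjI allI impI)
  show "h \<in> topspace Y \<rightarrow> topspace (Tp X)"
    by simp
  fix U :: "('a, 'k) cfun set" assume U: "openin (Tp X) U"
  have "\<exists>V. openin Y V \<and> y \<in> V \<and> V \<subseteq> {y \<in> topspace Y. h y \<in> U}" if y: "y \<in> topspace Y" "h y \<in> U" for y
  proof -
    obtain S \<epsilon> where S: "finite S" "S \<subseteq> X" "\<epsilon> > 0" "\<And>g. g - h y \<in> cball0 S \<epsilon> \<Longrightarrow> g \<in> U"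
      using openin_TpD[OF U y(2)] by metis
    define V where "V = {z \<in> topspace Y. \<forall>x\<in>S. cfun_apply (h z) x \<in> ball (cfun_apply (h y) x) \<epsilon>}"
    have "openin Y {z \<in> topspace Y. \<forall>x\<in>S. cfun_apply (h z) x \<in> ball (cfun_apply (h y) x) \<epsilon>}"
      using S(1,2)
    proof (induction S rule: finite_induct)
      case (insert x S)
      have "openin Y {z \<in> topspace Y. cfun_apply (h z) x \<in> ball (cfun_apply (h y) x) \<epsilon>}"
        using insert.prems by (intro openin_continuous_map_preimage[OF assms]) auto
      then have "openin Y ({z \<in> topspace Y. cfun_apply (h z) x \<in> ball (cfun_apply (h y) x) \<epsilon>} \<inter>
          {z \<in> topspace Y. \<forall>x\<in>S. cfun_apply (h z) x \<in> ball (cfun_apply (h y) x) \<epsilon>})"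
        using insert by (intro openin_Int) auto
      then show ?case
        by (rule back_subst[of "openin Y"]) auto
    qed simp
    then have "openin Y V"
      by (simp add: V_def)
    moreover have "y \<in> V"
      using y S(3) by (simp add: V_def)
    moreover have "h z \<in> U" if "z \<in> V" for z
    proof -
      have "norm (cfun_apply (h z) x - cfun_apply (h y) x) \<le> \<epsilon>" if "x \<in> S" for x
        using \<open>z \<in> V\<close> that by (auto simp: V_def dist_norm norm_minus_commute less_imp_le)
      then show ?thesis
        by (intro S(4)) (simp add: cball0_def cfun_simps)
    qed
    ultimately show ?thesis
      by (intro exI[of _ V]) (auto simp: V_def)
  qed
  then show "openin Y {y \<in> topspace Y. h y \<in> U}"
    by (subst openin_subopen) auto
qed

lemma continuous_map_eval_Tp:
  assumes "x \<in> X"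
  shows "continuous_map (Tp X) euclidean (\<lambda>f. cfun_apply f x)"
  unfolding continuous_map_def
proof (intro conjI allI impI)
  fix V :: "'b set" assume "openin euclidean V"
  then have V: "open V"
    by simp
  show "openin (Tp X) {f \<in> topspace (Tp X). cfun_apply f x \<in> V}"
    unfolding openin_Tp
  proof
    fix f assume "f \<in> {f \<in> topspace (Tp X). cfun_apply f x \<in> V}"
    then obtain e where e: "e > 0" "cball (cfun_apply f x) e \<subseteq> V"
      using V open_contains_cball by blast
    have "g \<in> {f \<in> topspace (Tp X). cfun_apply f x \<in> V}" if "g - f \<in> cball0 {x} e" for g
      using that e by (auto simp: cball0_def cfun_simps dist_norm norm_minus_commute subset_iff)
    then show "\<exists>S. finite S \<and> S \<subseteq> X \<and>
        (\<exists>\<epsilon>>0. \<forall>g. g - f \<in> cball0 S \<epsilon> \<longrightarrow> g \<in> {f \<in> topspace (Tp X). cfun_apply f x \<in> V})"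
      using assms e(1) by (intro exI[of _ "{x}"]) auto
  qed
qed simp

lemma cfun_eq_if_eq_on_dense:
  assumes "closure X = UNIV" "\<And>x. x \<in> X \<Longrightarrow> cfun_apply f x = cfun_apply g x"
  shows "f = g"
proof (rule cfun_ext)
  fix x
  have "norm (cfun_apply (f - g) x) \<le> 0"
    by (rule norm_le_on_closure[of X]) (auto simp: assms cfun_simps)
  then show "cfun_apply f x = cfun_apply g x"
    by (simp add: cfun_simps)
qed

lemma locally_convex_space_Tp:
  assumes dense: "closure X = UNIV"
  shows "locally_convex_space cscale (Tp X :: ('a::topological_space, 'k::real_normed_field) cfun topology)"
  unfolding locally_convex_space_def
proof (intro conjI allI impI)
  let ?T = "Tp X :: ('a, 'k) cfun topology"
  note eval = continuous_map_eval_Tp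
  show "vector_space (cscale :: 'k \<Rightarrow> ('a, 'k) cfun \<Rightarrow> ('a, 'k) cfun)"
    by (rule vector_space_cscale)
  show "topspace ?T = UNIV"
    by simp
  show "Hausdorff_space ?T"
    unfolding Hausdorff_space_def
  proof (intro allI impI)
    fix f g :: "('a, 'k) cfun" assume "f \<in> topspace ?T \<and> g \<in> topspace ?T \<and> f \<noteq> g"
    then obtain x where x: "x \<in> X" "cfun_apply f x \<noteq> cfun_apply g x"
      using cfun_eq_if_eq_on_dense[OF dense, of f g] by blast
    obtain U V where UV: "open U" "open V" "cfun_apply f x \<in> U" "cfun_apply g x \<in> V" "U \<inter> V = {}"
      using hausdorff[OF x(2)] by blast
    have "openin ?T {f \<in> topspace ?T. cfun_apply f x \<in> U}" "openin ?T {f \<in> topspace ?T. cfun_apply f x \<in> V}"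
      by (rule openin_continuous_map_preimage[OF eval[OF x(1)]]; simp add: UV)+
    then show "\<exists>U V. openin ?T U \<and> openin ?T V \<and> f \<in> U \<and> g \<in> V \<and> disjnt U V"
      using UV(3-5) by (intro exI conjI) (assumption | auto simp: disjnt_def)+
  qed
  show "continuous_map (prod_topology ?T ?T) ?T (\<lambda>(f, g). f + g)"
  proof (rule continuous_map_into_Tp)
    fix x assume "x \<in> X"
    then have "continuous_map (prod_topology ?T ?T) euclidean
        (\<lambda>p. cfun_apply (fst p) x + cfun_apply (snd p) x)"
      by (intro continuous_map_add continuous_map_compose[OF continuous_map_fst eval, unfolded comp_def]
          continuous_map_compose[OF continuous_map_snd eval, unfolded comp_def])
    then show "continuous_map (prod_topology ?T ?T) euclidean
        (\<lambda>y. cfun_apply (case y of (f, g) \<Rightarrow> f + g) x)"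
      by (simp add: case_prod_unfold cfun_simps)
  qed
  show "continuous_map (prod_topology euclidean ?T) ?T (\<lambda>(c, f). cscale c f)"
  proof (rule continuous_map_into_Tp)
    fix x assume "x \<in> X"
    then have "continuous_map (prod_topology euclidean ?T) (prod_topology euclidean euclidean)
        (\<lambda>p. (fst p :: 'k, cfun_apply (snd p) x))"
      by (intro continuous_map_pairedI continuous_map_fst
          continuous_map_compose[OF continuous_map_snd eval, unfolded comp_def])
    moreover have "continuous_map (prod_topology euclidean euclidean) euclidean (\<lambda>p. fst p * snd p :: 'k)"
      by (simp add: continuous_on_mult[OF continuous_on_fst[OF continuous_on_id] continuous_on_snd[OF continuous_on_id]])
    ultimately have "continuous_map (prod_topology euclidean ?T) euclidean
        ((\<lambda>p. fst p * snd p) \<circ> (\<lambda>p. (fst p, cfun_apply (snd p) x)))"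
      by (rule continuous_map_compose)
    then have "continuous_map (prod_topology euclidean ?T) euclidean
        (\<lambda>p. fst p * cfun_apply (snd p) x)"
      by (simp add: comp_def)
    then show "continuous_map (prod_topology euclidean ?T) euclidean
        (\<lambda>y. cfun_apply (case y of (c, f) \<Rightarrow> cscale c f) x)"
      by (simp add: case_prod_unfold cfun_simps)
  qed
  fix U assume "openin ?T U \<and> 0 \<in> U"
  then obtain S \<epsilon> where S: "finite S" "S \<subseteq> X" "\<epsilon> > 0" "\<And>g. g - 0 \<in> cball0 S \<epsilon> \<Longrightarrow> g \<in> U"
    using openin_TpD[of X U 0] by metis
  define V :: "('a, 'k) cfun set" where "V = {f. \<forall>x\<in>S. cfun_apply f x \<in> ball 0 \<epsilon>}"
  have "openin ?T {f. \<forall>x\<in>S. cfun_apply f x \<in> ball 0 \<epsilon>}"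
    using S(1,2)
  proof (induction S rule: finite_induct)
    case empty
    show ?case
      using openin_topspace[of ?T] by simp
  next
    case (insert x S)
    have "openin ?T {f \<in> topspace ?T. cfun_apply f x \<in> ball 0 \<epsilon>}"
      using insert.prems by (intro openin_continuous_map_preimage[OF eval]) auto
    then have "openin ?T ({f \<in> topspace ?T. cfun_apply f x \<in> ball 0 \<epsilon>} \<inter>
        {f. \<forall>x\<in>S. cfun_apply f x \<in> ball 0 \<epsilon>})"
      using insert by (intro openin_Int) auto
    then show ?case
      by (rule back_subst[of "openin ?T"]) auto
  qed
  then have "openin ?T V"
    by (simp add: V_def)
  moreover have "convex_wrt cscale V"
    unfolding convex_wrt_def
  proof (intro ballI)
    fix f g and t :: real assume "f \<in> V" "g \<in> V" and t: "t \<in> {0..1}"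
    then have "t *\<^sub>R cfun_apply f x + (1 - t) *\<^sub>R cfun_apply g x \<in> ball 0 \<epsilon>" if "x \<in> S" for x
      using that convexD_alt[OF convex_ball[of "0 :: 'k" \<epsilon>], of "cfun_apply g x" "cfun_apply f x" t]
      by (simp add: V_def add.commute)
    then show "cscale (of_real t) f + cscale (of_real (1 - t)) g \<in> V"
      by (simp add: V_def cfun_simps scaleR_conv_of_real)
  qed
  moreover have "0 \<in> V"
    using S(3) by (simp add: V_def cfun_simps)
  moreover have "V \<subseteq> U"
    using S(4) by (auto simp: V_def cball0_def less_imp_le)
  ultimately show "\<exists>V. openin ?T V \<and> 0 \<in> V \<and> V \<subseteq> U \<and> convex_wrt cscale V"
    by blast
qed

lemma openin_Tk_if_openin_Tp: "openin (Tp X) U \<Longrightarrow> X \<subseteq> Z \<Longrightarrow> openin (Tk Z) U"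
  unfolding openin_Tp openin_Tk by (meson finite_imp_compact subset_trans)

text \<open>Shows that the range of topologies is nonempty, which is the passage from "every" to
  "some". Density of \<open>X\<close> makes \<open>Tp X\<close> Hausdorff.\<close>

lemma Tp_in_lc_topologies_between:
  assumes "closure X = UNIV" "X \<subseteq> Z"
  shows "Tp X \<in> lc_topologies_between (Tp X) (Tk Z)"
  using locally_convex_space_Tp[OF assms(1)] openin_Tk_if_openin_Tp[OF _ assms(2)]
  by (auto simp: lc_topologies_between_def)

text \<open>One locale for both ranges of topologies: it is used with \<open>Z = X\<close>, and with
  the whole space as \<open>Z\<close> when \<open>X\<close> is k-dense.\<close>

locale lc_topology_between =
  fixes X Z :: "'a::t2_space set" and T :: "('a, 'k::{real_normed_field, euclidean_space}) cfun topology"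
  assumes crs: "completely_regular_space (euclidean :: 'a topology)"
    and mu: "mu_space TYPE('k) TYPE('a)" and Z: "Z = X \<or> k_dense X"
    and T: "T \<in> lc_topologies_between (Tp X) (Tk Z)"
begin

lemma openin_if_openin_Tp: "openin (Tp X) U \<Longrightarrow> openin T U"
  using T by (auto simp: lc_topologies_between_def)

lemma openin_Tk_if_openin: "openin T U \<Longrightarrow> openin (Tk Z) U"
  using T by (auto simp: lc_topologies_between_def)

lemma topspace [simp]: "topspace T = UNIV"
  using T by (simp add: lc_topologies_between_def locally_convex_space_def)

lemma closedin_if_closedin_Tp: "closedin (Tp X) U \<Longrightarrow> closedin T U"
  by (simp add: closedin_def openin_if_openin_Tp)

lemma barrelD:
  assumes "barrel cscale T U"
  shows "closedin (Tk Z) U" "absolutely_convex cscale U" "absorbing cscale U"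
  using assms by (auto simp: barrel_def closedin_def openin_Tk_if_openin)

text \<open>Closed already for the coarsest topology, as an intersection of conditions at points of
  \<open>X\<close>; absorbing because continuous functions are bounded on the compact closure of
  \<open>A\<close>.\<close>

lemma barrel_cball0:
  assumes A: "A \<subseteq> X" "compact (closure A)" and r: "r > 0"
  shows "barrel cscale T (cball0 A r)"
  unfolding barrel_def
proof (intro conjI)
  have "closedin (Tp X) {f :: ('a, 'k) cfun \<in> topspace (Tp X). cfun_apply f x \<in> cball 0 r}" if "x \<in> A" for x
    using that A by (intro closedin_continuous_map_preimage[OF continuous_map_eval_Tp]) auto
  then have "closedin T {f. cfun_apply f x \<in> cball 0 r}" if "x \<in> A" for x
    using closedin_if_closedin_Tp that by simp
  then have "closedin T (\<Inter>x\<in>A. {f. cfun_apply f x \<in> cball 0 r})" if "A \<noteq> {}"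
    using that by (intro closedin_INT) auto
  moreover have "closedin T (\<Inter>x\<in>A. {f. cfun_apply f x \<in> cball 0 r})" if "A = {}"
    using that closedin_topspace[of T] by simp
  moreover have "(\<Inter>x\<in>A. {f. cfun_apply f x \<in> cball 0 r}) = cball0 A r"
    by (auto simp: cball0_def)
  ultimately show "closedin T (cball0 A r)"
    by metis
  show "absolutely_convex cscale (cball0 A r :: ('a, 'k) cfun set)"
    unfolding absolutely_convex_def
  proof (intro ballI allI impI)
    fix f g :: "('a, 'k) cfun" and a b :: 'k
    assume *: "f \<in> cball0 A r" "g \<in> cball0 A r" "norm a + norm b \<le> 1"
    have "norm (a * cfun_apply f x + b * cfun_apply g x) \<le> r" if "x \<in> A" for x
    proof -
      have "norm (a * cfun_apply f x + b * cfun_apply g x) \<le> norm a * norm (cfun_apply f x) + norm b * norm (cfun_apply g x)"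
        by (metis norm_mult norm_triangle_ineq)
      also have "\<dots> \<le> norm a * r + norm b * r"
        using * that by (intro add_mono mult_left_mono) (auto simp: cball0_def)
      also have "\<dots> = (norm a + norm b) * r"
        by (simp add: algebra_simps)
      also have "\<dots> \<le> 1 * r"
        using * r by (intro mult_right_mono) auto
      finally show ?thesis
        by simp
    qed
    then show "cscale a f + cscale b g \<in> cball0 A r"
      by (simp add: cball0_def cfun_simps)
  qed
  show "absorbing cscale (cball0 A r :: ('a, 'k) cfun set)"
    unfolding absorbing_def
  proof
    fix f :: "('a, 'k) cfun"
    have "bounded (cfun_apply f ` closure A)"
      using A(2) by (intro compact_imp_bounded compact_continuous_image continuous_cfun)
    then obtain R where R: "R > 0" "\<And>x. x \<in> closure A \<Longrightarrow> norm (cfun_apply f x) \<le> R"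
      unfolding bounded_pos by auto
    have "cscale c f \<in> cball0 A r" if "norm c \<le> r / R" for c
    proof -
      have "norm c * norm (cfun_apply f x) \<le> r" if "x \<in> A" for x
      proof -
        have "norm c * norm (cfun_apply f x) \<le> r / R * R"
          using \<open>norm c \<le> r / R\<close> R that r closure_subset[of A] by (intro mult_mono) auto
        then show ?thesis
          using R by simp
      qed
      then show ?thesis
        by (simp add: cball0_def cfun_simps norm_mult)
    qed
    then show "\<exists>r'>0. \<forall>c. norm c \<le> r' \<longrightarrow> cscale c f \<in> cball0 A r"
      using R r by (intro exI[of _ "r / R"]) auto
  qed
qed

end

section \<open>Necessity: from a witnessing sequence to the countable compact set\<close>

lemma norm_on_tendsto_0_iff:
  assumes "\<And>n. \<phi> n 0 = 0"
  shows "(\<lambda>n. norm_on B (\<phi> n)) \<longlonglongrightarrow> 0 \<longleftrightarrow>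
    (\<forall>e>0. \<forall>\<^sub>F n in sequentially. \<forall>x\<in>B. norm (\<phi> n x) \<le> e)" (is "?L \<longleftrightarrow> ?R")
proof
  assume L: ?L
  show ?R
  proof (intro allI impI)
    fix e :: real assume "e > 0"
    then have "\<forall>\<^sub>F n in sequentially. norm_on B (\<phi> n) < ereal e"
      using order_tendstoD(2)[OF L] by simp
    then show "\<forall>\<^sub>F n in sequentially. \<forall>x\<in>B. norm (\<phi> n x) \<le> e"
    proof (rule eventually_mono)
      fix n assume n: "norm_on B (\<phi> n) < ereal e"
      have "ereal (norm (\<phi> n x)) \<le> norm_on B (\<phi> n)" if "x \<in> B" for x
        unfolding norm_on_def using that by (intro SUP_upper) auto
      then show "\<forall>x\<in>B. norm (\<phi> n x) \<le> e"
        using n by (metis ereal_less_eq(3) less_imp_le order_trans)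
    qed
  qed
next
  assume R: ?R
  show ?L
  proof (rule order_tendstoI)
    fix a :: ereal assume "a < 0"
    have "0 \<le> norm_on B (\<phi> n)" for n
      unfolding norm_on_def by (rule SUP_upper2[of 0]) auto
    then show "\<forall>\<^sub>F n in sequentially. a < norm_on B (\<phi> n)"
      using \<open>a < 0\<close> less_le_trans by (intro always_eventually allI) blast
  next
    fix a :: ereal assume "0 < a"
    then obtain e where e: "0 < ereal e" "ereal e < a"
      using ereal_dense2 by blast
    then have "\<forall>\<^sub>F n in sequentially. \<forall>x\<in>B. norm (\<phi> n x) \<le> e"
      using R by simp
    then show "\<forall>\<^sub>F n in sequentially. norm_on B (\<phi> n) < a"
    proof (rule eventually_mono)
      fix n assume "\<forall>x\<in>B. norm (\<phi> n x) \<le> e"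
      then have "norm_on B (\<phi> n) \<le> ereal e"
        unfolding norm_on_def using e assms by (intro SUP_least) auto
      then show "norm_on B (\<phi> n) < a"
        using e(2) by (rule le_less_trans)
    qed
  qed
qed

lemma dual_spaceD:
  assumes "\<phi> \<in> dual_space s T"
  shows "\<phi> (x + y) = \<phi> x + \<phi> y" "\<phi> (s c x) = c * \<phi> x" "continuous_map T euclidean \<phi>"
  using assms by (auto simp: dual_space_def Vector_Spaces.linear_iff)

context lc_topology_between
begin

text \<open>By continuity \<open>\<phi>\<close> has norm below 1 on some
  \<open>cball0 S \<epsilon>\<close>, which contains all multiples of a function vanishing on
  \<open>S\<close>; one of these multiples would have value exactly 1.\<close>

lemma dual_carrier:
  assumes "\<phi> \<in> dual_space cscale T"
  shows "\<exists>S\<subseteq>Z. closed S \<and> (\<forall>f. (\<forall>x\<in>S. cfun_apply f x = 0) \<longrightarrow> \<phi> f = 0)"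
proof -
  note \<phi> = dual_spaceD[OF assms]
  have "\<phi> 0 = 0"
    using \<phi>(2)[of 0 0] by simp
  have "openin T {f \<in> topspace T. \<phi> f \<in> ball 0 1}"
    by (rule openin_continuous_map_preimage[OF \<phi>(3)]) simp
  then have "openin (Tk Z) {f. \<phi> f \<in> ball 0 1}"
    using openin_Tk_if_openin by simp
  moreover have "0 \<in> {f. \<phi> f \<in> ball 0 1}"
    using \<open>\<phi> 0 = 0\<close> by simp
  ultimately obtain S \<epsilon> where S: "compact S" "S \<subseteq> Z" "\<epsilon> > 0"
    "\<And>f. f - 0 \<in> cball0 S \<epsilon> \<Longrightarrow> f \<in> {f. \<phi> f \<in> ball 0 1}"
    by (rule openin_TkD) (rule that)
  have "\<phi> f = 0" if f: "\<forall>x\<in>S. cfun_apply f x = 0" for f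
  proof (rule ccontr)
    assume "\<phi> f \<noteq> 0"
    have "cscale (1 / \<phi> f) f \<in> cball0 S \<epsilon>"
      using f S(3) by (simp add: cball0_def cfun_simps)
    then show False
      using S(4)[of "cscale (1 / \<phi> f) f"] \<open>\<phi> f \<noteq> 0\<close> by (simp add: \<phi>)
  qed
  then show ?thesis
    using S(1,2) by (intro exI[of _ S]) (auto intro: compact_imp_closed)
qed

lemma barrel_bounded_if_uniformly_bounded:
  assumes B: "\<And>f x. f \<in> B \<Longrightarrow> norm (cfun_apply f x) \<le> 1"
  shows "barrel_bounded cscale T B"
  unfolding barrel_bounded_def
proof (intro allI impI)
  fix U assume "barrel cscale T U"
  note U = barrelD[OF this]
  obtain \<epsilon> where \<epsilon>: "\<epsilon> > 0" "\<And>f. (\<And>x. norm (cfun_apply f x) \<le> \<epsilon>) \<Longrightarrow> f \<in> U"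
    by (rule barrel_contains_sup_ball[OF closedin_Tk_mono[OF U(1)] U(2,3)]) auto
  obtain n where n: "1 / real (Suc n) < \<epsilon>"
    using \<epsilon>(1) by (rule nat_approx_posE)
  have "f \<in> cscale (of_nat (Suc n)) ` U" if f: "f \<in> B" for f
  proof
    show "f = cscale (of_nat (Suc n)) (cscale (1 / of_nat (Suc n)) f)"
      by (simp del: of_nat_Suc)
    have "norm (cfun_apply (cscale (1 / of_nat (Suc n)) f) x) \<le> \<epsilon>" for x
    proof -
      have "norm (cfun_apply (cscale (1 / of_nat (Suc n)) f) x) = norm (cfun_apply f x) / real (Suc n)"
        by (simp add: cfun_simps norm_divide norm_mult del: of_nat_Suc)
      also have "\<dots> \<le> 1 / real (Suc n)"
        using B[OF f, of x] by (intro divide_right_mono) auto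
      finally show ?thesis
        using n by linarith
    qed
    then show "cscale (1 / of_nat (Suc n)) f \<in> U"
      by (rule \<epsilon>(2))
  qed
  then show "\<exists>n. B \<subseteq> cscale (of_nat n) ` U"
    by blast
qed

text \<open>By pigeonhole some \<open>i < j\<close> share a centre \<open>a\<close>. As
  \<open>f j\<close> vanishes at \<open>x i\<close>, the centre is at most \<open>1/5\<close> there,
  hence \<open>f i\<close> at most \<open>2/5\<close>, which is less than
  \<open>1/2\<close>.\<close>

lemma not_barrel_precompact_if_separated:
  assumes B: "B \<subseteq> X" "compact (closure B)" and x: "\<And>i::nat. x i \<in> B"
    and f: "\<And>i. 1 / 2 \<le> norm (cfun_apply (f i) (x i))" "\<And>i j. i < j \<Longrightarrow> cfun_apply (f j) (x i) = 0"
  shows "\<not> barrel_precompact cscale T (range f)"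
proof
  assume "barrel_precompact cscale T (range f)"
  moreover have "barrel cscale T (cball0 B (1 / 5))"
    by (rule barrel_cball0[OF B]) simp
  ultimately obtain F where F: "finite F" "range f \<subseteq> {a + u |a u. a \<in> F \<and> u \<in> cball0 B (1 / 5)}"
    unfolding barrel_precompact_def by blast
  have "\<exists>a. a \<in> F \<and> f i - a \<in> cball0 B (1 / 5)" for i
  proof -
    have "f i \<in> {a + u |a u. a \<in> F \<and> u \<in> cball0 B (1 / 5)}"
      by (rule subsetD[OF F(2)]) simp
    then obtain a u where "f i = a + u" "a \<in> F" "u \<in> cball0 B (1 / 5)"
      by blast
    then show ?thesis
      by (intro exI[of _ a]) simp
  qed
  then obtain a where a: "\<And>i. a i \<in> F" "\<And>i. f i - a i \<in> cball0 B (1 / 5)"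
    by metis
  have "finite (range a)"
    using a(1) by (intro finite_subset[OF _ F(1)]) auto
  then have "\<not> inj a"
    using finite_imageD infinite_UNIV_nat by blast
  then obtain i j where ij: "i < j" "a i = a j"
    unfolding inj_def by (metis linorder_neqE_nat)
  have "norm (cfun_apply (f k) (x i) - cfun_apply (a k) (x i)) \<le> 1 / 5" for k
    using a(2)[of k] x[of i] by (simp add: cball0_def cfun_simps)
  from this[of i] this[of j] have "norm (cfun_apply (f i) (x i) - cfun_apply (a i) (x i)) \<le> 1 / 5"
      "norm (cfun_apply (a i) (x i)) \<le> 1 / 5"
    using ij f(2)[OF ij(1)] by auto
  then have "norm (cfun_apply (f i) (x i)) \<le> 2 / 5"
    using norm_triangle_sub[of "cfun_apply (f i) (x i)" "cfun_apply (a i) (x i)"] by linarith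
  then show False
    using f(1)[of i] by linarith
qed

text \<open>The range of \<open>f\<close> is barrel-bounded but not barrel-precompact. For late
  \<open>i\<close> the bound \<open>e i\<close> controls all functionals at once; the finitely many
  early \<open>i\<close> are handled by weak* convergence.\<close>

lemma witness_detects:
  assumes wit: "witnesses_strongly_GP cscale T \<phi>"
    and B: "B \<subseteq> X" "compact (closure B)" and x: "\<And>i::nat. x i \<in> B"
    and f: "\<And>i y. norm (cfun_apply (f i) y) \<le> 1" "\<And>i. 1 / 2 \<le> norm (cfun_apply (f i) (x i))"
      "\<And>i j. i < j \<Longrightarrow> cfun_apply (f j) (x i) = 0"
    and e: "\<And>n i. norm (\<phi> n (f i)) \<le> e i" "e \<longlonglongrightarrow> 0"
  shows False
proof -
  have dual: "\<phi> n \<in> dual_space cscale T" and null: "(\<lambda>n. \<phi> n g) \<longlonglongrightarrow> 0" for n g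
    using wit by (auto simp: witnesses_strongly_GP_def)
  have zero: "\<phi> n 0 = 0" for n
    using dual_spaceD(2)[OF dual[of n], of 0 0] by simp
  have "barrel_bounded cscale T (range f)"
    by (rule barrel_bounded_if_uniformly_bounded) (auto simp: f)
  moreover have "\<not> barrel_precompact cscale T (range f)"
    by (rule not_barrel_precompact_if_separated[OF B x f(2,3)])
  ultimately have "\<not> (\<lambda>n. norm_on (range f) (\<phi> n)) \<longlonglongrightarrow> 0"
    using wit by (auto simp: witnesses_strongly_GP_def)
  moreover have "\<forall>\<^sub>F n in sequentially. \<forall>g\<in>range f. norm (\<phi> n g) \<le> \<epsilon>" if \<epsilon>: "\<epsilon> > 0" for \<epsilon>
  proof -
    obtain k where k: "\<And>i. i \<ge> k \<Longrightarrow> e i < \<epsilon>"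
      using order_tendstoD(2)[OF e(2) \<epsilon>] by (auto simp: eventually_sequentially)
    have "\<forall>\<^sub>F n in sequentially. norm (\<phi> n (f i)) < \<epsilon>" for i
      using null[of "f i"] \<epsilon> by (intro order_tendstoD(2)[OF tendsto_norm_zero])
    then have "\<forall>\<^sub>F n in sequentially. \<forall>i\<in>{..<k}. norm (\<phi> n (f i)) < \<epsilon>"
      by (intro eventually_ball_finite) auto
    then show ?thesis
    proof (rule eventually_mono)
      fix n assume n: "\<forall>i\<in>{..<k}. norm (\<phi> n (f i)) < \<epsilon>"
      have "norm (\<phi> n (f i)) \<le> \<epsilon>" for i
        using n k[of i] e(1)[of n i] by (cases "i < k") (auto intro: less_imp_le)
      then show "\<forall>g\<in>range f. norm (\<phi> n g) \<le> \<epsilon>"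
        by blast
    qed
  qed
  ultimately show False
    using norm_on_tendsto_0_iff[of \<phi>, OF zero] by blast
qed

lemma bound_from_polar:
  assumes \<phi>: "\<phi> \<in> dual_space cscale T" and \<epsilon>: "\<epsilon> > 0"
    and le: "\<And>f. f \<in> cball0 A \<epsilon> \<Longrightarrow> norm (\<phi> f) \<le> 1"
    and r: "r \<ge> 0" and f: "\<And>x. x \<in> A \<Longrightarrow> norm (cfun_apply f x) \<le> r"
  shows "norm (\<phi> f) \<le> 1 / \<epsilon> * r"
proof (rule field_le_epsilon)
  fix e :: real assume e: "e > 0"
  \<comment> \<open>\<open>r\<close> may be 0, so the scaling uses a slightly larger positive
    number, whose excess contributes exactly \<open>e\<close> after division by
    \<open>\<epsilon>\<close>.\<close>
  define s where "s = r + \<epsilon> * e"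
  have s: "s > 0" "r \<le> s"
    using r \<epsilon> e by (auto simp: s_def add_nonneg_pos)
  have "cscale (of_real (\<epsilon> / s)) f \<in> cball0 A \<epsilon>"
  proof -
    have "\<epsilon> / s * norm (cfun_apply f x) \<le> \<epsilon>" if "x \<in> A" for x
    proof -
      have "\<epsilon> / s * norm (cfun_apply f x) \<le> \<epsilon> / s * s"
        using f[OF that] s \<epsilon> by (intro mult_left_mono) auto
      then show ?thesis
        using s by simp
    qed
    then show ?thesis
      using s \<epsilon> by (simp add: cball0_def cfun_simps norm_mult norm_divide)
  qed
  from le[OF this] have "\<epsilon> / s * norm (\<phi> f) \<le> 1"
    using s \<epsilon> by (simp add: dual_spaceD[OF \<phi>] norm_mult norm_divide)
  then have "norm (\<phi> f) \<le> s / \<epsilon>"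
    using s \<epsilon> by (simp add: field_simps)
  also have "s / \<epsilon> = 1 / \<epsilon> * r + e"
    using \<epsilon> by (simp add: s_def field_simps)
  finally show "norm (\<phi> f) \<le> 1 / \<epsilon> * r + e" .
qed

text \<open>The barrel through which a witnessing sequence yields the set \<open>A\<close>. It is
  absorbing because a convergent sequence of scalars is bounded.\<close>

lemma barrel_polar:
  assumes dual: "\<And>n. \<phi> n \<in> dual_space cscale T" and null: "\<And>f. (\<lambda>n. \<phi> n f) \<longlonglongrightarrow> 0"
  shows "barrel cscale T {f. \<forall>n. norm (\<phi> n f) \<le> 1}"
  unfolding barrel_def
proof (intro conjI)
  note lin = dual_spaceD[OF dual]
  have "closedin T {f \<in> topspace T. \<phi> n f \<in> cball 0 1}" for n
    by (rule closedin_continuous_map_preimage[OF lin(3)]) simp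
  then have "closedin T (\<Inter>n. {f. norm (\<phi> n f) \<le> 1})"
    by (intro closedin_INT) auto
  then show "closedin T {f. \<forall>n. norm (\<phi> n f) \<le> 1}"
    by (rule back_subst[of "closedin T"]) auto
  show "absolutely_convex cscale {f. \<forall>n. norm (\<phi> n f) \<le> 1}"
    unfolding absolutely_convex_def
  proof (intro ballI allI impI)
    fix f g and a b :: 'k
    assume *: "f \<in> {f. \<forall>n. norm (\<phi> n f) \<le> 1}" "g \<in> {f. \<forall>n. norm (\<phi> n f) \<le> 1}" "norm a + norm b \<le> 1"
    have "norm (\<phi> n (cscale a f + cscale b g)) \<le> 1" for n
    proof -
      have "norm (\<phi> n (cscale a f + cscale b g)) \<le> norm a * norm (\<phi> n f) + norm b * norm (\<phi> n g)"
        unfolding lin by (metis norm_mult norm_triangle_ineq)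
      also have "\<dots> \<le> norm a * 1 + norm b * 1"
        using * by (intro add_mono mult_left_mono) auto
      finally show ?thesis
        using * by simp
    qed
    then show "cscale a f + cscale b g \<in> {f. \<forall>n. norm (\<phi> n f) \<le> 1}"
      by simp
  qed
  show "absorbing cscale {f. \<forall>n. norm (\<phi> n f) \<le> 1}"
    unfolding absorbing_def
  proof
    fix f
    have "Bseq (\<lambda>n. \<phi> n f)"
      using null[of f] by (intro convergent_imp_Bseq) (auto simp: convergent_def)
    then obtain R where R: "R > 0" "\<And>n. norm (\<phi> n f) \<le> R"
      unfolding Bseq_def by blast
    have "norm (\<phi> n (cscale c f)) \<le> 1" if c: "norm c \<le> 1 / R" for c n
    proof -
      have "norm (\<phi> n (cscale c f)) = norm c * norm (\<phi> n f)"
        by (simp add: lin norm_mult)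
      also have "\<dots> \<le> 1 / R * R"
        using c R by (intro mult_mono) auto
      finally show ?thesis
        using R by simp
    qed
    then show "\<exists>r>0. \<forall>c. norm c \<le> r \<longrightarrow> cscale c f \<in> {f. \<forall>n. norm (\<phi> n f) \<le> 1}"
      using R by (intro exI[of _ "1 / R"]) auto
  qed
qed

lemma strongly_GP_imp:
  assumes "strongly_GP cscale T"
  obtains A where "A \<subseteq> X" "countable_compact_finite_height (closure A)"
    "\<And>H. compact H \<Longrightarrow> finite (H \<inter> X - closure A)" "Z = X \<Longrightarrow> closure A \<subseteq> X"
proof -
  obtain \<phi> where wit: "witnesses_strongly_GP cscale T \<phi>"
    using assms by (auto simp: strongly_GP_def)
  have dual: "\<phi> n \<in> dual_space cscale T" and null: "(\<lambda>n. \<phi> n f) \<longlonglongrightarrow> 0" for n f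
    using wit by (auto simp: witnesses_strongly_GP_def)
  note U = barrelD[OF barrel_polar[OF dual null]]
  obtain A \<epsilon> where A: "A \<subseteq> X" "compact (closure A)" "\<epsilon> > 0"
    "cball0 A \<epsilon> \<subseteq> {f. \<forall>n. norm (\<phi> n f) \<le> 1}"
    by (rule barrel_contains_cball0[OF crs mu Z U])
  have le: "norm (\<phi> n f) \<le> 1" if "f \<in> cball0 A \<epsilon>" for n f
    using A(4) that by blast
  interpret detecting_null_sequence X A "1 / \<epsilon>" \<phi>
  proof
    show "norm (\<phi> n f) \<le> 1 / \<epsilon> * r" if "r \<ge> 0" "\<And>x. x \<in> A \<Longrightarrow> norm (cfun_apply f x) \<le> r" for n f r
      by (rule bound_from_polar[OF dual A(3) le that])
    show False if "B \<subseteq> X" "compact (closure B)" "\<And>i. x i \<in> B" "\<And>i y. norm (cfun_apply (f i) y) \<le> 1"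
      "\<And>i::nat. 1 / 2 \<le> norm (cfun_apply (f i) (x i))" "\<And>i j. i < j \<Longrightarrow> cfun_apply (f j) (x i) = 0"
      "\<And>n i. norm (\<phi> n (f i)) \<le> e i" "e \<longlonglongrightarrow> 0" for B f x e
      by (rule witness_detects[OF wit that])
  qed (use A crs null in \<open>auto simp: dual_spaceD[OF dual]\<close>)
  show ?thesis
  proof (rule that[OF A(1) countable_compact_finite_height_closure finite_outside_closure])
    assume "Z = X"
    \<comment> \<open>Only for \<open>Z = X\<close> do the functionals have carriers inside
      \<open>X\<close>.\<close>
    then show "closure A \<subseteq> X"
      by (intro closure_subset_carriers) (use dual_carrier[OF dual] in simp)
  qed
qed

end

section \<open>Countable compact spaces of finite scattered height\<close>

text \<open>Countably many separating functions, one for each pair of points of \<open>K\<close>,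
  map into the metrizable product of copies of the reals. For compact \<open>K\<close> the distance
  of images is thus a metric inducing its topology.\<close>

lemma countable_set_separating_map:
  fixes K :: "'a::t2_space set"
  assumes crs: "completely_regular_space (euclidean :: 'a topology)" and K: "countable K"
  obtains \<Phi> :: "'a \<Rightarrow> nat \<Rightarrow> real" where "continuous_on UNIV \<Phi>" "inj_on \<Phi> K"
proof -
  have "\<exists>u :: 'a \<Rightarrow> real. continuous_on UNIV u \<and> (a \<noteq> b \<longrightarrow> u a \<noteq> u b)" for a b :: 'a
  proof (cases "a = b")
    case False
    then have "closedin (euclidean :: 'a topology) {b}" "a \<in> topspace euclidean - {b}"
      by auto
    then obtain f where f: "continuous_map (euclidean :: 'a topology) (top_of_set {0..1::real}) f"
        "f a = 0" "f ` {b} \<subseteq> {1}"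
      using crs unfolding completely_regular_space_def by meson
    then show ?thesis
      by (intro exI[of _ f]) (auto simp: continuous_map_in_subtopology)
  qed (auto intro: continuous_on_const)
  then obtain u :: "'a \<Rightarrow> 'a \<Rightarrow> 'a \<Rightarrow> real" where u: "\<And>a b. continuous_on UNIV (u a b)"
    "\<And>a b. a \<noteq> b \<Longrightarrow> u a b a \<noteq> u a b b"
    by metis
  define p where "p = from_nat_into (K \<times> K)"
  define \<Phi> where "\<Phi> = (\<lambda>x n. u (fst (p n)) (snd (p n)) x)"
  show ?thesis
  proof
    show "continuous_on UNIV \<Phi>"
      unfolding \<Phi>_def by (intro continuous_on_coordinatewise_then_product u)
    show "inj_on \<Phi> K"
    proof (rule inj_onI, rule ccontr)
      fix a b assume ab: "a \<in> K" "b \<in> K" "\<Phi> a = \<Phi> b" "a \<noteq> b"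
      have "countable (K \<times> K)"
        using K by simp
      then obtain n where "p n = (a, b)"
        unfolding p_def using ab(1,2) from_nat_into_surj[of "K \<times> K" "(a, b)"] by blast
      then have "\<Phi> a n \<noteq> \<Phi> b n"
        using u(2)[OF ab(4)] by (simp add: \<Phi>_def)
      then show False
        using ab(3) by simp
    qed
  qed
qed

lemma closed_nonisolated:
  assumes "closed L"
  shows "closed (nonisolated L)"
  unfolding closed_def
proof (subst open_subopen, rule ballI)
  fix x assume x: "x \<in> - nonisolated L"
  show "\<exists>T. open T \<and> x \<in> T \<and> T \<subseteq> - nonisolated L"
  proof (cases "x \<in> L")
    case True
    then have "\<not> x islimpt L"
      using x by (simp add: nonisolated_def)
    then obtain T where T: "x \<in> T" "open T" "\<forall>y\<in>L. y \<in> T \<longrightarrow> y = x"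
      unfolding islimpt_def by blast
    have "T \<subseteq> - nonisolated L"
    proof
      fix y assume "y \<in> T"
      then show "y \<in> - nonisolated L"
        using T(3) x by (cases "y \<in> L") (auto simp: nonisolated_def)
    qed
    then show ?thesis
      using T(1,2) by blast
  next
    case False
    then show ?thesis
      using assms by (intro exI[of _ "- L"]) (auto simp: nonisolated_def)
  qed
qed

lemma closed_cb_derivative: "closed K \<Longrightarrow> closed (cb_derivative K n)"
  by (induction n) (auto simp: cb_derivative_0 cb_derivative_Suc closed_nonisolated)

lemma cb_derivative_antimono: "i \<le> j \<Longrightarrow> cb_derivative K j \<subseteq> cb_derivative K i"
  by (rule lift_Suc_antimono_le[of "cb_derivative K"]) (auto simp: cb_derivative_Suc nonisolated_def)

text \<open>An infinite compact set contains one of its own limit points, and this would be a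
  non-isolated point of \<open>L\<close>.\<close>

lemma finite_closed_isolated:
  fixes L :: "'a::t2_space set"
  assumes "compact Y" "Y \<subseteq> L" "Y \<inter> nonisolated L = {}"
  shows "finite Y"
proof (rule ccontr)
  assume "infinite Y"
  then obtain p where "p \<in> Y" "p islimpt Y"
    using Heine_Borel_imp_Bolzano_Weierstrass[OF assms(1), of Y] by auto
  then have "p \<in> Y \<inter> nonisolated L"
    using assms(2) islimpt_subset by (auto simp: nonisolated_def)
  then show False
    using assms(3) by simp
qed

text \<open>
  Send each point of \<open>K\<close>, as long as possible, to a nearest point of the next derivative after
  the last one containing it. The distance tends to zero since each derivative has only finitely
  many points at a given distance from the next one.
\<close>

lemma ex_parent_map:
  fixes K :: "'a::t2_space set"
  assumes crs: "completely_regular_space (euclidean :: 'a topology)"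
    and K: "countable_compact_finite_height K"
  obtains r :: "'a \<Rightarrow> 'a" and ht :: "'a \<Rightarrow> nat" and h where
    "\<And>x. x \<in> K \<Longrightarrow> r x \<in> K" "\<And>x. x \<in> K \<Longrightarrow> r x \<noteq> x \<Longrightarrow> ht (r x) < ht x"
    "\<And>x. ht x \<le> h" "finite {x \<in> K. r x = x}"
    "\<And>(f :: ('a, 'k::real_normed_field) cfun) e. e > 0 \<Longrightarrow>
       finite {x \<in> K. e \<le> norm (cfun_apply f x - cfun_apply f (r x))}"
proof -
  have comp: "compact K" and count: "countable K"
    using K by (auto simp: countable_compact_finite_height_def)
  obtain h where h: "cb_derivative K h = {}"
    using K by (auto simp: countable_compact_finite_height_def finite_scattered_height_def)
  obtain \<Phi> :: "'a \<Rightarrow> nat \<Rightarrow> real" where \<Phi>: "continuous_on UNIV \<Phi>" "inj_on \<Phi> K"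
    by (rule countable_set_separating_map[OF crs count])
  \<comment> \<open>A continuous pseudometric on the whole space that is a metric on
    \<open>K\<close>.\<close>
  define d where "d = (\<lambda>x y. dist (\<Phi> x) (\<Phi> y))"
  have d_cont: "continuous_on UNIV (d x)" "continuous_on UNIV (\<lambda>x. d x y)" for x y
    unfolding d_def by (intro continuous_intros \<Phi>)+
  define L where "L = cb_derivative K"
  have L0: "L 0 = K" and LSuc: "L (Suc i) = nonisolated (L i)" for i
    by (simp_all add: L_def cb_derivative_0 cb_derivative_Suc)
  have L_sub: "L i \<subseteq> K" for i
    by (simp add: L_def cb_derivative_subset)
  have L_anti: "L j \<subseteq> L i" if "i \<le> j" for i j
    using that by (simp add: L_def cb_derivative_antimono)
  have L_compact: "compact (L i)" for i
    using closed_cb_derivative[OF compact_imp_closed[OF comp], of i] L_sub[of i] comp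
    unfolding L_def by (metis compact_Int_closed inf.absorb_iff2)
  \<comment> \<open>For points of \<open>K\<close> this is the Cantor-Bendixson rank plus 1, so
    \<open>L (\<kappa> x)\<close> is the first derivative without \<open>x\<close>; for other points
    it is 0.\<close>
  define \<kappa> where "\<kappa> = (\<lambda>x. LEAST j. x \<notin> L j)"
  have \<kappa>_notin: "x \<notin> L (\<kappa> x)" and \<kappa>_le: "\<kappa> x \<le> h" for x
  proof -
    have "x \<notin> L h"
      using h by (simp add: L_def)
    then show "x \<notin> L (\<kappa> x)" "\<kappa> x \<le> h"
      unfolding \<kappa>_def by (rule LeastI[of "\<lambda>j. x \<notin> L j"], rule Least_le)
  qed
  have in_L: "x \<in> L i" if "i < \<kappa> x" for i x
    using not_less_Least[of i "\<lambda>j. x \<notin> L j"] that by (auto simp: \<kappa>_def)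
  have less_\<kappa>: "i < \<kappa> x" if "x \<in> L i" for i x
    using that L_anti[of "\<kappa> x" i] \<kappa>_notin[of x] by (meson not_le subsetD)
  have \<kappa>_pos: "\<kappa> x = Suc (\<kappa> x - 1)" if "x \<in> K" for x
    using less_\<kappa>[of x 0] that by (simp add: L0)
  \<comment> \<open>Where the next derivative is empty, \<open>x\<close> is made a fixed point:
    these are the roots at which all chains end.\<close>
  define r where "r = (\<lambda>x. if L (\<kappa> x) = {} then x else SOME y. y \<in> L (\<kappa> x) \<and> (\<forall>z\<in>L (\<kappa> x). d x y \<le> d x z))"
  have r: "r x \<in> L (\<kappa> x)" "\<And>z. z \<in> L (\<kappa> x) \<Longrightarrow> d x (r x) \<le> d x z" if ne: "L (\<kappa> x) \<noteq> {}" for x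
  proof -
    have "\<exists>y\<in>L (\<kappa> x). \<forall>z\<in>L (\<kappa> x). d x y \<le> d x z"
      by (rule continuous_attains_inf[OF L_compact ne]) (rule continuous_on_subset[OF d_cont(1)], simp)
    then have "\<exists>y. y \<in> L (\<kappa> x) \<and> (\<forall>z\<in>L (\<kappa> x). d x y \<le> d x z)"
      by blast
    from someI_ex[OF this] show "r x \<in> L (\<kappa> x)" "\<And>z. z \<in> L (\<kappa> x) \<Longrightarrow> d x (r x) \<le> d x z"
      using ne by (auto simp: r_def)
  qed
  have fin: "finite {x \<in> K. \<forall>z\<in>L (\<kappa> x). \<delta> \<le> d x z}" if \<delta>: "\<delta> > 0" for \<delta>
  proof -
    \<comment> \<open>\<open>Y i\<close> is a closed part of \<open>L i\<close> that misses
      \<open>L (Suc i)\<close>, as the distance of a point to itself is 0. If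
      \<open>L (Suc i)\<close> is empty the condition is vacuous, so the roots are covered
      too.\<close>
    define Y where "Y = (\<lambda>i. {x \<in> L i. \<forall>z\<in>L (Suc i). \<delta> \<le> d x z})"
    have "finite (Y i)" for i
    proof (rule finite_closed_isolated)
      have "closed (\<Inter>z\<in>L (Suc i). {x. \<delta> \<le> d x z})"
        by (intro closed_INT ballI closed_Collect_le d_cont continuous_intros)
      moreover have "Y i = L i \<inter> (\<Inter>z\<in>L (Suc i). {x. \<delta> \<le> d x z})"
        by (auto simp: Y_def)
      ultimately show "compact (Y i)"
        using L_compact by (simp add: compact_Int_closed)
      show "Y i \<subseteq> L i"
        by (auto simp: Y_def)
      show "Y i \<inter> nonisolated (L i) = {}"
        using \<delta> by (auto simp: Y_def d_def simp flip: LSuc)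
    qed
    then have "finite (\<Union>i<h. Y i)"
      by simp
    moreover have "x \<in> (\<Union>i<h. Y i)" if x: "x \<in> K" "\<forall>z\<in>L (\<kappa> x). \<delta> \<le> d x z" for x
    proof -
      have "\<kappa> x - 1 < h" "x \<in> L (\<kappa> x - 1)"
        using \<kappa>_pos[OF x(1)] \<kappa>_le[of x] in_L[of "\<kappa> x - 1" x] by linarith+
      moreover have "x \<in> Y (\<kappa> x - 1)"
        using calculation(2) x(2) \<kappa>_pos[OF x(1)] by (simp add: Y_def)
      ultimately show ?thesis
        by blast
    qed
    ultimately show ?thesis
      by (elim finite_subset[rotated]) blast
  qed
  show ?thesis
  \<comment> \<open>\<open>r\<close> raises \<open>\<kappa>\<close>, which is at most
    \<open>h\<close>; the complement \<open>h - \<kappa> x\<close> therefore decreases along chains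
    and bounds their length.\<close>
  proof (rule that[of r "\<lambda>x. h - \<kappa> x" h])
    show "r x \<in> K" if "x \<in> K" for x
      using that r(1)[of x] L_sub by (cases "L (\<kappa> x) = {}") (auto simp: r_def)
    show "h - \<kappa> (r x) < h - \<kappa> x" if "r x \<noteq> x" for x
    proof -
      have "L (\<kappa> x) \<noteq> {}"
        using that by (auto simp: r_def)
      then have "\<kappa> x < \<kappa> (r x)"
        by (intro less_\<kappa> r)
      then show ?thesis
        using \<kappa>_le[of "r x"] by linarith
    qed
    have "L (\<kappa> x) = {}" if "r x = x" for x
      using that r(1)[of x] \<kappa>_notin[of x] by metis
    then show "finite {x \<in> K. r x = x}"
      by (intro finite_subset[OF _ fin[OF zero_less_one]]) auto
    fix f :: "('a, 'k) cfun" and e :: real assume e: "e > 0"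
    \<comment> \<open>The pairs between which \<open>f\<close> varies by at least \<open>e\<close>
      form a compact set off the diagonal, on which \<open>d\<close> has a positive minimum: uniform
      continuity of \<open>f\<close> on \<open>K\<close> with respect to \<open>d\<close>.\<close>
    define D where "D = (K \<times> K) \<inter> {p. e \<le> norm (cfun_apply f (fst p) - cfun_apply f (snd p))}"
    have "closed {p :: 'a \<times> 'a. e \<le> norm (cfun_apply f (fst p) - cfun_apply f (snd p))}"
      by (intro closed_Collect_le continuous_intros
          continuous_on_compose2[OF continuous_cfun continuous_on_fst[OF continuous_on_id]]
          continuous_on_compose2[OF continuous_cfun continuous_on_snd[OF continuous_on_id]]) auto
    then have D: "compact D"
      unfolding D_def by (intro compact_Int_closed compact_Times comp)
    have "\<exists>\<delta>>0. \<forall>p\<in>D. \<delta> \<le> d (fst p) (snd p)"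
    proof (cases "D = {}")
      case False
      have "continuous_on D (\<lambda>p. d (fst p) (snd p))"
        unfolding d_def
        by (intro continuous_intros
            continuous_on_compose2[OF \<Phi>(1) continuous_on_fst[OF continuous_on_id]]
            continuous_on_compose2[OF \<Phi>(1) continuous_on_snd[OF continuous_on_id]]) auto
      then obtain p where p: "p \<in> D" "\<And>q. q \<in> D \<Longrightarrow> d (fst p) (snd p) \<le> d (fst q) (snd q)"
        using continuous_attains_inf[OF D False] by blast
      have "fst p \<noteq> snd p"
        using p(1) e by (auto simp: D_def)
      then have "d (fst p) (snd p) > 0"
        using p(1) \<Phi>(2) by (auto simp: D_def d_def dest: inj_onD)
      then show ?thesis
        using p(2) by blast
    qed (auto intro: exI[of _ 1])
    then obtain \<delta> where \<delta>: "\<delta> > 0" "\<And>p. p \<in> D \<Longrightarrow> \<delta> \<le> d (fst p) (snd p)"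
      by blast
    have "\<forall>z\<in>L (\<kappa> x). \<delta> \<le> d x z" if x: "x \<in> K" "e \<le> norm (cfun_apply f x - cfun_apply f (r x))" for x
    proof
      fix z assume z: "z \<in> L (\<kappa> x)"
      then have "r x \<in> L (\<kappa> x)" "d x (r x) \<le> d x z"
        using r[of x] by blast+
      moreover have "(x, r x) \<in> D"
        using x calculation(1) L_sub by (auto simp: D_def)
      ultimately show "\<delta> \<le> d x z"
        using \<delta>(2)[of "(x, r x)"] by simp
    qed
    then show "finite {x \<in> K. e \<le> norm (cfun_apply f x - cfun_apply f (r x))}"
      by (intro finite_subset[OF _ fin[OF \<delta>(1)]]) auto
  qed (use \<kappa>_le in auto)
qed

section \<open>Finite nets and closures of countable sets\<close>

text \<open>Round the values on \<open>D\<close> to a finite \<open>e / 2\<close>-net of the compact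
  scalar ball: finitely many patterns occur, and functions with the same pattern differ by at most
  \<open>e\<close>. Representatives are taken from \<open>B\<close> itself because the estimates
  along chains hold only for members of \<open>B\<close>.\<close>

lemma finite_net_on_finite_set:
  fixes B :: "('a::topological_space, 'k::{real_normed_field, euclidean_space}) cfun set"
  assumes D: "finite D" and R: "\<And>f x. f \<in> B \<Longrightarrow> x \<in> D \<Longrightarrow> norm (cfun_apply f x) \<le> R" and e: "e > 0"
  obtains F where "finite F" "F \<subseteq> B"
    "\<And>f. f \<in> B \<Longrightarrow> \<exists>g\<in>F. \<forall>x\<in>D. norm (cfun_apply f x - cfun_apply g x) \<le> e"
proof -
  obtain N where N: "finite N" "cball (0::'k) R \<subseteq> (\<Union>c\<in>N. ball c (e / 2))"
  proof (rule compactE_image[OF compact_cball[of "0::'k" R], of UNIV "\<lambda>c. ball c (e / 2)"])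
    show "cball (0::'k) R \<subseteq> (\<Union>c. ball c (e / 2))"
    proof
      fix x :: 'k
      show "x \<in> (\<Union>c. ball c (e / 2))"
        using e by (intro UN_I[of x]) auto
    qed
  qed auto
  have "\<exists>c\<in>N. dist c z < e / 2" if "norm z \<le> R" for z
    using N(2) that by (auto simp: subset_iff)
  then obtain c where c: "\<And>z. norm z \<le> R \<Longrightarrow> c z \<in> N" "\<And>z. norm z \<le> R \<Longrightarrow> dist (c z) z < e / 2"
    by metis
  define q where "q = (\<lambda>f. restrict (\<lambda>x. c (cfun_apply f x)) D)"
  have "q ` B \<subseteq> PiE D (\<lambda>_. N)"
    using c(1) R by (auto simp: q_def)
  then have fin: "finite (q ` B)"
    using finite_PiE[OF D, of "\<lambda>_. N"] N(1) finite_subset by blast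
  show ?thesis
  proof (rule that[of "inv_into B q ` q ` B"])
    show "finite (inv_into B q ` q ` B)"
      using fin by simp
    show "inv_into B q ` q ` B \<subseteq> B"
      by (auto intro: inv_into_into)
    fix f assume f: "f \<in> B"
    define g where "g = inv_into B q (q f)"
    have g: "g \<in> B" "q g = q f"
      using f by (auto simp: g_def inv_into_into f_inv_into_f)
    have "norm (cfun_apply f x - cfun_apply g x) \<le> e" if x: "x \<in> D" for x
    proof -
      have "c (cfun_apply f x) = c (cfun_apply g x)"
        using fun_cong[OF g(2), of x] x by (simp add: q_def)
      then show ?thesis
        using c(2)[OF R[OF f x]] c(2)[OF R[OF g(1) x]]
          dist_triangle_half_r[of "c (cfun_apply f x)" "cfun_apply f x" e "cfun_apply g x"]
        by (simp add: dist_norm)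
    qed
    then show "\<exists>g\<in>inv_into B q ` q ` B. \<forall>x\<in>D. norm (cfun_apply f x - cfun_apply g x) \<le> e"
      using f by (auto simp: g_def)
  qed
qed

text \<open>Following \<open>r\<close> from \<open>x\<close> until the chain enters the finite set
  \<open>D\<close> of roots and exceptional points changes every function in \<open>B\<close> only
  little, so approximation on \<open>D\<close> spreads to \<open>K\<close>. The finitely many points
  of \<open>K'\<close> are put into the net directly.\<close>

lemma finite_net_by_parent_map:
  fixes B :: "('a::topological_space, 'k::{real_normed_field, euclidean_space}) cfun set"
  assumes r: "\<And>x. x \<in> K \<Longrightarrow> r x \<in> K" "\<And>x. x \<in> K \<Longrightarrow> r x \<noteq> x \<Longrightarrow> ht (r x) < (ht x :: nat)"
      "\<And>x. ht x \<le> h" "finite {x \<in> K. r x = x}"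
    and K': "finite K'"
    and R: "\<And>f x. f \<in> B \<Longrightarrow> x \<in> K \<union> K' \<Longrightarrow> norm (cfun_apply f x) \<le> R"
    and small: "\<And>e. e > 0 \<Longrightarrow> finite {x \<in> K. \<exists>f\<in>B. e < norm (cfun_apply f x - cfun_apply f (r x))}"
    and e: "e > 0"
  obtains F where "finite F"
    "\<And>f. f \<in> B \<Longrightarrow> \<exists>g\<in>F. \<forall>x\<in>K \<union> K'. norm (cfun_apply f x - cfun_apply g x) \<le> e"
proof -
  \<comment> \<open>At most \<open>h\<close> links cost \<open>e / 3\<close>, to be paid once for
    \<open>f\<close> and once for \<open>g\<close>, leaving \<open>e / 3\<close> for the net on
    \<open>D\<close>. \<open>Suc h\<close> avoids division by zero.\<close>
  define \<eta> where "\<eta> = e / (3 * real (Suc h))"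
  have \<eta>: "\<eta> > 0" "real h * \<eta> \<le> e / 3"
    using e by (auto simp: \<eta>_def field_simps)
  define D where "D = {x \<in> K. r x = x} \<union> {x \<in> K. \<exists>f\<in>B. \<eta> < norm (cfun_apply f x - cfun_apply f (r x))}"
  have D: "finite D" "D \<subseteq> K"
    using r(4) small[OF \<eta>(1)] by (auto simp: D_def)
  \<comment> \<open>The end point \<open>z\<close> is chosen before \<open>f\<close>, since
    \<open>f\<close> and its approximation must be compared at the same point of
    \<open>D\<close>.\<close>
  have chain: "\<exists>z\<in>D. \<forall>f\<in>B. norm (cfun_apply f x - cfun_apply f z) \<le> real (ht x) * \<eta>" if "x \<in> K" for x
    using that
  proof (induction "ht x" arbitrary: x rule: less_induct)
    case less
    show ?case
    proof (cases "x \<in> D")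
      case True
      then show ?thesis
        using \<eta>(1) by (intro bexI[of _ x]) auto
    next
      case False
      then have "ht (r x) < ht x"
        using r(2) less.prems by (auto simp: D_def)
      then obtain z where z: "z \<in> D"
        "\<And>f. f \<in> B \<Longrightarrow> norm (cfun_apply f (r x) - cfun_apply f z) \<le> real (ht (r x)) * \<eta>"
        using less.hyps r(1)[OF less.prems] by blast
      have "norm (cfun_apply f x - cfun_apply f z) \<le> real (ht x) * \<eta>" if f: "f \<in> B" for f
      proof -
        have "norm (cfun_apply f x - cfun_apply f (r x)) \<le> \<eta>"
          using False less.prems f by (auto simp: D_def not_less)
        then have "norm (cfun_apply f x - cfun_apply f z) \<le> \<eta> + real (ht (r x)) * \<eta>"
          using z(2)[OF f] norm_triangle_ineq[of "cfun_apply f x - cfun_apply f (r x)" "cfun_apply f (r x) - cfun_apply f z"]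
          by simp
        also have "\<dots> = real (Suc (ht (r x))) * \<eta>"
          by (simp add: algebra_simps)
        also have "\<dots> \<le> real (ht x) * \<eta>"
          using \<open>ht (r x) < ht x\<close> \<eta>(1) by (intro mult_right_mono) auto
        finally show ?thesis .
      qed
      then show ?thesis
        using z(1) by blast
    qed
  qed
  obtain F where F: "finite F" "F \<subseteq> B"
    "\<And>f. f \<in> B \<Longrightarrow> \<exists>g\<in>F. \<forall>x\<in>D \<union> K'. norm (cfun_apply f x - cfun_apply g x) \<le> e / 3"
    by (rule finite_net_on_finite_set[of "D \<union> K'" B R "e / 3"]) (use D K' R e in auto)
  show ?thesis
  proof (rule that[OF F(1)])
    fix f assume f: "f \<in> B"
    then obtain g where g: "g \<in> F" "\<And>x. x \<in> D \<union> K' \<Longrightarrow> norm (cfun_apply f x - cfun_apply g x) \<le> e / 3"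
      using F(3) by blast
    have "norm (cfun_apply f x - cfun_apply g x) \<le> e" if x: "x \<in> K" for x
    proof -
      obtain z where z: "z \<in> D"
        "\<And>f. f \<in> B \<Longrightarrow> norm (cfun_apply f x - cfun_apply f z) \<le> real (ht x) * \<eta>"
        using chain[OF x] by blast
      have "real (ht x) * \<eta> \<le> real h * \<eta>"
        using r(3)[of x] \<eta>(1) by (intro mult_right_mono) auto
      then have "norm (cfun_apply f' x - cfun_apply f' z) \<le> e / 3" if "f' \<in> B" for f'
        using z(2)[OF that] \<eta>(2) by linarith
      then have "norm (cfun_apply f x - cfun_apply f z) \<le> e / 3" "norm (cfun_apply g x - cfun_apply g z) \<le> e / 3"
        using f g(1) F(2) by auto
      moreover have "norm (cfun_apply f z - cfun_apply g z) \<le> e / 3"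
        using g(2) z(1) by blast
      moreover have "norm (cfun_apply f x - cfun_apply g x) \<le> norm (cfun_apply f x - cfun_apply f z) +
          norm (cfun_apply f z - cfun_apply g z) + norm (cfun_apply g x - cfun_apply g z)"
        by norm
      ultimately show ?thesis
        by linarith
    qed
    then show "\<exists>g\<in>F. \<forall>x\<in>K \<union> K'. norm (cfun_apply f x - cfun_apply g x) \<le> e"
      using g e by (intro bexI[of _ g]) fastforce+
  qed
qed

lemma supp_eval_diff:
  fixes x y :: "'a::t2_space"
  shows "supp (\<lambda>f :: ('a, 'k::real_normed_field) cfun. cfun_apply f x - cfun_apply f y) \<subseteq> {x, y}"
proof
  fix z assume z: "z \<in> supp (\<lambda>f :: ('a, 'k) cfun. cfun_apply f x - cfun_apply f y)"
  show "z \<in> {x, y}"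
  proof (rule ccontr)
    assume "z \<notin> {x, y}"
    moreover have "open (- {x, y})"
      by (intro open_Compl finite_imp_closed) simp
    ultimately obtain f :: "('a, 'k) cfun" where f: "cfun_apply f x - cfun_apply f y \<noteq> 0"
      "csupport f \<subseteq> - {x, y}"
      using z unfolding supp_def csupport_def by blast
    then have "cfun_apply f x = 0" "cfun_apply f y = 0"
      by (auto intro: not_in_csupport)
    then show False
      using f(1) by simp
  qed
qed

lemma supp_zero: "supp (\<lambda>f. 0) = {}"
  unfolding supp_def by auto

text \<open>A countable compact closure is metrizable through the separating map, so each of its
  points is the limit of a sequence in \<open>A\<close>, and sequential closedness suffices.\<close>

lemma closure_subset_if_sequentially_closed:
  fixes X :: "'a::t2_space set"
  assumes crs: "completely_regular_space (euclidean :: 'a topology)"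
    and X: "sequentially_closed X" and A: "A \<subseteq> X" "compact (closure A)" "countable (closure A)"
  shows "closure A \<subseteq> X"
proof
  fix y assume y: "y \<in> closure A"
  obtain \<Phi> :: "'a \<Rightarrow> nat \<Rightarrow> real" where \<Phi>: "continuous_on UNIV \<Phi>" "inj_on \<Phi> (closure A)"
    by (rule countable_set_separating_map[OF crs A(3)])
  define d where "d = (\<lambda>x. dist (\<Phi> x) (\<Phi> y))"
  have d: "continuous_on UNIV d"
    unfolding d_def by (intro continuous_intros \<Phi>)
  have "\<exists>x\<in>A. d x < 1 / real (Suc n)" for n
  proof -
    have "open {x. d x < 1 / real (Suc n)}"
      by (intro open_Collect_less d continuous_intros)
    moreover have "y \<in> {x. d x < 1 / real (Suc n)} \<inter> closure A"
      using y by (simp add: d_def)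
    ultimately show ?thesis
      using open_Int_closure_eq_empty[of "{x. d x < 1 / real (Suc n)}" A] by blast
  qed
  then obtain x where x: "\<And>n. x n \<in> A" "\<And>n. d (x n) < 1 / real (Suc n)"
    by metis
  have "x \<longlonglongrightarrow> y"
  proof (rule topological_tendstoI)
    fix W assume W: "open W" "y \<in> W"
    define F where "F = closure A - W"
    \<comment> \<open>Outside a neighbourhood of \<open>y\<close> the distance to \<open>y\<close>
      has a positive minimum on the closure; once \<open>1 / Suc n\<close> is below it,
      \<open>x n\<close> is in the neighbourhood.\<close>
    have F: "compact F"
      unfolding F_def by (intro compact_diff A W)
    have "\<exists>\<delta>>0. \<forall>z\<in>F. \<delta> \<le> d z"
    proof (cases "F = {}")
      case False
      obtain z where z: "z \<in> F" "\<And>z'. z' \<in> F \<Longrightarrow> d z \<le> d z'"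
        using continuous_attains_inf[OF F False continuous_on_subset[OF d subset_UNIV]] by blast
      have "z \<in> closure A" "z \<noteq> y"
        using z(1) W by (auto simp: F_def)
      then have "d z > 0"
        using y \<Phi>(2) by (auto simp: d_def dest: inj_onD)
      then show ?thesis
        using z(2) by blast
    qed (auto intro: exI[of _ 1])
    then obtain \<delta> where \<delta>: "\<delta> > 0" "\<And>z. z \<in> F \<Longrightarrow> \<delta> \<le> d z"
      by blast
    have "(\<lambda>n. 1 / real (Suc n)) \<longlonglongrightarrow> 0"
      using LIMSEQ_inverse_real_of_nat by (simp add: inverse_eq_divide)
    then have "\<forall>\<^sub>F n in sequentially. 1 / real (Suc n) < \<delta>"
      using \<delta>(1) by (rule order_tendstoD)
    then show "\<forall>\<^sub>F n in sequentially. x n \<in> W"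
    proof (rule eventually_mono)
      fix n assume "1 / real (Suc n) < \<delta>"
      then have "x n \<notin> F"
        using x(2)[of n] \<delta>(2)[of "x n"] by linarith
      then show "x n \<in> W"
        using x(1)[of n] closure_subset[of A] by (auto simp: F_def)
    qed
  qed
  moreover have "\<forall>n. x n \<in> X"
    using x(1) A(1) by blast
  ultimately show "y \<in> X"
    using X unfolding sequentially_closed_def by blast
qed

section \<open>Sufficiency: finitely supported witnesses\<close>

context lc_topology_between
begin

lemma dual_zero: "(\<lambda>f. 0) \<in> dual_space cscale T"
  unfolding dual_space_def Vector_Spaces.linear_iff
  by (simp add: vector_space_cscale) (simp add: vector_space_def algebra_simps)

lemma dual_eval_diff:
  assumes "x \<in> X" "y \<in> X"
  shows "(\<lambda>f. cfun_apply f x - cfun_apply f y) \<in> dual_space cscale T"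
proof -
  have "continuous_map T euclidean (\<lambda>f. cfun_apply f z)" if "z \<in> X" for z
    using continuous_map_eval_Tp[OF that] by (auto simp: continuous_map_def openin_if_openin_Tp)
  then have "continuous_map T euclidean (\<lambda>f. cfun_apply f x - cfun_apply f y)"
    using assms by (intro continuous_map_diff)
  moreover have "vector_space ((*) :: 'k \<Rightarrow> 'k \<Rightarrow> 'k)"
    by (simp add: vector_space_def algebra_simps)
  ultimately show ?thesis
    by (simp add: dual_space_def Vector_Spaces.linear_iff vector_space_cscale cfun_simps algebra_simps)
qed

text \<open>A barrel contains some \<open>cball0 A \<epsilon>\<close>, and by assumption
  \<open>A\<close> has only finitely many points off \<open>K\<close>. So uniform nets on
  \<open>K\<close> together with finitely many further points serve all barrels.\<close>

lemma barrel_precompactI: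
  assumes K: "\<And>F. compact F \<Longrightarrow> finite (F \<inter> X - K)"
    and net: "\<And>K' e. finite K' \<Longrightarrow> K' \<subseteq> X \<Longrightarrow> e > 0 \<Longrightarrow>
      \<exists>F. finite F \<and> (\<forall>f\<in>B. \<exists>g\<in>F. \<forall>x\<in>K \<union> K'. norm (cfun_apply f x - cfun_apply g x) \<le> e)"
  shows "barrel_precompact cscale T B"
  unfolding barrel_precompact_def
proof (intro allI impI)
  fix U assume "barrel cscale T U"
  note U = barrelD[OF this]
  obtain A \<epsilon> where A: "A \<subseteq> X" "compact (closure A)" "\<epsilon> > 0" "cball0 A \<epsilon> \<subseteq> U"
    by (rule barrel_contains_cball0[OF crs mu Z U])
  define K' where "K' = closure A \<inter> X - K"
  have "finite K'" "K' \<subseteq> X" "A \<subseteq> K \<union> K'"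
    using K[OF A(2)] A(1) closure_subset[of A] by (auto simp: K'_def)
  then obtain F where F: "finite F"
    "\<And>f. f \<in> B \<Longrightarrow> \<exists>g\<in>F. \<forall>x\<in>K \<union> K'. norm (cfun_apply f x - cfun_apply g x) \<le> \<epsilon>"
    using net[OF _ _ A(3), of K'] by blast
  have "f \<in> {a + u |a u. a \<in> F \<and> u \<in> U}" if f: "f \<in> B" for f
  proof -
    obtain g where g: "g \<in> F" "\<And>x. x \<in> K \<union> K' \<Longrightarrow> norm (cfun_apply f x - cfun_apply g x) \<le> \<epsilon>"
      using F(2)[OF f] by blast
    then have "f - g \<in> cball0 A \<epsilon>"
      using \<open>A \<subseteq> K \<union> K'\<close> by (auto simp: cball0_def cfun_simps)
    then have "f - g \<in> U"
      using A(4) by blast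
    moreover have "f = g + (f - g)"
      by simp
    ultimately show ?thesis
      using g(1) by blast
  qed
  then show "\<exists>F. finite F \<and> B \<subseteq> {a + u |a u. a \<in> F \<and> u \<in> U}"
    using F(1) by blast
qed

lemma barrel_boundedD:
  assumes B: "barrel_bounded cscale T B" and K: "K \<subseteq> X" "compact K"
  obtains R where "\<And>f x. f \<in> B \<Longrightarrow> x \<in> K \<Longrightarrow> norm (cfun_apply f x) \<le> R"
proof -
  have "barrel cscale T (cball0 K 1)"
    using K by (intro barrel_cball0) (auto simp: compact_imp_closed)
  then obtain n where n: "B \<subseteq> cscale (of_nat n) ` cball0 K 1"
    using B unfolding barrel_bounded_def by blast
  have "norm (cfun_apply f x) \<le> real n" if "f \<in> B" "x \<in> K" for f x
  proof -
    obtain g where g: "f = cscale (of_nat n) g" "g \<in> cball0 K 1"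
      using n \<open>f \<in> B\<close> by blast
    then have "norm (cfun_apply g x) \<le> 1"
      using \<open>x \<in> K\<close> by (simp add: cball0_def)
    then have "real n * norm (cfun_apply g x) \<le> real n * 1"
      by (intro mult_left_mono) auto
    then show ?thesis
      by (simp add: g(1) cfun_simps norm_mult)
  qed
  then show ?thesis
    by (rule that)
qed

text \<open>The functionals are the differences along the links \<open>x\<close>,
  \<open>r x\<close>. Their uniform convergence to 0 on \<open>B\<close> is precisely the smallness
  that the chain argument needs, so precompactness is shown in contrapositive form.\<close>

lemma ex_finitely_supported_witness:
  assumes KX: "K \<subseteq> X" and K: "countable_compact_finite_height K"
    and fin: "\<And>F. compact F \<Longrightarrow> finite (F \<inter> X - K)"
  shows "\<exists>\<mu>. witnesses_strongly_GP cscale T \<mu> \<and> (\<forall>n. finite (supp (\<mu> n)) \<and> supp (\<mu> n) \<subseteq> K)"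
proof -
  obtain r ht h where r: "\<And>x. x \<in> K \<Longrightarrow> r x \<in> K" "\<And>x. x \<in> K \<Longrightarrow> r x \<noteq> x \<Longrightarrow> ht (r x) < (ht x :: nat)"
      "\<And>x. ht x \<le> h" "finite {x \<in> K. r x = x}"
    and null: "\<And>(f :: ('a, 'k) cfun) e. e > 0 \<Longrightarrow>
       finite {x \<in> K. e \<le> norm (cfun_apply f x - cfun_apply f (r x))}"
    by (rule ex_parent_map[where 'k = 'k, OF crs K]) blast
  have comp: "compact K" and count: "countable K"
    using K by (auto simp: countable_compact_finite_height_def)
  define ix where "ix = to_nat_on K"
  have inj: "inj_on ix K"
    using count by (simp add: ix_def inj_on_to_nat_on)
  define pt where "pt = inv_into K ix"
  have pt_ix: "pt (ix x) = x" if "x \<in> K" for x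
    using inj that by (simp add: pt_def)
  have pt_K: "pt n \<in> K" "ix (pt n) = n" if "n \<in> ix ` K" for n
    using that by (auto simp: pt_def inv_into_into f_inv_into_f)
  \<comment> \<open>Indices outside the image of \<open>ix\<close> occur if \<open>K\<close> is
    finite; they receive the zero functional.\<close>
  define \<mu> :: "nat \<Rightarrow> ('a, 'k) cfun \<Rightarrow> 'k" where
    "\<mu> = (\<lambda>n. if n \<in> ix ` K then (\<lambda>f. cfun_apply f (pt n) - cfun_apply f (r (pt n))) else (\<lambda>f. 0))"
  have \<mu>_ix: "\<mu> (ix x) f = cfun_apply f x - cfun_apply f (r x)" if "x \<in> K" for x f
    using that by (simp add: \<mu>_def pt_ix)
  have dual: "\<mu> n \<in> dual_space cscale T" for n
    using KX pt_K r(1) by (auto simp: \<mu>_def intro!: dual_zero dual_eval_diff)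
  have \<mu>_0: "\<mu> n 0 = 0" for n
    by (simp add: \<mu>_def cfun_simps)
  have lim: "(\<lambda>n. \<mu> n f) \<longlonglongrightarrow> 0" for f
  proof (rule tendstoI)
    fix e :: real assume e: "e > 0"
    have "finite (ix ` {x \<in> K. e \<le> norm (cfun_apply f x - cfun_apply f (r x))})"
      using null[OF e] by (rule finite_imageI)
    then have "\<forall>\<^sub>F n in sequentially. n \<notin> ix ` {x \<in> K. e \<le> norm (cfun_apply f x - cfun_apply f (r x))}"
      unfolding cofinite_eq_sequentially[symmetric] by (simp add: eventually_cofinite)
    then show "\<forall>\<^sub>F n in sequentially. dist (\<mu> n f) 0 < e"
    proof (rule eventually_mono)
      fix n assume n: "n \<notin> ix ` {x \<in> K. e \<le> norm (cfun_apply f x - cfun_apply f (r x))}"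
      show "dist (\<mu> n f) 0 < e"
      proof (cases "n \<in> ix ` K")
        case True
        then obtain x where "x \<in> K" "n = ix x"
          by blast
        then show ?thesis
          using n by (auto simp: \<mu>_ix not_le)
      qed (use e in \<open>simp add: \<mu>_def\<close>)
    qed
  qed
  have precompact: "barrel_precompact cscale T B"
    if B: "barrel_bounded cscale T B" and B_lim: "(\<lambda>n. norm_on B (\<mu> n)) \<longlonglongrightarrow> 0" for B
  proof (rule barrel_precompactI[OF fin])
    fix K' and e :: real assume K': "finite K'" "K' \<subseteq> X" and e: "e > 0"
    obtain R where R: "\<And>f x. f \<in> B \<Longrightarrow> x \<in> K \<union> K' \<Longrightarrow> norm (cfun_apply f x) \<le> R"
      using barrel_boundedD[OF B, of "K \<union> K'"] KX K' comp by (metis Un_least compact_Un finite_imp_compact)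
    \<comment> \<open>Uniform convergence fails at level \<open>e\<close> for only finitely many
      indices, and \<open>ix\<close> is injective, so only finitely many points of \<open>K\<close>
      are exceptional.\<close>
    have small: "finite {x \<in> K. \<exists>f\<in>B. e < norm (cfun_apply f x - cfun_apply f (r x))}"
      if e: "e > 0" for e
    proof -
      have "\<forall>\<^sub>F n in sequentially. \<forall>f\<in>B. norm (\<mu> n f) \<le> e"
        using B_lim norm_on_tendsto_0_iff[of \<mu>, OF \<mu>_0] e by blast
      then have "finite {n. \<not> (\<forall>f\<in>B. norm (\<mu> n f) \<le> e)}"
        unfolding cofinite_eq_sequentially[symmetric] eventually_cofinite .
      moreover have "ix ` {x \<in> K. \<exists>f\<in>B. e < norm (cfun_apply f x - cfun_apply f (r x))} \<subseteq>
          {n. \<not> (\<forall>f\<in>B. norm (\<mu> n f) \<le> e)}"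
        by (auto simp: \<mu>_ix not_le)
      moreover have "inj_on ix {x \<in> K. \<exists>f\<in>B. e < norm (cfun_apply f x - cfun_apply f (r x))}"
        by (rule inj_on_subset[OF inj]) auto
      ultimately show ?thesis
        using inj_on_finite by blast
    qed
    obtain F where "finite F"
      "\<And>f. f \<in> B \<Longrightarrow> \<exists>g\<in>F. \<forall>x\<in>K \<union> K'. norm (cfun_apply f x - cfun_apply g x) \<le> e"
      by (rule finite_net_by_parent_map[where r = r and K = K and ht = ht and h = h and B = B and R = R,
            OF r K'(1) R small e]) blast+
    then show "\<exists>F. finite F \<and> (\<forall>f\<in>B. \<exists>g\<in>F. \<forall>x\<in>K \<union> K'. norm (cfun_apply f x - cfun_apply g x) \<le> e)"
      by blast
  qed
  have "witnesses_strongly_GP cscale T \<mu>"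
    unfolding witnesses_strongly_GP_def using dual lim precompact by blast
  moreover have "finite (supp (\<mu> n)) \<and> supp (\<mu> n) \<subseteq> K" for n
  proof (cases "n \<in> ix ` K")
    case True
    then have "supp (\<mu> n) \<subseteq> {pt n, r (pt n)}"
      unfolding \<mu>_def by (simp add: supp_eval_diff)
    moreover have "{pt n, r (pt n)} \<subseteq> K"
      using pt_K[OF True] r(1) by blast
    ultimately show ?thesis
      using finite_subset by fastforce
  next
    case False
    then show ?thesis
      by (simp add: \<mu>_def supp_zero)
  qed
  ultimately show ?thesis
    by blast
qed

end

section \<open>Combining necessity and sufficiency for both ranges of topologies\<close>

theorem theorem3p7:
  fixes X :: "'a::t2_space set"
  assumes tychonoff: "completely_regular_space (euclidean :: 'a topology)"
    and infdim: "infinite_dimensional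
          (cscale :: 'k::{real_normed_field, euclidean_space} \<Rightarrow> ('a, 'k) cfun \<Rightarrow> ('a, 'k) cfun)"
    and mu: "mu_space TYPE('k) TYPE('a)"
    and dense: "closure X = UNIV"
  shows
    "\<comment> \<open>(A): (i), (ii), (iii)\<close>
     (((\<forall>T \<in> lc_topologies_between (Tp X) (Tk X :: ('a, 'k) cfun topology). strongly_GP cscale T)
        \<longleftrightarrow>
       (\<exists>T \<in> lc_topologies_between (Tp X) (Tk X :: ('a, 'k) cfun topology). strongly_GP cscale T))
      \<and>
      ((\<exists>T \<in> lc_topologies_between (Tp X) (Tk X :: ('a, 'k) cfun topology). strongly_GP cscale T)
        \<longleftrightarrow>
       (\<exists>K \<subseteq> X. countable_compact_finite_height K \<and>
          (\<forall>F. compact F \<longrightarrow> finite ((F \<inter> X) - K)))))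
     \<and>
     \<comment> \<open>(B): (iii), (iv), (v), (vi)\<close>
     (k_dense X \<and> sequentially_closed X \<longrightarrow>
      ((\<exists>K \<subseteq> X. countable_compact_finite_height K \<and>
          (\<forall>F. compact F \<longrightarrow> finite ((F \<inter> X) - K)))
        \<longleftrightarrow>
       (\<forall>T \<in> lc_topologies_between (Tp X) (Tk UNIV :: ('a, 'k) cfun topology). strongly_GP cscale T))
      \<and>
      ((\<forall>T \<in> lc_topologies_between (Tp X) (Tk UNIV :: ('a, 'k) cfun topology). strongly_GP cscale T)
        \<longleftrightarrow>
       (\<exists>T \<in> lc_topologies_between (Tp X) (Tk UNIV :: ('a, 'k) cfun topology). strongly_GP cscale T))
      \<and>
      ((\<exists>T \<in> lc_topologies_between (Tp X) (Tk UNIV :: ('a, 'k) cfun topology). strongly_GP cscale T)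
        \<longleftrightarrow>
       X = UNIV \<and>
       (\<exists>K \<subseteq> X. countable_compact_finite_height K \<and>
          (\<forall>F \<subseteq> X. compact F \<longrightarrow> finite (F - K)))))
     \<and>
     \<comment> \<open>(C): (v) implies (vii)\<close>
     (k_dense X \<longrightarrow>
      (\<exists>T \<in> lc_topologies_between (Tp X) (Tk UNIV :: ('a, 'k) cfun topology). strongly_GP cscale T)
        \<longrightarrow>
      (\<exists>K. countable_compact_finite_height K \<and> UNIV = X \<union> K \<and>
         (\<forall>F. compact F \<longrightarrow> finite (F - K))))
     \<and>
     \<comment> \<open>(D)\<close>
     (\<forall>K \<subseteq> X. countable_compact_finite_height K \<and>
         (\<forall>F. compact F \<longrightarrow> finite ((F \<inter> X) - K)) \<longrightarrow>
      (\<forall>T \<in> lc_topologies_between (Tp X) (Tk X :: ('a, 'k) cfun topology).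
         \<exists>\<mu>. witnesses_strongly_GP cscale T \<mu> \<and>
             (\<forall>n. finite (supp (\<mu> n)) \<and> supp (\<mu> n) \<subseteq> K))
      \<and>
      (k_dense X \<and> sequentially_closed X \<longrightarrow>
       (\<forall>T \<in> lc_topologies_between (Tp X) (Tk UNIV :: ('a, 'k) cfun topology).
          \<exists>\<mu>. witnesses_strongly_GP cscale T \<mu> \<and>
              (\<forall>n. finite (supp (\<mu> n)) \<and> supp (\<mu> n) \<subseteq> K))))"
proof -
  let ?fin = "\<lambda>K. \<forall>F. compact F \<longrightarrow> finite ((F \<inter> X) - K)"
  let ?iii = "\<exists>K \<subseteq> X. countable_compact_finite_height K \<and> ?fin K"
  let ?TX = "lc_topologies_between (Tp X) (Tk X :: ('a, 'k) cfun topology)"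
  let ?TM = "lc_topologies_between (Tp X) (Tk UNIV :: ('a, 'k) cfun topology)"
  let ?sGP = "strongly_GP (cscale :: 'k \<Rightarrow> ('a, 'k) cfun \<Rightarrow> ('a, 'k) cfun)"
  let ?vi = "X = UNIV \<and> (\<exists>K \<subseteq> X. countable_compact_finite_height K \<and>
          (\<forall>F \<subseteq> X. compact F \<longrightarrow> finite (F - K)))"
  let ?finsupp = "\<lambda>K T. \<exists>\<mu>. witnesses_strongly_GP cscale T (\<mu> :: nat \<Rightarrow> ('a, 'k) cfun \<Rightarrow> 'k) \<and>
             (\<forall>n. finite (supp (\<mu> n)) \<and> supp (\<mu> n) \<subseteq> K)"
  have X: "lc_topology_between X X T" if "T \<in> ?TX" for T
    using that tychonoff mu by unfold_locales auto
  have M: "lc_topology_between X UNIV T" if "T \<in> ?TM" "k_dense X" for T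
    using that tychonoff mu by unfold_locales auto
  have Tp_X: "Tp X \<in> ?TX" and Tp_M: "Tp X \<in> ?TM"
    by (rule Tp_in_lc_topologies_between[OF dense]; simp)+
  have D_X: "?finsupp K T" if "K \<subseteq> X" "countable_compact_finite_height K" "?fin K" "T \<in> ?TX" for K T
    by (rule lc_topology_between.ex_finitely_supported_witness[OF X[OF that(4)] that(1,2)])
      (use that(3) in simp)
  have D_M: "?finsupp K T"
    if "K \<subseteq> X" "countable_compact_finite_height K" "?fin K" "T \<in> ?TM" "k_dense X" for K T
    by (rule lc_topology_between.ex_finitely_supported_witness[OF M[OF that(4,5)] that(1,2)])
      (use that(3) in simp)
  have sGP_I: "?sGP T" if "?finsupp K T" for K T
  proof -
    from that obtain \<mu> :: "nat \<Rightarrow> ('a, 'k) cfun \<Rightarrow> 'k" where "witnesses_strongly_GP cscale T \<mu>"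
      by (elim exE conjE)
    then show ?thesis
      unfolding strongly_GP_def by (intro exI[of _ \<mu>])
  qed
  have iii_i: "\<forall>T\<in>?TX. ?sGP T" if iii: ?iii
  proof
    fix T assume T: "T \<in> ?TX"
    obtain K where "K \<subseteq> X" "countable_compact_finite_height K" "?fin K"
      using iii by blast
    from D_X[OF this T] show "?sGP T"
      by (rule sGP_I)
  qed
  have ii_iii: ?iii if T: "T \<in> ?TX" "?sGP T" for T
  proof -
    obtain A where A: "countable_compact_finite_height (closure A)"
      "\<And>H. compact H \<Longrightarrow> finite (H \<inter> X - closure A)" "closure A \<subseteq> X"
      by (rule lc_topology_between.strongly_GP_imp[OF X[OF T(1)] T(2)]) blast
    then show ?iii
      by blast
  qed
  have iii_iv: "\<forall>T\<in>?TM. ?sGP T" if iii: ?iii and k: "k_dense X"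
  proof
    fix T assume T: "T \<in> ?TM"
    obtain K where "K \<subseteq> X" "countable_compact_finite_height K" "?fin K"
      using iii by blast
    from D_M[OF this T k] show "?sGP T"
      by (rule sGP_I)
  qed
  have v: "\<exists>A\<subseteq>X. countable_compact_finite_height (closure A) \<and> X \<union> closure A = UNIV \<and>
      (\<forall>F. compact F \<longrightarrow> finite (F - closure A))" if T: "T \<in> ?TM" "?sGP T" and k: "k_dense X" for T
  proof -
    obtain A where A: "A \<subseteq> X" "countable_compact_finite_height (closure A)"
      "\<And>H. compact H \<Longrightarrow> finite (H \<inter> X - closure A)"
      by (rule lc_topology_between.strongly_GP_imp[OF M[OF T(1) k] T(2)]) blast
    \<comment> \<open>Finiteness is known only for points of \<open>X\<close>. K-density supplies a
      compact \<open>S\<close> around \<open>F\<close> in which they are dense, and the closed set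
      formed by \<open>closure A\<close> and finitely many points contains them, hence all of
      \<open>S\<close>.\<close>
    have cover: "\<exists>G. finite G \<and> G \<subseteq> X \<and> F \<subseteq> closure A \<union> G" if F: "compact F" for F
    proof -
      obtain S where S: "compact S" "F \<subseteq> S" "S \<subseteq> closure (S \<inter> X)"
        using k F unfolding k_dense_def by blast
      define G where "G = S \<inter> X - closure A"
      have G: "finite G"
        unfolding G_def by (rule A(3)[OF S(1)])
      have "closure (S \<inter> X) \<subseteq> closure A \<union> G"
        by (intro closure_minimal closed_Un closed_closure finite_imp_closed[OF G]) (auto simp: G_def)
      then show ?thesis
        using S G by (intro exI[of _ G]) (auto simp: G_def)
    qed
    have "finite (F - closure A)" if "compact F" for F
    proof -
      from cover[OF that] obtain G where G: "finite G" "F \<subseteq> closure A \<union> G"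
        by (elim exE conjE)
      have "F - closure A \<subseteq> G"
        using G(2) by auto
      then show ?thesis
        using G(1) by (rule finite_subset)
    qed
    moreover have "x \<in> X \<union> closure A" for x
    proof -
      \<comment> \<open>Singletons as compact sets show that every point outside
        \<open>closure A\<close> belongs to \<open>X\<close>.\<close>
      have "compact {x}"
        by simp
      from cover[OF this] obtain G where "G \<subseteq> X" "{x} \<subseteq> closure A \<union> G"
        by (elim exE conjE)
      then show ?thesis
        by auto
    qed
    then have "X \<union> closure A = UNIV"
      by auto
    ultimately show ?thesis
      using A(1,2) by (intro exI[of _ A] conjI allI impI)
  qed
  have v_vi: ?vi if T: "T \<in> ?TM" "?sGP T" "k_dense X" and seq: "sequentially_closed X" for T
  proof -
    from v[OF T] obtain A where A: "A \<subseteq> X" "countable_compact_finite_height (closure A)"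
      "X \<union> closure A = UNIV" "\<forall>F. compact F \<longrightarrow> finite (F - closure A)"
      by (elim exE conjE)
    \<comment> \<open>The closure is already known to be countable and compact, so sequential
      closedness can bring it into \<open>X\<close>, and the cover then leaves no point outside
      \<open>X\<close>.\<close>
    have sub: "closure A \<subseteq> X"
      using closure_subset_if_sequentially_closed[OF tychonoff seq A(1)] A(2)
      by (simp add: countable_compact_finite_height_def)
    show ?vi
    proof (intro conjI exI[of _ "closure A"])
      show "X = UNIV"
        using A(3) sub by auto
      show "\<forall>F\<subseteq>X. compact F \<longrightarrow> finite (F - closure A)"
        using A(4) by simp
    qed (use A(2) sub in auto)
  qed
  have vi_iii: ?iii if ?vi
    using that by auto
  have ii: "\<exists>T\<in>?TX. ?sGP T" if "\<forall>T\<in>?TX. ?sGP T"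
    using bspec[OF that Tp_X] Tp_X by (rule bexI)
  have ii_iii': ?iii if "\<exists>T\<in>?TX. ?sGP T"
    using that by (elim bexE) (rule ii_iii)
  have "((\<forall>T\<in>?TX. ?sGP T) \<longleftrightarrow> (\<exists>T\<in>?TX. ?sGP T)) \<and> ((\<exists>T\<in>?TX. ?sGP T) \<longleftrightarrow> ?iii)"
    using iii_i ii ii_iii' by argo
  moreover have "k_dense X \<and> sequentially_closed X \<longrightarrow>
      (?iii \<longleftrightarrow> (\<forall>T\<in>?TM. ?sGP T)) \<and> ((\<forall>T\<in>?TM. ?sGP T) \<longleftrightarrow> (\<exists>T\<in>?TM. ?sGP T)) \<and>
      ((\<exists>T\<in>?TM. ?sGP T) \<longleftrightarrow> ?vi)"
  proof
    assume k: "k_dense X \<and> sequentially_closed X"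
    have 1: "\<forall>T\<in>?TM. ?sGP T" if ?iii
      using that k by (elim conjE) (rule iii_iv)
    have 2: ?vi if "\<exists>T\<in>?TM. ?sGP T"
      using that k by (elim bexE conjE) (rule v_vi)
    have 3: "\<exists>T\<in>?TM. ?sGP T" if "\<forall>T\<in>?TM. ?sGP T"
      using bspec[OF that Tp_M] Tp_M by (rule bexI)
    show "(?iii \<longleftrightarrow> (\<forall>T\<in>?TM. ?sGP T)) \<and> ((\<forall>T\<in>?TM. ?sGP T) \<longleftrightarrow> (\<exists>T\<in>?TM. ?sGP T)) \<and>
      ((\<exists>T\<in>?TM. ?sGP T) \<longleftrightarrow> ?vi)"
      using 1 2 3 vi_iii by argo
  qed
  moreover have "k_dense X \<longrightarrow> (\<exists>T\<in>?TM. ?sGP T) \<longrightarrow>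
      (\<exists>K. countable_compact_finite_height K \<and> UNIV = X \<union> K \<and>
         (\<forall>F. compact F \<longrightarrow> finite (F - K)))"
  proof (intro impI)
    assume k: "k_dense X" and "\<exists>T\<in>?TM. ?sGP T"
    then obtain T where "T \<in> ?TM" "?sGP T"
      by (elim bexE)
    from v[OF this k] obtain A where "countable_compact_finite_height (closure A)"
      "X \<union> closure A = UNIV" "\<forall>F. compact F \<longrightarrow> finite (F - closure A)"
      by (elim exE conjE)
    then show "\<exists>K. countable_compact_finite_height K \<and> UNIV = X \<union> K \<and>
         (\<forall>F. compact F \<longrightarrow> finite (F - K))"
      by (intro exI[of _ "closure A"]) simp
  qed
  moreover have "\<forall>K\<subseteq>X. countable_compact_finite_height K \<and> ?fin K \<longrightarrow>
      (\<forall>T\<in>?TX. ?finsupp K T) \<and>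
      (k_dense X \<and> sequentially_closed X \<longrightarrow> (\<forall>T\<in>?TM. ?finsupp K T))"
    using D_X D_M by simp
  ultimately show ?thesis
    by (intro conjI) (assumption | simp only:)+
qed

end
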